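(* Let $\mathcal{M}$ be an $\mathrm{L}_\mathcal{M}$-structure, $\mathfrak{N}:=\{\mathcal{N}_a\}_{a\in\mathcal{M}}$ a class of $\mathrm{L}_\mathfrak{N}$-structures, and $\mathcal{S}=\mathcal{M}[\mathfrak{N}]$ their lexicographic product. Assume that for every sentence $\phi\in\mathrm{L}_\mathfrak{N}$, the set $\{a\in\mathcal{M}\mid\mathcal{N}_a\models\phi\}$ is $\emptyset$-definable in $\mathcal{M}$. Then $$\mathrm{bdn}(\mathcal{S})=\sup\left(\mathrm{bdn}(\mathcal{M}),\ \mathrm{bdn}(\mathcal{N}_\rho),\ \rho\in S_1^{\mathrm{Th}(\mathcal{M})}\right).$$ If $\mathcal{M}$ is $|\mathrm{L}_\mathfrak{N}|^+$-saturated, then $$\mathrm{bdn}(\mathcal{S})=\sup\left(\mathrm{bdn}(\mathcal{M}),\ \mathrm{bdn}(\mathcal{N}_a),\ a\in\mathcal{M}\right).$$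
   Context: $\mathrm{L}_\mathcal{M},\mathrm{L}_\mathfrak{N}$ are disjoint languages, not necessarily relational. Lexicographic product (sum): $\mathcal{M}[\mathfrak{N}]$ is the multisorted structure with a main sort $S:=\bigcup_{a\in\mathcal{M}}\{a\}\times\mathcal{N}_a$, a sort for the structure $\mathcal{M}$ (in $\mathrm{L}_\mathcal{M}$), and the projection $v:S\to\mathcal{M}$, $(a,b)\mapsto a$. The sort $S$ carries a structure in a copy $\{P_\bullet\}_{P\in\mathrm{L}_\mathfrak{N}}$ of $\mathrm{L}_\mathfrak{N}$. For an $n$-ary predicate $P$, $P_\bullet:=\{((a,b_1),\dots,(a,b_n))\mid a\in\mathcal{M},\ \mathcal{N}_a\models P(b_1,\dots,b_n)\}$. For an $n$-ary function symbol $f$, $f_\bullet((a_1,b_1),\dots,(a_n,b_n)):=(a,f^{\mathcal{N}_a}(b_1,\dots,b_n))$ if $a_1=\dots=a_n=a$, and $:=u$ otherwise, where $u$ is a constant standing for "undetermined". $\mathcal{N}_\rho$: $S_1^{\mathrm{Th}(\mathcal{M})}$ is the set of complete $1$-types over $\emptyset$ of $\mathrm{Th}(\mathcal{M})$; for $\rho$ in it, $\mathcal{N}_\rho$ denotes the ultraproduct $\prod_\mathcal{U}\mathcal{N}_a$ for any ultrafilter $\mathcal{U}$ on $\mathcal{M}$ containing $\{\phi(\mathcal{M})\mid\phi\in\rho\}$; by the definability assumption its theory does not depend on $\mathcal{U}$. Burden: an inp-pattern of depth $\kappa$ in a variable $x$ is a family $\{\phi_i(x,y_i),(a_{i,j})_{j<\omega},k_i\}_{i<\kappa}$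 of formulas, parameters (in a sufficiently saturated model) and integers $k_i$ such that for each $i$ the row $\{\phi_i(x,a_{i,j})\}_{j<\omega}$ is $k_i$-inconsistent, and for every $f:\kappa\to\omega$ the path $\{\phi_i(x,a_{i,f(i)})\}_{i<\kappa}$ is consistent. The burden $\mathrm{bdn}$ of a structure is the supremum of the depths of inp-patterns in a single variable $x$. *)

theory Defs
  imports Main "HOL-Library.FuncSet"
begin

unbundle cardinal_syntax

section \<open>Cardinals\<close>

text \<open>
  The cardinals \<open>\<le> |'u|\<close>, as the sets of elements of \<open>'u\<close> up to bijection.  A supremum formed in
  this complete linear order is the true supremum cut off at \<open>|'u|\<close>; in particular
  "unbounded" is rendered as \<open>top = |'u|\<close>.  As \<open>'u\<close> is a type variable, that is, arbitrarily
  large, an identity proved over \<open>'u\<close> is the identity of the true suprema (including the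
  value \<open>\<infinity>\<close>).
\<close>

quotient_type 'u cardinal = "'u set" / "\<lambda>A B. |A| =o |B|"
  morphisms rep_cardinal cardinality
  by (intro equivpI reflpI sympI transpI)
    (auto intro: ordIso_symmetric ordIso_transitive card_of_refl)

instantiation cardinal :: (type) linorder
begin

lift_definition less_eq_cardinal :: "'a cardinal \<Rightarrow> 'a cardinal \<Rightarrow> bool"
  is "\<lambda>A B. |A| \<le>o |B|"
  by (meson ordIso_ordLeq_trans ordIso_symmetric ordLeq_ordIso_trans)

lift_definition less_cardinal :: "'a cardinal \<Rightarrow> 'a cardinal \<Rightarrow> bool"
  is "\<lambda>A B. |A| <o |B|"
  by (meson ordIso_ordLess_trans ordIso_symmetric ordLess_ordIso_trans)

instance
proof
  fix x y z :: "'a cardinal"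
  show "x < y \<longleftrightarrow> x \<le> y \<and> \<not> y \<le> x"
    by transfer (meson card_of_Well_order not_ordLess_ordLeq ordLess_imp_ordLeq not_ordLeq_iff_ordLess)
  show "x \<le> x" by transfer (rule ordLeq_reflexive[OF card_of_Well_order])
  show "x \<le> y \<Longrightarrow> y \<le> z \<Longrightarrow> x \<le> z" by transfer (rule ordLeq_transitive)
  show "x \<le> y \<Longrightarrow> y \<le> x \<Longrightarrow> x = y" by transfer (simp add: ordIso_iff_ordLeq)
  show "x \<le> y \<or> y \<le> x" by transfer (simp add: ordLeq_total[OF card_of_Well_order card_of_Well_order])
qed

end

lemma wf_cardinal: "wf {(x :: 'u cardinal, y). x < y}"
proof (rule wf_subset[OF wf_inv_image[OF wf_ordLess, of "\<lambda>c. |rep_cardinal c| "]], clarify)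
  fix x y :: "'u cardinal"
  have rep: "cardinality (rep_cardinal c) = c" for c :: "'u cardinal"
    by (rule Quotient_abs_rep[OF Quotient_cardinal])
  assume "x < y"
  then have "cardinality (rep_cardinal x) < cardinality (rep_cardinal y)" by (simp add: rep)
  then show "(x, y) \<in> inv_image ordLess (\<lambda>c. |rep_cardinal c| )"
    by (simp add: less_cardinal.abs_eq)
qed

instance cardinal :: (type) wellorder
  by (rule wf_wellorderI[OF wf_cardinal]) intro_classes

instantiation cardinal :: (type) complete_linorder
begin

definition "bot_cardinal = cardinality ({} :: 'a set)"
definition "top_cardinal = cardinality (UNIV :: 'a set)"
definition "inf_cardinal = (min :: 'a cardinal \<Rightarrow> _)"
definition "sup_cardinal = (max :: 'a cardinal \<Rightarrow> _)"
definition "Inf_cardinal X = (if X = {} then top else LEAST c :: 'a cardinal. c \<in> X)"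
definition "Sup_cardinal X = (LEAST c :: 'a cardinal. \<forall>x\<in>X. x \<le> c)"

instance
proof
  have top: "c \<le> top" for c :: "'a cardinal"
    unfolding top_cardinal_def by transfer (simp add: card_of_mono1)
  have bot: "bot \<le> c" for c :: "'a cardinal"
    unfolding bot_cardinal_def by transfer (simp add: card_of_mono1)
  fix x y z :: "'a cardinal" and X :: "'a cardinal set"
  show "x \<in> X \<Longrightarrow> Inf X \<le> x" by (auto simp: Inf_cardinal_def intro: Least_le)
  show "(\<And>x. x \<in> X \<Longrightarrow> z \<le> x) \<Longrightarrow> z \<le> Inf X"
    using LeastI[of "\<lambda>c. c \<in> X"] by (cases "X = {}") (auto simp: Inf_cardinal_def top)
  show "x \<in> X \<Longrightarrow> x \<le> Sup X"
    using LeastI[of "\<lambda>c. \<forall>x\<in>X. x \<le> c" top] top by (auto simp: Sup_cardinal_def)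
  show "(\<And>x. x \<in> X \<Longrightarrow> x \<le> z) \<Longrightarrow> Sup X \<le> z"
    by (auto simp: Sup_cardinal_def intro: Least_le)
  show "Inf {} = (top :: 'a cardinal)" by (simp add: Inf_cardinal_def)
  show "Sup {} = (bot :: 'a cardinal)"
    using Least_le[of "\<lambda>_. True" "bot :: 'a cardinal"] bot
    by (auto simp: Sup_cardinal_def intro: antisym)
qed (simp_all add: inf_cardinal_def sup_cardinal_def)

end


section \<open>Many-sorted first-order logic with equality\<close>

text \<open>One-sorted languages and structures are those whose type of sorts is \<^typ>\<open>unit\<close>.\<close>

record ('s, 'f, 'p) lang =
  funs :: "'f set"
  fun_dom :: "'f \<Rightarrow> 's list"
  fun_cod :: "'f \<Rightarrow> 's"
  rels :: "'p set"
  rel_dom :: "'p \<Rightarrow> 's list"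

type_synonym 's var = "'s \<times> nat"

datatype ('s, 'f) trm =
    Var "'s var"
  | Fn 'f "('s, 'f) trm list"

datatype ('s, 'f, 'p) fm =
    Eq "('s, 'f) trm" "('s, 'f) trm"
  | Rel 'p "('s, 'f) trm list"
  | Neg "('s, 'f, 'p) fm"
  | Conj "('s, 'f, 'p) fm" "('s, 'f, 'p) fm"
  | Ex "'s var" "('s, 'f, 'p) fm"

inductive has_sort :: "('s, 'f, 'p) lang \<Rightarrow> ('s, 'f) trm \<Rightarrow> 's \<Rightarrow> bool" for L where
  "has_sort L (Var x) (fst x)"
| "f \<in> funs L \<Longrightarrow> list_all2 (has_sort L) ts (fun_dom L f) \<Longrightarrow> has_sort L (Fn f ts) (fun_cod L f)"

primrec wf_fm :: "('s, 'f, 'p) lang \<Rightarrow> ('s, 'f, 'p) fm \<Rightarrow> bool" where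
  "wf_fm L (Eq t t') \<longleftrightarrow> (\<exists>s. has_sort L t s \<and> has_sort L t' s)"
| "wf_fm L (Rel P ts) \<longleftrightarrow> P \<in> rels L \<and> list_all2 (has_sort L) ts (rel_dom L P)"
| "wf_fm L (Neg \<phi>) \<longleftrightarrow> wf_fm L \<phi>"
| "wf_fm L (Conj \<phi> \<psi>) \<longleftrightarrow> wf_fm L \<phi> \<and> wf_fm L \<psi>"
| "wf_fm L (Ex x \<phi>) \<longleftrightarrow> wf_fm L \<phi>"

primrec fvt :: "('s, 'f) trm \<Rightarrow> 's var set" where
  "fvt (Var x) = {x}"
| "fvt (Fn f ts) = \<Union> (set (map fvt ts))"

primrec fv :: "('s, 'f, 'p) fm \<Rightarrow> 's var set" where
  "fv (Eq t t') = fvt t \<union> fvt t'"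
| "fv (Rel P ts) = \<Union> (fvt ` set ts)"
| "fv (Neg \<phi>) = fv \<phi>"
| "fv (Conj \<phi> \<psi>) = fv \<phi> \<union> fv \<psi>"
| "fv (Ex x \<phi>) = fv \<phi> - {x}"

text \<open>
  The set of formulas of \<open>L\<close>.  The cardinality \<open>|L|\<close> of a language is, as usual, the number of
  its formulas, i.e. \<open>\<aleph>\<^sub>0\<close> plus the number of its symbols in the one-sorted case.
\<close>

definition fms :: "('s, 'f, 'p) lang \<Rightarrow> ('s, 'f, 'p) fm set" where
  "fms L = {\<phi>. wf_fm L \<phi>}"

definition sentences :: "('s, 'f, 'p) lang \<Rightarrow> ('s, 'f, 'p) fm set" where
  "sentences L = {\<phi> \<in> fms L. fv \<phi> = {}}"

text \<open>
  The values of \<open>fun_int\<close> and \<open>rel_int\<close> at arguments that do not fit the declared sorts are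
  irrelevant.  The carriers of different sorts need not be disjoint.
\<close>

record ('s, 'f, 'p, 'a) struct =
  univ :: "'s \<Rightarrow> 'a set"
  fun_int :: "'f \<Rightarrow> 'a list \<Rightarrow> 'a"
  rel_int :: "'p \<Rightarrow> 'a list \<Rightarrow> bool"

definition is_struct :: "('s, 'f, 'p) lang \<Rightarrow> ('s, 'f, 'p, 'a) struct \<Rightarrow> bool" where
  "is_struct L M \<longleftrightarrow>
     (\<forall>s. univ M s \<noteq> {}) \<and>
     (\<forall>f\<in>funs L. \<forall>as. list_all2 (\<lambda>a s. a \<in> univ M s) as (fun_dom L f)
        \<longrightarrow> fun_int M f as \<in> univ M (fun_cod L f))"

definition assignments :: "('s, 'f, 'p, 'a) struct \<Rightarrow> ('s var \<Rightarrow> 'a) set" where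
  "assignments M = {e. \<forall>x. e x \<in> univ M (fst x)}"

primrec eval :: "('s, 'f, 'p, 'a) struct \<Rightarrow> ('s var \<Rightarrow> 'a) \<Rightarrow> ('s, 'f) trm \<Rightarrow> 'a" where
  "eval M e (Var x) = e x"
| "eval M e (Fn f ts) = fun_int M f (map (eval M e) ts)"

primrec sat :: "('s, 'f, 'p, 'a) struct \<Rightarrow> ('s var \<Rightarrow> 'a) \<Rightarrow> ('s, 'f, 'p) fm \<Rightarrow> bool" where
  "sat M e (Eq t t') \<longleftrightarrow> eval M e t = eval M e t'"
| "sat M e (Rel P ts) \<longleftrightarrow> rel_int M P (map (eval M e) ts)"
| "sat M e (Neg \<phi>) \<longleftrightarrow> \<not> sat M e \<phi>"
| "sat M e (Conj \<phi> \<psi>) \<longleftrightarrow> sat M e \<phi> \<and> sat M e \<psi>"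
| "sat M e (Ex x \<phi>) \<longleftrightarrow> (\<exists>a\<in>univ M (fst x). sat M (e(x := a)) \<phi>)"

definition models :: "('s, 'f, 'p, 'a) struct \<Rightarrow> ('s, 'f, 'p) fm \<Rightarrow> bool" (infix "\<Turnstile>" 50) where
  "M \<Turnstile> \<phi> \<longleftrightarrow> (\<forall>e\<in>assignments M. sat M e \<phi>)"

definition Th :: "('s, 'f, 'p) lang \<Rightarrow> ('s, 'f, 'p, 'a) struct \<Rightarrow> ('s, 'f, 'p) fm set" where
  "Th L M = {\<phi> \<in> sentences L. M \<Turnstile> \<phi>}"

text \<open>
  \<open>\<kappa>\<close>-saturation.  A partial type in the variable \<open>x\<close> over \<open>A\<close> is a set of pairs \<open>(\<phi>, e)\<close>, where
  \<open>e\<close> assigns elements of \<open>A\<close> to the free variables of \<open>\<phi>\<close> other than \<open>x\<close>.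
\<close>

definition partial_type ::
  "('s, 'f, 'p) lang \<Rightarrow> ('s, 'f, 'p, 'a) struct \<Rightarrow> 's var \<Rightarrow> 'a set
    \<Rightarrow> (('s, 'f, 'p) fm \<times> ('s var \<Rightarrow> 'a)) set \<Rightarrow> bool" where
  "partial_type L M x A p \<longleftrightarrow>
     (\<forall>(\<phi>, e)\<in>p. \<phi> \<in> fms L \<and> (\<forall>y\<in>fv \<phi> - {x}. e y \<in> univ M (fst y) \<inter> A)) \<and>
     (\<forall>q\<subseteq>p. finite q \<longrightarrow> (\<exists>b\<in>univ M (fst x). \<forall>(\<phi>, e)\<in>q. sat M (e(x := b)) \<phi>))"

definition saturated ::
  "'k rel \<Rightarrow> ('s, 'f, 'p) lang \<Rightarrow> ('s, 'f, 'p, 'a) struct \<Rightarrow> bool" where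
  "saturated \<kappa> L M \<longleftrightarrow>
     (\<forall>x A p. |A| <o \<kappa> \<longrightarrow> partial_type L M x A p \<longrightarrow>
        (\<exists>b\<in>univ M (fst x). \<forall>(\<phi>, e)\<in>p. sat M (e(x := b)) \<phi>))"


section \<open>Burden\<close>

text \<open>
  An inp-pattern of depth \<open>|I|\<close> in the variable \<open>x\<close>, with parameters in \<open>M\<close>.  The tuple \<open>y\<^sub>i\<close>
  consists of the free variables of \<open>\<phi> i\<close> other than \<open>x\<close>, and \<open>a i j\<close> is an assignment whose
  restriction to \<open>y\<^sub>i\<close> is the parameter tuple \<open>a\<^sub>i\<^sub>,\<^sub>j\<close>.  A path is consistent if it is finitely
  satisfiable in \<open>M\<close>.
\<close>

definition inp_pattern ::
  "('s, 'f, 'p) lang \<Rightarrow> ('s, 'f, 'p, 'a) struct \<Rightarrow> 's var \<Rightarrow> 'i set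
    \<Rightarrow> ('i \<Rightarrow> ('s, 'f, 'p) fm) \<Rightarrow> ('i \<Rightarrow> nat \<Rightarrow> 's var \<Rightarrow> 'a) \<Rightarrow> ('i \<Rightarrow> nat) \<Rightarrow> bool" where
  "inp_pattern L M x I \<phi> a k \<longleftrightarrow>
     (\<forall>i\<in>I. \<phi> i \<in> fms L \<and> (\<forall>j. a i j \<in> assignments M)) \<and>
     (\<forall>i\<in>I. \<forall>J. finite J \<and> card J = k i \<longrightarrow>
        \<not> (\<exists>b\<in>univ M (fst x). \<forall>j\<in>J. sat M ((a i j)(x := b)) (\<phi> i))) \<and>
     (\<forall>f. \<forall>I0\<subseteq>I. finite I0 \<longrightarrow>
        (\<exists>b\<in>univ M (fst x). \<forall>i\<in>I0. sat M ((a i (f i))(x := b)) (\<phi> i)))"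

text \<open>
  The variable \<open>x\<close> may be of any sort.  The parameters are allowed to lie in an arbitrary model \<open>M'\<close>
  of \<open>Th(M)\<close>, which amounts to taking them in one sufficiently saturated model: every \<open>M'\<close> embeds
  elementarily into such a model, and by Loewenheim-Skolem a pattern of depth \<open>\<le> |'u|\<close> already lives
  in an elementary submodel whose elements are indexed by the type
  \<^typ>\<open>'s + 'f + 'p + 'u + nat\<close> chosen below.
\<close>

definition bdn :: "('s, 'f, 'p) lang \<Rightarrow> ('s, 'f, 'p, 'a) struct \<Rightarrow> 'u cardinal" where
  "bdn L M = Sup {cardinality I | I :: 'u set.
     \<exists>(M' :: ('s, 'f, 'p, 's + 'f + 'p + 'u + nat) struct) x \<phi> a k.
       is_struct L M' \<and> (\<forall>\<psi>\<in>Th L M. M' \<Turnstile> \<psi>) \<and> inp_pattern L M' x I \<phi> a k}"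


section \<open>One-sorted structures: definable sets, types, ultraproducts\<close>

abbreviation dom1 :: "(unit, 'f, 'p, 'a) struct \<Rightarrow> 'a set" where
  "dom1 M \<equiv> univ M ()"

definition fms1 :: "(unit, 'f, 'p) lang \<Rightarrow> (unit, 'f, 'p) fm set" where
  "fms1 L = {\<phi> \<in> fms L. fv \<phi> \<subseteq> {((), 0)}}"

text \<open>The set \<open>\<phi>(M)\<close>, for \<open>\<phi>\<close> in \<^term>\<open>fms1 L\<close>.\<close>

definition solutions :: "(unit, 'f, 'p, 'a) struct \<Rightarrow> (unit, 'f, 'p) fm \<Rightarrow> 'a set" where
  "solutions M \<phi> = {a \<in> dom1 M. sat M (\<lambda>_. a) \<phi>}"

definition definable0 :: "(unit, 'f, 'p) lang \<Rightarrow> (unit, 'f, 'p, 'a) struct \<Rightarrow> 'a set \<Rightarrow> bool" where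
  "definable0 L M X \<longleftrightarrow> (\<exists>\<phi>\<in>fms1 L. X = solutions M \<phi>)"

text \<open>
  Complete 1-types over the empty set.  As \<open>Th(M)\<close> is complete, a set of formulas is consistent with
  it iff it is finitely satisfiable in \<open>M\<close>.
\<close>

definition S1 :: "(unit, 'f, 'p) lang \<Rightarrow> (unit, 'f, 'p, 'a) struct \<Rightarrow> (unit, 'f, 'p) fm set set" where
  "S1 L M = {\<rho>. \<rho> \<subseteq> fms1 L \<and>
     (\<forall>q\<subseteq>\<rho>. finite q \<longrightarrow> (\<exists>a\<in>dom1 M. \<forall>\<phi>\<in>q. a \<in> solutions M \<phi>)) \<and>
     (\<forall>\<phi>\<in>fms1 L. \<phi> \<in> \<rho> \<or> Neg \<phi> \<in> \<rho>)}"

definition ultrafilter_on :: "'a set \<Rightarrow> 'a filter \<Rightarrow> bool" where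
  "ultrafilter_on A U \<longleftrightarrow> U \<noteq> bot \<and> eventually (\<lambda>a. a \<in> A) U \<and>
     (\<forall>P. eventually P U \<or> eventually (\<lambda>a. \<not> P a) U)"

definition uclass :: "'i set \<Rightarrow> 'i filter \<Rightarrow> ('i \<Rightarrow> 'a set) \<Rightarrow> ('i \<Rightarrow> 'a) \<Rightarrow> ('i \<Rightarrow> 'a) set" where
  "uclass A U X g = {h \<in> Pi A X. eventually (\<lambda>i. h i = g i) U}"

text \<open>Elements of the ultraproduct are equivalence classes; \<^term>\<open>SOME g. g \<in> c\<close> picks a representative.\<close>

definition ultraproduct ::
  "'i set \<Rightarrow> 'i filter \<Rightarrow> ('i \<Rightarrow> (unit, 'f, 'p, 'a) struct) \<Rightarrow> (unit, 'f, 'p, ('i \<Rightarrow> 'a) set) struct"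
  where
  "ultraproduct A U N = \<lparr>
     univ = \<lambda>_. uclass A U (\<lambda>i. dom1 (N i)) ` (\<Pi> i\<in>A. dom1 (N i)),
     fun_int = \<lambda>f cs. uclass A U (\<lambda>i. dom1 (N i))
       (\<lambda>i. fun_int (N i) f (map (\<lambda>c. (SOME g. g \<in> c) i) cs)),
     rel_int = \<lambda>P cs. eventually (\<lambda>i. rel_int (N i) P (map (\<lambda>c. (SOME g. g \<in> c) i) cs)) U\<rparr>"


section \<open>Lexicographic product\<close>

text \<open>
  Besides the main sort \<open>S = \<Union>a\<in>M. {a} \<times> N\<^sub>a\<close> and the sort of \<open>M\<close>, there is a sort \<open>S \<union> {u}\<close>: the
  functions \<open>f\<^sub>\<bullet>\<close> are defined on powers of \<open>S\<close> and take values in \<open>S \<union> {u}\<close>, whereas the projection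
  \<open>v\<close> is only defined on \<open>S\<close>.  The language contains the constant \<open>u\<close> and the inclusion of \<open>S\<close>
  into \<open>S \<union> {u}\<close>.
\<close>

datatype lex_sort = Main_Sort | Base_Sort | Main_Undet_Sort

datatype ('f, 'g) lex_fun = Base_Fun 'f | Bullet_Fun 'g | Proj | Incl | Undet

datatype ('p, 'q) lex_rel = Base_Rel 'p | Bullet_Rel 'q

datatype ('a, 'b) lex_elem = Pt (fst_pt: 'a) (snd_pt: 'b) | Base (the_base: 'a) | Undetermined

definition lex_lang ::
  "(unit, 'f, 'p) lang \<Rightarrow> (unit, 'g, 'q) lang \<Rightarrow> (lex_sort, ('f, 'g) lex_fun, ('p, 'q) lex_rel) lang"
  where
  "lex_lang LM LN = \<lparr>
     funs = Base_Fun ` funs LM \<union> Bullet_Fun ` funs LN \<union> {Proj, Incl, Undet},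
     fun_dom = (\<lambda>h. case h of
         Base_Fun f \<Rightarrow> map (\<lambda>_. Base_Sort) (fun_dom LM f)
       | Bullet_Fun f \<Rightarrow> map (\<lambda>_. Main_Sort) (fun_dom LN f)
       | Proj \<Rightarrow> [Main_Sort]
       | Incl \<Rightarrow> [Main_Sort]
       | Undet \<Rightarrow> []),
     fun_cod = (\<lambda>h. case h of
         Base_Fun f \<Rightarrow> Base_Sort
       | Bullet_Fun f \<Rightarrow> Main_Undet_Sort
       | Proj \<Rightarrow> Base_Sort
       | Incl \<Rightarrow> Main_Undet_Sort
       | Undet \<Rightarrow> Main_Undet_Sort),
     rels = Base_Rel ` rels LM \<union> Bullet_Rel ` rels LN,
     rel_dom = (\<lambda>R. case R of
         Base_Rel P \<Rightarrow> map (\<lambda>_. Base_Sort) (rel_dom LM P)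
       | Bullet_Rel P \<Rightarrow> map (\<lambda>_. Main_Sort) (rel_dom LN P))\<rparr>"

definition lex_main :: "'a set \<Rightarrow> ('a \<Rightarrow> 'b set) \<Rightarrow> ('a, 'b) lex_elem set" where
  "lex_main A B = {Pt a b | a b. a \<in> A \<and> b \<in> B a}"

text \<open>
  For a constant symbol \<open>f\<close> there are no arguments that would determine \<open>a\<close>, so \<open>f\<^sub>\<bullet>\<close> is \<open>u\<close>.
\<close>

definition bullet_fun ::
  "('a \<Rightarrow> (unit, 'g, 'q, 'b) struct) \<Rightarrow> 'g \<Rightarrow> ('a, 'b) lex_elem list \<Rightarrow> ('a, 'b) lex_elem" where
  "bullet_fun N f xs =
     (if xs \<noteq> [] \<and> (\<forall>x\<in>set xs. fst_pt x = fst_pt (hd xs))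
      then Pt (fst_pt (hd xs)) (fun_int (N (fst_pt (hd xs))) f (map snd_pt xs))
      else Undetermined)"

definition bullet_rel ::
  "'a set \<Rightarrow> ('a \<Rightarrow> (unit, 'g, 'q, 'b) struct) \<Rightarrow> 'q \<Rightarrow> ('a, 'b) lex_elem list \<Rightarrow> bool" where
  "bullet_rel A N P xs \<longleftrightarrow> (\<exists>a\<in>A. \<exists>bs. xs = map (Pt a) bs \<and> rel_int (N a) P bs)"

definition lex_product ::
  "(unit, 'f, 'p, 'a) struct \<Rightarrow> ('a \<Rightarrow> (unit, 'g, 'q, 'b) struct)
    \<Rightarrow> (lex_sort, ('f, 'g) lex_fun, ('p, 'q) lex_rel, ('a, 'b) lex_elem) struct" where
  "lex_product M N = \<lparr>
     univ = (\<lambda>s. case s of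
         Main_Sort \<Rightarrow> lex_main (dom1 M) (\<lambda>a. dom1 (N a))
       | Base_Sort \<Rightarrow> Base ` dom1 M
       | Main_Undet_Sort \<Rightarrow> insert Undetermined (lex_main (dom1 M) (\<lambda>a. dom1 (N a)))),
     fun_int = (\<lambda>h xs. case h of
         Base_Fun f \<Rightarrow> Base (fun_int M f (map the_base xs))
       | Bullet_Fun f \<Rightarrow> bullet_fun N f xs
       | Proj \<Rightarrow> Base (fst_pt (hd xs))
       | Incl \<Rightarrow> hd xs
       | Undet \<Rightarrow> Undetermined),
     rel_int = (\<lambda>R xs. case R of
         Base_Rel P \<Rightarrow> rel_int M P (map the_base xs)
       | Bullet_Rel P \<Rightarrow> bullet_rel (dom1 M) N P xs)\<rparr>"

end

(*
  By compactness and Loewenheim-Skolem, the burden of a structure is the supremum of the depths of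
  those families of formulas all of whose finite approximations of an inp-pattern exist in the
  structure itself; each approximation is expressed by a single sentence.

  Lower bound: formulas of M, and formulas of a fibre N_a relativised to the fibre, are expressible in
  the product S, and an approximation in N_rho already exists in some N_a.

  Upper bound: by a back-and-forth argument every formula of S is determined by finitely many formulas
  of M about projections and formulas of the fibres about points of a common fibre; the sentences of
  the fibres are absorbed into M by the definability hypothesis.  By a product Ramsey argument all
  solutions b on the paths of a pattern in S may be assumed to have, row by row, the same signs of these
  atoms and the same position relative to the parameters.  If in no row b lies in the fibre of a
  parameter, projecting gives a pattern in M.  If in some row it does, then either the depth is 1 and M
  is infinite, hence has burden at least 1, or all solutions lie in one fibre, which gives a pattern
  there.  This fibre depends on the approximation; the limit of its types along an ultrafilter is a type
  rho for which N_rho has all the approximations.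
*)

theory Submission
  imports Defs "HOL-Library.Nat_Bijection" "HOL-Library.Countable_Set"
begin

text \<open>\<open>M\<close>, the fibres, the ultraproducts and the product live on different types
  of elements, and only sentences travel between them; this is why patterns are handled as finite
  grids. After the Ramsey step the condition on a solution is to have a prescribed colour. Rows stay
  inconsistent since the colour determines the truth of the original formula. Why there is one
  fibre: a row in which the solution meets the fibre of a parameter makes its projection a function
  of the column chosen in that row. Two such rows force it to be constant, as their columns can be
  changed one at a time. A row of the other kind cannot occur beside such a row: the projection,
  fixed by the latter, would solve the former at all columns. A single row gives no such control, so
  for finite \<open>M\<close> the projection itself is made part of the colour. Fibre functions take
  values in the sort with \<open>u\<close>, so terms of the product do not nest. This simplifies the
  atoms, but formulas of a fibre must be flattened to be written in the product; there constants and
  nullary relations lose their fibre and are replaced by parameters and by formulas of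
  \<open>M\<close>.\<close>

declare split_paired_All [simp del] split_paired_Ex [simp del]

section \<open>Syntax and semantics\<close>

lemma eval_cong: "(\<And>x. x \<in> fvt t \<Longrightarrow> e x = e' x) \<Longrightarrow> eval M e t = eval M e' t"
proof (induction t)
  case (Fn f ts)
  have "map (eval M e) ts = map (eval M e') ts"
    using Fn by (intro map_cong) auto
  then show ?case by (simp only: eval.simps)
qed simp

lemma sat_cong: "(\<And>x. x \<in> fv \<phi> \<Longrightarrow> e x = e' x) \<Longrightarrow> sat M e \<phi> = sat M e' \<phi>"
proof (induction \<phi> arbitrary: e e')
  case (Eq t t')
  then show ?case using eval_cong[of t e e' M] eval_cong[of t' e e' M] by auto
next
  case (Rel P ts)
  have "map (eval M e) ts = map (eval M e') ts"
    using Rel by (intro map_cong refl eval_cong) auto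
  then show ?case by (simp only: sat.simps)
next
  case (Neg \<phi>)
  show ?case using Neg.IH[of e e'] Neg.prems by simp
next
  case (Conj \<phi> \<psi>)
  show ?case using Conj.IH(1)[of e e'] Conj.IH(2)[of e e'] Conj.prems by simp
next
  case (Ex x \<phi>)
  have "sat M (e(x := a)) \<phi> = sat M (e'(x := a)) \<phi>" for a
    by (rule Ex.IH) (use Ex.prems in auto)
  then show ?case by simp
qed

lemma finite_fvt [simp]: "finite (fvt t)"
  by (induction t) auto

lemma finite_fv [simp]: "finite (fv \<phi>)"
  by (induction \<phi>) auto

lemma is_struct_nonempty: "is_struct L M \<Longrightarrow> univ M s \<noteq> {}"
  by (simp add: is_struct_def)

lemma ex_assignment:
  assumes "\<And>s. univ M s \<noteq> {}"
  shows "\<exists>e. e \<in> assignments M"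
  using assms by (intro exI[of _ "\<lambda>x. SOME a. a \<in> univ M (fst x)"])
    (auto simp: assignments_def some_in_eq)

lemma assignments_upd [simp]:
  "e \<in> assignments M \<Longrightarrow> a \<in> univ M (fst x) \<Longrightarrow> e(x := a) \<in> assignments M"
  by (cases x) (auto simp: assignments_def)

lemma assignmentsD: "e \<in> assignments M \<Longrightarrow> e x \<in> univ M (fst x)"
  by (simp add: assignments_def)

lemma models_iff_sat:
  assumes "fv \<phi> = {}" "\<And>s. univ M s \<noteq> {}"
  shows "M \<Turnstile> \<phi> \<longleftrightarrow> sat M e \<phi>"
proof -
  have "sat M e' \<phi> = sat M e \<phi>" for e'
    by (rule sat_cong) (simp add: assms)
  then show ?thesis using ex_assignment[OF assms(2)] by (auto simp: models_def)
qed

lemma eval_in_univ: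
  assumes K: "is_struct L K" and e: "e \<in> assignments K"
  shows "has_sort L t s \<Longrightarrow> eval K e t \<in> univ K s"
proof (induction rule: has_sort.induct)
  case (1 x)
  then show ?case using assignmentsD[OF e] by simp
next
  case (2 f ts)
  then have "list_all2 (\<lambda>a s. a \<in> univ K s) (map (eval K e) ts) (fun_dom L f)"
    by (auto simp: list_all2_map1 elim!: list_all2_mono)
  then show ?case using K 2(1) by (simp add: is_struct_def)
qed

section \<open>Renaming of variables\<close>

primrec rename_trm :: "('s var \<Rightarrow> 's var) \<Rightarrow> ('s, 'f) trm \<Rightarrow> ('s, 'f) trm" where
  "rename_trm r (Var x) = Var (r x)"
| "rename_trm r (Fn f ts) = Fn f (map (rename_trm r) ts)"

primrec rename_fm :: "('s var \<Rightarrow> 's var) \<Rightarrow> ('s, 'f, 'p) fm \<Rightarrow> ('s, 'f, 'p) fm" where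
  "rename_fm r (Eq t t') = Eq (rename_trm r t) (rename_trm r t')"
| "rename_fm r (Rel P ts) = Rel P (map (rename_trm r) ts)"
| "rename_fm r (Neg \<phi>) = Neg (rename_fm r \<phi>)"
| "rename_fm r (Conj \<phi> \<psi>) = Conj (rename_fm r \<phi>) (rename_fm r \<psi>)"
| "rename_fm r (Ex x \<phi>) = Ex (r x) (rename_fm r \<phi>)"

lemma eval_rename: "eval M e (rename_trm r t) = eval M (e \<circ> r) t"
proof (induction t)
  case (Fn f ts)
  have "map (eval M e \<circ> rename_trm r) ts = map (eval M (e \<circ> r)) ts"
    using Fn by (intro map_cong) (auto simp: o_def)
  then show ?case by (simp only: eval.simps rename_trm.simps map_map)
qed simp

text \<open>Bound variables are renamed together with the free ones, so injectivity of
  \<open>r\<close> is what rules out capture in the \<open>Ex\<close> case.\<close>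

lemma sat_rename:
  assumes "inj r" "\<And>x. fst (r x) = fst x"
  shows "sat M e (rename_fm r \<phi>) = sat M (e \<circ> r) \<phi>"
proof (induction \<phi> arbitrary: e)
  case (Rel P ts)
  have "map (eval M e \<circ> rename_trm r) ts = map (eval M (e \<circ> r)) ts"
    by (intro map_cong) (auto simp: eval_rename)
  then show ?case by (simp only: sat.simps rename_fm.simps map_map)
next
  case (Ex x \<phi>)
  have upd: "e(r x := a) \<circ> r = (e \<circ> r)(x := a)" for a
    using assms(1) by (auto simp: fun_eq_iff inj_eq)
  show ?case by (simp only: rename_fm.simps sat.simps Ex assms(2) upd)
qed (auto simp: eval_rename)

lemma has_sort_rename:
  assumes "\<And>x. fst (r x) = fst x"
  shows "has_sort L t s \<Longrightarrow> has_sort L (rename_trm r t) s"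
proof (induction rule: has_sort.induct)
  case (1 x)
  then show ?case using has_sort.intros(1)[of L "r x"] assms by simp
next
  case (2 f ts)
  then show ?case by (auto intro!: has_sort.intros simp: list_all2_map1 elim: list_all2_mono)
qed

lemma wf_rename:
  assumes "\<And>x. fst (r x) = fst x"
  shows "wf_fm L \<phi> \<Longrightarrow> wf_fm L (rename_fm r \<phi>)"
proof (induction \<phi>)
  case (Eq t t')
  then show ?case using has_sort_rename[OF assms] by auto
next
  case (Rel P ts)
  then show ?case using has_sort_rename[OF assms] by (auto simp: list_all2_map1 elim!: list_all2_mono)
qed auto

lemma fvt_rename: "fvt (rename_trm r t) = r ` fvt t"
  by (induction t) auto

lemma fv_rename: "inj r \<Longrightarrow> fv (rename_fm r \<phi>) = r ` fv \<phi>"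
  by (induction \<phi>) (auto simp: fvt_rename inj_eq)

section \<open>Finite conjunctions and blocks of existential quantifiers\<close>

definition Verum :: "('s, 'f, 'p) fm" where
  "Verum = Ex (undefined, 0) (Eq (Var (undefined, 0)) (Var (undefined, 0)))"

lemma Verum_simps [simp]: "fv Verum = {}" "wf_fm L Verum" "sat M e Verum \<longleftrightarrow> univ M undefined \<noteq> {}"
  by (auto simp: Verum_def intro: has_sort.intros)

text \<open>Satisfaction does not depend on order or repetitions, so the conjunction is indexed by a
  set; choosing an enumeration makes it a definite formula.\<close>

definition Conjs :: "('s, 'f, 'p) fm set \<Rightarrow> ('s, 'f, 'p) fm" where
  "Conjs F = foldr Conj (SOME xs. set xs = F) Verum"

definition Exs :: "'s var set \<Rightarrow> ('s, 'f, 'p) fm \<Rightarrow> ('s, 'f, 'p) fm" where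
  "Exs V \<phi> = foldr Ex (SOME xs. set xs = V) \<phi>"

lemma some_list: "finite F \<Longrightarrow> set (SOME xs. set xs = F) = F"
  by (rule someI_ex) (rule finite_list)

lemma sat_Conjs:
  assumes "finite F" "\<And>s. univ M s \<noteq> {}"
  shows "sat M e (Conjs F) \<longleftrightarrow> (\<forall>\<phi>\<in>F. sat M e \<phi>)"
proof -
  have "sat M e (foldr Conj xs Verum) \<longleftrightarrow> (\<forall>\<phi>\<in>set xs. sat M e \<phi>)" for xs
    by (induction xs) (auto simp: assms)
  from this[of "SOME xs. set xs = F"] show ?thesis by (simp add: Conjs_def some_list assms)
qed

lemma wf_Conjs:
  assumes "finite F" "\<And>\<phi>. \<phi> \<in> F \<Longrightarrow> wf_fm L \<phi>"
  shows "wf_fm L (Conjs F)"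
proof -
  have "(\<forall>\<phi>\<in>set xs. wf_fm L \<phi>) \<Longrightarrow> wf_fm L (foldr Conj xs Verum)" for xs
    by (induction xs) auto
  from this[of "SOME xs. set xs = F"] show ?thesis by (simp add: Conjs_def some_list assms)
qed

lemma fv_Conjs:
  assumes "finite F"
  shows "fv (Conjs F) = \<Union> (fv ` F)"
proof -
  have "fv (foldr Conj xs Verum) = \<Union> (fv ` set xs)" for xs :: "('a, 'b, 'c) fm list"
    by (induction xs) auto
  from this[of "SOME xs. set xs = F"] show ?thesis by (simp add: Conjs_def some_list assms)
qed

lemma sat_Exs:
  assumes "finite V"
  shows "sat M e (Exs V \<phi>) \<longleftrightarrow>
    (\<exists>e'. (\<forall>x\<in>V. e' x \<in> univ M (fst x)) \<and> (\<forall>x. x \<notin> V \<longrightarrow> e' x = e x) \<and> sat M e' \<phi>)"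
proof -
  have "sat M e (foldr Ex xs \<phi>) \<longleftrightarrow>
    (\<exists>e'. (\<forall>x\<in>set xs. e' x \<in> univ M (fst x)) \<and> (\<forall>x. x \<notin> set xs \<longrightarrow> e' x = e x) \<and> sat M e' \<phi>)" for xs
  proof (induction xs arbitrary: e)
    case Nil
    have "(\<forall>x. e' x = e x) \<longleftrightarrow> e' = e" for e' by (auto simp: fun_eq_iff)
    then show ?case by simp
  next
    case (Cons y ys)
    show ?case
    proof
      assume "sat M e (foldr Ex (y # ys) \<phi>)"
      then obtain a e' where a: "a \<in> univ M (fst y)"
        and e': "\<forall>x\<in>set ys. e' x \<in> univ M (fst x)" "\<forall>x. x \<notin> set ys \<longrightarrow> e' x = (e(y := a)) x"
          "sat M e' \<phi>" by (auto simp: Cons.IH)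
      \<comment> \<open>\<open>y\<close> may occur again in \<open>ys\<close>: then its value is
        controlled by the inner block, otherwise it is \<open>a\<close>.\<close>
      have "e' y \<in> univ M (fst y)" by (metis a e'(1,2) fun_upd_same)
      then show "\<exists>e'. (\<forall>x\<in>set (y # ys). e' x \<in> univ M (fst x)) \<and>
          (\<forall>x. x \<notin> set (y # ys) \<longrightarrow> e' x = e x) \<and> sat M e' \<phi>"
        using e' by (intro exI[of _ e']) auto
    next
      assume "\<exists>e'. (\<forall>x\<in>set (y # ys). e' x \<in> univ M (fst x)) \<and>
          (\<forall>x. x \<notin> set (y # ys) \<longrightarrow> e' x = e x) \<and> sat M e' \<phi>"
      then obtain e' where e': "\<forall>x\<in>set (y # ys). e' x \<in> univ M (fst x)"
          "\<forall>x. x \<notin> set (y # ys) \<longrightarrow> e' x = e x" "sat M e' \<phi>" by blast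
      have "sat M (e(y := e' y)) (foldr Ex ys \<phi>)"
        unfolding Cons.IH using e' by (intro exI[of _ e']) auto
      then show "sat M e (foldr Ex (y # ys) \<phi>)" using e' by auto
    qed
  qed
  from this[of "SOME xs. set xs = V"] show ?thesis by (simp add: Exs_def some_list assms)
qed

lemma wf_Exs: "wf_fm L (Exs V \<phi>) \<longleftrightarrow> wf_fm L \<phi>"
proof -
  have "wf_fm L (foldr Ex xs \<phi>) \<longleftrightarrow> wf_fm L \<phi>" for xs
    by (induction xs) auto
  then show ?thesis by (simp add: Exs_def)
qed

lemma fv_Exs:
  assumes "finite V"
  shows "fv (Exs V \<phi>) = fv \<phi> - V"
proof -
  have "fv (foldr Ex xs \<phi>) = fv \<phi> - set xs" for xs
    by (induction xs) auto
  then show ?thesis by (simp add: Exs_def some_list assms)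
qed

lemma models_closure:
  assumes "\<And>s. univ M s \<noteq> {}"
  shows "M \<Turnstile> Exs (fv \<phi>) \<phi> \<longleftrightarrow> (\<exists>e\<in>assignments M. sat M e \<phi>)"
proof -
  obtain e0 where e0: "e0 \<in> assignments M" using ex_assignment[OF assms] by blast
  have "M \<Turnstile> Exs (fv \<phi>) \<phi> \<longleftrightarrow> sat M e0 (Exs (fv \<phi>) \<phi>)"
    by (rule models_iff_sat) (auto simp: fv_Exs assms)
  also have "\<dots> \<longleftrightarrow> (\<exists>e\<in>assignments M. sat M e \<phi>)" unfolding sat_Exs[OF finite_fv]
  proof
    assume "\<exists>e\<in>assignments M. sat M e \<phi>"
    then obtain e where e: "e \<in> assignments M" "sat M e \<phi>" by blast
    have "sat M (\<lambda>x. if x \<in> fv \<phi> then e x else e0 x) \<phi> = sat M e \<phi>"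
      by (rule sat_cong) auto
    with e show "\<exists>e'. (\<forall>x\<in>fv \<phi>. e' x \<in> univ M (fst x)) \<and>
         (\<forall>x. x \<notin> fv \<phi> \<longrightarrow> e' x = e0 x) \<and> sat M e' \<phi>"
      by (intro exI[of _ "\<lambda>x. if x \<in> fv \<phi> then e x else e0 x"]) (auto simp: assignments_def)
  next
    assume "\<exists>e'. (\<forall>x\<in>fv \<phi>. e' x \<in> univ M (fst x)) \<and>
         (\<forall>x. x \<notin> fv \<phi> \<longrightarrow> e' x = e0 x) \<and> sat M e' \<phi>"
    then obtain e' where "(\<forall>x\<in>fv \<phi>. e' x \<in> univ M (fst x))" 
         "(\<forall>x. x \<notin> fv \<phi> \<longrightarrow> e' x = e0 x)" "sat M e' \<phi>" by blast
    moreover from this have "e' x \<in> univ M (fst x)" for x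
      using assignmentsD[OF e0] by (cases "x \<in> fv \<phi>") auto
    ultimately show "\<exists>e\<in>assignments M. sat M e \<phi>"
      by (intro bexI[of _ e']) (simp_all add: assignments_def)
  qed
  finally show ?thesis .
qed

section \<open>Finite approximations of inp-patterns\<close>

text \<open>
  The part of an inp-pattern that mentions only the rows in \<open>I\<close> and the columns up to \<open>n\<close>,
  with a predicate \<open>Q\<close> that is inconsistent along rows and a predicate \<open>R\<close> that is consistent
  along paths.
\<close>

definition approx ::
  "'e set \<Rightarrow> 'b set \<Rightarrow> ('i \<Rightarrow> 'e \<Rightarrow> 'b \<Rightarrow> bool) \<Rightarrow> ('i \<Rightarrow> 'e \<Rightarrow> 'b \<Rightarrow> bool) \<Rightarrow> ('i \<Rightarrow> nat)
    \<Rightarrow> 'i set \<Rightarrow> nat \<Rightarrow> bool" where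
  "approx P B Q R k I n \<longleftrightarrow> (\<exists>a. (\<forall>i j. a i j \<in> P) \<and>
     (\<forall>i\<in>I. \<forall>J\<subseteq>{..n}. card J = k i \<longrightarrow> \<not> (\<exists>b\<in>B. \<forall>j\<in>J. Q i (a i j) b)) \<and>
     (\<forall>f. (\<forall>i\<in>I. f i \<le> n) \<longrightarrow> (\<exists>b\<in>B. \<forall>i\<in>I. R i (a i (f i)) b)))"

lemma approx_mono:
  assumes "approx P B Q R k I n" "I' \<subseteq> I" "n' \<le> n"
  shows "approx P B Q R k I' n'"
proof -
  obtain a where a: "\<forall>i j. a i j \<in> P"
    "\<forall>i\<in>I. \<forall>J\<subseteq>{..n}. card J = k i \<longrightarrow> \<not> (\<exists>b\<in>B. \<forall>j\<in>J. Q i (a i j) b)"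
    "\<And>f. (\<forall>i\<in>I. f i \<le> n) \<Longrightarrow> (\<exists>b\<in>B. \<forall>i\<in>I. R i (a i (f i)) b)"
    using assms(1) by (auto simp: approx_def)
  have paths: "\<exists>b\<in>B. \<forall>i\<in>I'. R i (a i (f i)) b" if "\<forall>i\<in>I'. f i \<le> n'" for f
  proof -
    \<comment> \<open>A path on the smaller grid is extended by column \<open>0\<close>, which
      exists in every row.\<close>
    have "\<forall>i\<in>I. (if i \<in> I' then f i else 0) \<le> n" using that assms(3) by auto
    from a(3)[OF this] obtain b where b: "b \<in> B" "\<forall>i\<in>I. R i (a i (if i \<in> I' then f i else 0)) b"
      by blast
    have "R i (a i (f i)) b" if "i \<in> I'" for i
      using bspec[OF b(2), of i] assms(2) that by auto
    with b(1) show ?thesis by blast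
  qed
  have rows: "\<forall>i\<in>I'. \<forall>J\<subseteq>{..n'}. card J = k i \<longrightarrow> \<not> (\<exists>b\<in>B. \<forall>j\<in>J. Q i (a i j) b)"
  proof (intro ballI allI impI)
    fix i J assume "i \<in> I'" "J \<subseteq> {..n'}" "card J = k i"
    moreover have "{..n'} \<subseteq> {..n}" using assms(3) by simp
    ultimately show "\<not> (\<exists>b\<in>B. \<forall>j\<in>J. Q i (a i j) b)"
      using a(2) assms(2) by (meson order_trans subsetD)
  qed
  show ?thesis unfolding approx_def
    by (intro exI[of _ a] conjI a(1) rows allI impI paths)
qed

abbreviation fapprox ::
  "('s, 'f, 'p, 'a) struct \<Rightarrow> 's var \<Rightarrow> ('i \<Rightarrow> ('s, 'f, 'p) fm) \<Rightarrow> ('i \<Rightarrow> nat)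
    \<Rightarrow> 'i set \<Rightarrow> nat \<Rightarrow> bool" where
  "fapprox M x \<phi> \<equiv> approx (assignments M) (univ M (fst x))
     (\<lambda>i e b. sat M (e(x := b)) (\<phi> i)) (\<lambda>i e b. sat M (e(x := b)) (\<phi> i))"

text \<open>Renames all variables but \<open>x\<close> apart for distinct positive \<open>m\<close>.\<close>

definition param_var :: "'s var \<Rightarrow> nat \<Rightarrow> 's var \<Rightarrow> 's var" where
  "param_var x m y = (fst y, prod_encode (if y = x then 0 else m, snd y))"

lemma fst_param_var [simp]: "fst (param_var x m y) = fst y"
  by (simp add: param_var_def)

lemma inj_param_var: "m > 0 \<Longrightarrow> inj (param_var x m)"
  by (rule injI) (auto simp: param_var_def prod_eq_iff split: if_splits)

lemma param_var_upd:
  assumes "m > 0"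
  shows "e(param_var x 0 x := b) \<circ> param_var x m = (e \<circ> param_var x m)(x := b)"
  using assms by (auto simp: fun_eq_iff param_var_def prod_eq_iff split: if_splits)

text \<open>\<open>Suc\<close> keeps the tag \<open>0\<close> for the common variable
  \<open>x\<close>; the other tags belong to the cells of the grid.\<close>

definition param_index :: "'i set \<Rightarrow> 'i \<Rightarrow> nat \<Rightarrow> nat" where
  "param_index I i j = Suc (prod_encode (to_nat_on I i, j))"

text \<open>Stores the assignments of all cells in one: the tag of a variable tells from which cell
  its value is read. Tags that code no cell still give a value of some \<open>a i j\<close> at a
  variable of the same sort, so the result is an assignment.\<close>

definition combine_params :: "'i set \<Rightarrow> ('i \<Rightarrow> nat \<Rightarrow> 's var \<Rightarrow> 'a) \<Rightarrow> 's var \<Rightarrow> 'a" where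
  "combine_params I a = (\<lambda>(s, m). case prod_decode m of (c, q) \<Rightarrow>
     (case prod_decode (c - 1) of (g, j) \<Rightarrow> a (from_nat_into I g) j (s, q)))"

lemma combine_params_param_var:
  "finite I \<Longrightarrow> i \<in> I \<Longrightarrow> (combine_params I a \<circ> param_var x (param_index I i j))(x := b) = (a i j)(x := b)"
  by (auto simp: fun_eq_iff combine_params_def param_var_def param_index_def countable_finite)

lemma combine_params_value: "\<exists>i j y. combine_params I a z = a i j y \<and> fst y = fst z"
  by (auto simp: combine_params_def split: prod.splits) (metis fst_conv)

text \<open>Paths range over extensional functions, of which there are only finitely many;
  \<open>x\<close> is one variable shared by all cells.\<close>

definition approx_body where
  "approx_body x \<phi> k I n =
     Conj (Conjs ((\<lambda>(i, J). Neg (Ex (param_var x 0 x) (Conjs ((\<lambda>j. rename_fm (param_var x (param_index I i j)) (\<phi> i)) ` J))))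
             ` {(i, J). i \<in> I \<and> J \<subseteq> {..n} \<and> card J = k i}))
          (Conjs ((\<lambda>f. Ex (param_var x 0 x) (Conjs ((\<lambda>i. rename_fm (param_var x (param_index I i (f i))) (\<phi> i)) ` I)))
             ` PiE I (\<lambda>_. {..n})))"

definition approx_sentence ::
  "'s var \<Rightarrow> ('i \<Rightarrow> ('s, 'f, 'p) fm) \<Rightarrow> ('i \<Rightarrow> nat) \<Rightarrow> 'i set \<Rightarrow> nat \<Rightarrow> ('s, 'f, 'p) fm" where
  "approx_sentence x \<phi> k I n = Exs (fv (approx_body x \<phi> k I n)) (approx_body x \<phi> k I n)"

lemma finite_approx_rows:
  "finite I \<Longrightarrow> finite {(i, J). i \<in> I \<and> J \<subseteq> {..n::nat} \<and> card J = k i}"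
  by (rule finite_subset[of _ "I \<times> Pow {..n}"]) auto

lemma approx_sentence_sentences:
  assumes "finite I" "\<And>i. i \<in> I \<Longrightarrow> \<phi> i \<in> fms L"
  shows "approx_sentence x \<phi> k I n \<in> sentences L"
proof -
  have "wf_fm L (approx_body x \<phi> k I n)"
    unfolding approx_body_def using assms finite_approx_rows[OF assms(1)] finite_subset[of _ "{..n}"]
    by (auto intro!: wf_Conjs wf_rename finite_PiE simp: fms_def)
  then show ?thesis
    by (simp add: sentences_def approx_sentence_def fms_def wf_Exs fv_Exs)
qed

lemma sat_param_var:
  assumes "finite J" "\<And>s. univ K s \<noteq> {}"
  shows "sat K (e(param_var x 0 x := b)) (Conjs ((\<lambda>j. rename_fm (param_var x (param_index I (i j) (f j))) (\<phi> j)) ` J))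
    \<longleftrightarrow> (\<forall>j\<in>J. sat K ((e \<circ> param_var x (param_index I (i j) (f j)))(x := b)) (\<phi> j))"
proof -
  have pos: "param_index I i j > 0" for i j by (simp add: param_index_def)
  show ?thesis by (simp add: sat_Conjs assms sat_rename inj_param_var pos param_var_upd)
qed

lemma sat_approx_body:
  assumes I: "finite I" and K: "\<And>s. univ K s \<noteq> {}"
  shows "sat K e (approx_body x \<phi> k I n) \<longleftrightarrow>
     (\<forall>i\<in>I. \<forall>J\<subseteq>{..n}. card J = k i \<longrightarrow>
        \<not> (\<exists>b\<in>univ K (fst x). \<forall>j\<in>J. sat K ((e \<circ> param_var x (param_index I i j))(x := b)) (\<phi> i))) \<and>
     (\<forall>f. (\<forall>i\<in>I. f i \<le> n) \<longrightarrow>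
        (\<exists>b\<in>univ K (fst x). \<forall>i\<in>I. sat K ((e \<circ> param_var x (param_index I i (f i)))(x := b)) (\<phi> i)))"
proof -
  have 1: "sat K e (Ex (param_var x 0 x) (Conjs ((\<lambda>j. rename_fm (param_var x (param_index I i j)) (\<phi> i)) ` J)))
     \<longleftrightarrow> (\<exists>b\<in>univ K (fst x). \<forall>j\<in>J. sat K ((e \<circ> param_var x (param_index I i j))(x := b)) (\<phi> i))"
    if "J \<subseteq> {..n}" for i J
    using finite_subset[OF that] by (simp add: sat_param_var K)
  have 2: "sat K e (Ex (param_var x 0 x) (Conjs ((\<lambda>i. rename_fm (param_var x (param_index I i (f i))) (\<phi> i)) ` I)))
     \<longleftrightarrow> (\<exists>b\<in>univ K (fst x). \<forall>i\<in>I. sat K ((e \<circ> param_var x (param_index I i (f i)))(x := b)) (\<phi> i))" for f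
    using I by (simp add: sat_param_var K)
  have 3: "(\<forall>f\<in>PiE I (\<lambda>_. {..n}). \<exists>b\<in>univ K (fst x). \<forall>i\<in>I. sat K ((e \<circ> param_var x (param_index I i (f i)))(x := b)) (\<phi> i))
    \<longleftrightarrow> (\<forall>f. (\<forall>i\<in>I. f i \<le> n) \<longrightarrow>
        (\<exists>b\<in>univ K (fst x). \<forall>i\<in>I. sat K ((e \<circ> param_var x (param_index I i (f i)))(x := b)) (\<phi> i)))"
    (is "(\<forall>f\<in>_. ?C f) \<longleftrightarrow> ?R")
  proof
    assume h: "\<forall>f\<in>PiE I (\<lambda>_. {..n}). ?C f"
    show ?R
    proof (intro allI impI)
      fix f assume "\<forall>i\<in>I. f i \<le> n"
      then have "restrict f I \<in> PiE I (\<lambda>_. {..n})" by auto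
      with h have "?C (restrict f I)" by blast
      then show "?C f" by simp
    qed
  qed auto
  have 4: "(\<forall>\<psi>\<in>(\<lambda>(i, J). F i J) ` {(i, J). i \<in> I \<and> J \<subseteq> {..n} \<and> card J = k i}. sat K e \<psi>) \<longleftrightarrow>
      (\<forall>i\<in>I. \<forall>J\<subseteq>{..n}. card J = k i \<longrightarrow> sat K e (F i J))" for F
    by (auto simp: split_paired_All image_iff Bex_def)
  show ?thesis
    unfolding approx_body_def sat.simps(4)
    apply (subst sat_Conjs)
      apply (simp add: finite_approx_rows[OF I])
     apply (rule K)
    apply (subst sat_Conjs)
      apply (simp add: finite_PiE I)
     apply (rule K)
    unfolding 4 using 1 2 3 by (simp del: sat.simps(5))
qed

text \<open>The existential closure quantifies all parameters of the grid at once, after they have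
  been renamed apart. Through this equivalence approximations pass between elementarily equivalent
  structures and, by \<open>Los\<close>, between an ultraproduct and its factors.\<close>

lemma models_approx_sentence:
  assumes I: "finite I" and K: "\<And>s. univ K s \<noteq> {}"
  shows "K \<Turnstile> approx_sentence x \<phi> k I n \<longleftrightarrow> fapprox K x \<phi> k I n"
  unfolding approx_sentence_def models_closure[OF K] sat_approx_body[OF I K]
proof
  assume "\<exists>e\<in>assignments K. (\<forall>i\<in>I. \<forall>J\<subseteq>{..n}. card J = k i \<longrightarrow>
        \<not> (\<exists>b\<in>univ K (fst x). \<forall>j\<in>J. sat K ((e \<circ> param_var x (param_index I i j))(x := b)) (\<phi> i))) \<and>
     (\<forall>f. (\<forall>i\<in>I. f i \<le> n) \<longrightarrow>
        (\<exists>b\<in>univ K (fst x). \<forall>i\<in>I. sat K ((e \<circ> param_var x (param_index I i (f i)))(x := b)) (\<phi> i)))"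
  then obtain e where e: "e \<in> assignments K" and *: "(\<forall>i\<in>I. \<forall>J\<subseteq>{..n}. card J = k i \<longrightarrow>
        \<not> (\<exists>b\<in>univ K (fst x). \<forall>j\<in>J. sat K ((e \<circ> param_var x (param_index I i j))(x := b)) (\<phi> i)))"
     "(\<forall>f. (\<forall>i\<in>I. f i \<le> n) \<longrightarrow>
        (\<exists>b\<in>univ K (fst x). \<forall>i\<in>I. sat K ((e \<circ> param_var x (param_index I i (f i)))(x := b)) (\<phi> i)))" by blast
  have "(e \<circ> param_var x m) y \<in> univ K (fst y)" for m y
    using assignmentsD[OF e, of "param_var x m y"] by simp
  then have "e \<circ> param_var x m \<in> assignments K" for m by (simp add: assignments_def)
  then show "fapprox K x \<phi> k I n" using *
    unfolding approx_def by (intro exI[of _ "\<lambda>i j. e \<circ> param_var x (param_index I i j)"]) auto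
next
  assume "fapprox K x \<phi> k I n"
  then obtain a where a: "\<And>i j. a i j \<in> assignments K" and *:
     "\<forall>i\<in>I. \<forall>J\<subseteq>{..n}. card J = k i \<longrightarrow> \<not> (\<exists>b\<in>univ K (fst x). \<forall>j\<in>J. sat K ((a i j)(x := b)) (\<phi> i))"
     "\<forall>f. (\<forall>i\<in>I. f i \<le> n) \<longrightarrow> (\<exists>b\<in>univ K (fst x). \<forall>i\<in>I. sat K ((a i (f i))(x := b)) (\<phi> i))"
    by (auto simp: approx_def)
  define e where "e = combine_params I a"
  have "e z \<in> univ K (fst z)" for z
  proof -
    obtain i j y where "combine_params I a z = a i j y" "fst y = fst z" using combine_params_value[of I a z] by blast
    then show ?thesis using assignmentsD[OF a, of i j y] by (simp add: e_def)
  qed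
  then have e: "e \<in> assignments K" by (simp add: assignments_def)
  have upd: "(e \<circ> param_var x (param_index I i j))(x := b) = (a i j)(x := b)" if "i \<in> I" for i j b
    unfolding e_def by (rule combine_params_param_var[OF I that])
  show "\<exists>e\<in>assignments K. (\<forall>i\<in>I. \<forall>J\<subseteq>{..n}. card J = k i \<longrightarrow>
        \<not> (\<exists>b\<in>univ K (fst x). \<forall>j\<in>J. sat K ((e \<circ> param_var x (param_index I i j))(x := b)) (\<phi> i))) \<and>
     (\<forall>f. (\<forall>i\<in>I. f i \<le> n) \<longrightarrow>
        (\<exists>b\<in>univ K (fst x). \<forall>i\<in>I. sat K ((e \<circ> param_var x (param_index I i (f i)))(x := b)) (\<phi> i)))"
    by (rule bexI[OF _ e]) (use * in \<open>simp add: upd\<close>)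
qed

section \<open>Ultraproducts and compactness\<close>

text \<open>Finer filters are smaller, so ultrafilters are the minimal proper filters and Zorn's
  lemma is applied to the reversed order. The infimum of a chain stays proper because an event in it
  already lies in a member of the chain.\<close>

lemma ultrafilter_exists:
  assumes "F \<noteq> bot"
  shows "\<exists>U\<le>F. ultrafilter_on UNIV U"
proof -
  let ?A = "{G. G \<le> F \<and> G \<noteq> bot}"
  have "\<exists>m\<in>?A. \<forall>a\<in>?A. m \<ge> a \<longrightarrow> a = m"
  proof (rule predicate_Zorn)
    show "partial_order_on ?A (relation_of (\<ge>) ?A)"
      by (rule partial_order_on_relation_ofI) auto
    fix C assume C: "C \<in> Chains (relation_of (\<ge>) ?A)"
    then have CA: "C \<subseteq> ?A" by (auto simp: Chains_def relation_of_def)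
    show "\<exists>u\<in>?A. \<forall>a\<in>C. a \<ge> u"
    proof (cases "C = {}")
      case False
      have "eventually P (Inf C) \<longleftrightarrow> (\<exists>b\<in>C. eventually P b)" for P
      proof (rule eventually_Inf_base[OF False])
        fix G H assume "G \<in> C" "H \<in> C"
        then have "G \<le> H \<or> H \<le> G" using C by (auto simp: Chains_def relation_of_def)
        then show "\<exists>x\<in>C. x \<le> inf G H" using \<open>G \<in> C\<close> \<open>H \<in> C\<close> by auto
      qed
      then have "Inf C \<noteq> bot" using CA by (auto simp: trivial_limit_def)
      moreover obtain G where "G \<in> C" "G \<le> F" using False CA by auto
      then have "Inf C \<le> F" by (rule Inf_lower2)
      ultimately show ?thesis by (intro bexI[of _ "Inf C"]) (auto intro: Inf_lower)
    qed (use assms in auto)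
  qed
  then obtain U where U: "U \<le> F" "U \<noteq> bot" and max: "\<And>G. G \<le> F \<Longrightarrow> G \<noteq> bot \<Longrightarrow> G \<le> U \<Longrightarrow> G = U"
    by blast
  have "eventually P U \<or> eventually (\<lambda>a. \<not> P a) U" for P
  proof (cases "inf U (principal {a. P a}) = bot")
    case True
    then show ?thesis by (auto simp: trivial_limit_def eventually_inf_principal)
  next
    case False
    \<comment> \<open>Adding the event \<open>P\<close> leaves the filter proper, so by minimality
      nothing was added.\<close>
    have "inf U (principal {a. P a}) = U"
      using U by (intro max[OF _ False]) (auto intro: le_infI1)
    then have "U \<le> principal {a. P a}" by (metis inf.cobounded2)
    then show ?thesis by (simp add: le_principal)
  qed
  then show ?thesis using U unfolding ultrafilter_on_def by auto
qed

lemma ultrafilter_not: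
  assumes U: "ultrafilter_on A U"
  shows "eventually (\<lambda>a. \<not> P a) U \<longleftrightarrow> \<not> eventually P U"
proof
  assume 1: "eventually (\<lambda>a. \<not> P a) U"
  show "\<not> eventually P U"
  proof
    assume "eventually P U"
    with 1 have "eventually (\<lambda>a. False) U" by (rule eventually_elim2) simp
    with U show False by (simp add: ultrafilter_on_def)
  qed
qed (use U in \<open>auto simp: ultrafilter_on_def\<close>)

lemma ultrafilter_disj:
  assumes "ultrafilter_on A U"
  shows "eventually (\<lambda>a. P a \<or> Q a) U \<longleftrightarrow> eventually P U \<or> eventually Q U"
proof -
  have "eventually (\<lambda>a. \<not> (\<not> P a \<and> \<not> Q a)) U \<longleftrightarrow> \<not> eventually (\<lambda>a. \<not> P a \<and> \<not> Q a) U"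
    by (rule ultrafilter_not[OF assms])
  then show ?thesis by (simp add: eventually_conj_iff ultrafilter_not[OF assms])
qed

lemma ultrafilter_finite_value:
  assumes U: "ultrafilter_on A U" and "finite C" "eventually (\<lambda>a. g a \<in> C) U"
  shows "\<exists>c\<in>C. eventually (\<lambda>a. g a = c) U"
  using assms(2,3)
proof (induction C)
  case empty
  then show ?case using U by (auto simp: ultrafilter_on_def)
next
  case (insert c C)
  then show ?case by (auto simp: ultrafilter_disj[OF U])
qed

text \<open>Compactness is also applied to the product, which has three sorts, so ultraproducts of
  many-sorted structures are needed; classes are formed sort by sort. For one sort this is
  \<open>ultraproduct\<close>.\<close>

definition uprod ::
  "('s, 'f, 'p) lang \<Rightarrow> 'i set \<Rightarrow> 'i filter \<Rightarrow> ('i \<Rightarrow> ('s, 'f, 'p, 'a) struct)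
    \<Rightarrow> ('s, 'f, 'p, ('i \<Rightarrow> 'a) set) struct" where
  "uprod L A U N = \<lparr>
     univ = \<lambda>s. uclass A U (\<lambda>i. univ (N i) s) ` (\<Pi> i\<in>A. univ (N i) s),
     fun_int = \<lambda>f cs. uclass A U (\<lambda>i. univ (N i) (fun_cod L f))
       (\<lambda>i. fun_int (N i) f (map (\<lambda>c. (SOME g. g \<in> c) i) cs)),
     rel_int = \<lambda>P cs. eventually (\<lambda>i. rel_int (N i) P (map (\<lambda>c. (SOME g. g \<in> c) i) cs)) U\<rparr>"

lemma ultraproduct_eq_uprod: "ultraproduct A U N = uprod L A U N"
  by (simp add: ultraproduct_def uprod_def)

abbreviation urep :: "('i \<Rightarrow> 'a) set \<Rightarrow> 'i \<Rightarrow> 'a" where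
  "urep c \<equiv> SOME g. g \<in> c"

lemma urep_uclass:
  assumes "g \<in> Pi A X"
  shows "urep (uclass A U X g) \<in> Pi A X" "eventually (\<lambda>i. urep (uclass A U X g) i = g i) U"
proof -
  have "urep (uclass A U X g) \<in> uclass A U X g"
    by (rule someI[of _ g]) (use assms in \<open>simp add: uclass_def\<close>)
  then show "urep (uclass A U X g) \<in> Pi A X" "eventually (\<lambda>i. urep (uclass A U X g) i = g i) U"
    by (auto simp: uclass_def)
qed

lemma uclass_eqI:
  assumes "eventually (\<lambda>i. g i = h i) U"
  shows "uclass A U X g = uclass A U X h"
proof -
  have "eventually (\<lambda>i. k i = g i) U \<longleftrightarrow> eventually (\<lambda>i. k i = h i) U" for k
    using assms by (auto elim: eventually_elim2)
  then show ?thesis by (auto simp: uclass_def)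
qed

context
  fixes L :: "('s, 'f, 'p) lang" and A :: "'i set" and U and N :: "'i \<Rightarrow> ('s, 'f, 'p, 'a) struct"
  assumes U: "ultrafilter_on A U" and N: "\<And>i. i \<in> A \<Longrightarrow> is_struct L (N i)"
begin

lemma uprod_univ_urep:
  assumes "c \<in> univ (uprod L A U N) s"
  shows "urep c \<in> (\<Pi> i\<in>A. univ (N i) s)" "uclass A U (\<lambda>i. univ (N i) s) (urep c) = c"
proof -
  obtain g where g: "g \<in> (\<Pi> i\<in>A. univ (N i) s)" "c = uclass A U (\<lambda>i. univ (N i) s) g"
    using assms by (auto simp: uprod_def)
  show "urep c \<in> (\<Pi> i\<in>A. univ (N i) s)" unfolding g(2) by (rule urep_uclass(1)[OF g(1)])
  show "uclass A U (\<lambda>i. univ (N i) s) (urep c) = c"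
    unfolding g(2) by (rule uclass_eqI[OF urep_uclass(2)[OF g(1)]])
qed

lemma uprod_univI:
  "g \<in> (\<Pi> i\<in>A. univ (N i) s) \<Longrightarrow> uclass A U (\<lambda>i. univ (N i) s) g \<in> univ (uprod L A U N) s"
  by (auto simp: uprod_def)

lemma uprod_eq_iff:
  assumes "c \<in> univ (uprod L A U N) s" "d \<in> univ (uprod L A U N) s"
  shows "c = d \<longleftrightarrow> eventually (\<lambda>i. urep c i = urep d i) U"
proof
  assume "eventually (\<lambda>i. urep c i = urep d i) U"
  then have "uclass A U (\<lambda>i. univ (N i) s) (urep c) = uclass A U (\<lambda>i. univ (N i) s) (urep d)"
    by (rule uclass_eqI)
  then show "c = d" using uprod_univ_urep[OF assms(1)] uprod_univ_urep[OF assms(2)] by simp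
qed simp

lemma uprod_fun:
  assumes f: "f \<in> funs L" and cs: "list_all2 (\<lambda>c s. c \<in> univ (uprod L A U N) s) cs (fun_dom L f)"
  shows "fun_int (uprod L A U N) f cs \<in> univ (uprod L A U N) (fun_cod L f)"
    "eventually (\<lambda>i. urep (fun_int (uprod L A U N) f cs) i = fun_int (N i) f (map (\<lambda>c. urep c i) cs)) U"
proof -
  have *: "(\<lambda>i. fun_int (N i) f (map (\<lambda>c. urep c i) cs)) \<in> (\<Pi> i\<in>A. univ (N i) (fun_cod L f))"
  proof
    fix i assume i: "i \<in> A"
    have "list_all2 (\<lambda>a s. a \<in> univ (N i) s) (map (\<lambda>c. urep c i) cs) (fun_dom L f)"
      unfolding list_all2_map1 using cs
      by (rule list_all2_mono) (use uprod_univ_urep(1) i in blast)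
    then show "fun_int (N i) f (map (\<lambda>c. urep c i) cs) \<in> univ (N i) (fun_cod L f)"
      using N[OF i] f by (simp add: is_struct_def)
  qed
  have fi: "fun_int (uprod L A U N) f cs =
      uclass A U (\<lambda>i. univ (N i) (fun_cod L f)) (\<lambda>i. fun_int (N i) f (map (\<lambda>c. urep c i) cs))"
    by (simp add: uprod_def)
  show "fun_int (uprod L A U N) f cs \<in> univ (uprod L A U N) (fun_cod L f)"
    unfolding fi by (rule uprod_univI[OF *])
  show "eventually (\<lambda>i. urep (fun_int (uprod L A U N) f cs) i = fun_int (N i) f (map (\<lambda>c. urep c i) cs)) U"
    unfolding fi by (rule urep_uclass(2)[OF *])
qed

lemma is_struct_uprod: "is_struct L (uprod L A U N)"
proof -
  have "univ (uprod L A U N) s \<noteq> {}" for s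
  proof -
    have "(\<lambda>i. SOME a. a \<in> univ (N i) s) \<in> (\<Pi> i\<in>A. univ (N i) s)"
      using is_struct_nonempty[OF N] by (simp add: some_in_eq)
    from uprod_univI[OF this] show ?thesis by blast
  qed
  then show ?thesis using uprod_fun(1) unfolding is_struct_def by blast
qed

lemma eval_uprod:
  assumes e: "e \<in> assignments (uprod L A U N)"
  shows "has_sort L t s \<Longrightarrow> eval (uprod L A U N) e t \<in> univ (uprod L A U N) s \<and>
    eventually (\<lambda>i. urep (eval (uprod L A U N) e t) i = eval (N i) (\<lambda>x. urep (e x) i) t) U"
proof (induction rule: has_sort.induct)
  case (1 x)
  then show ?case using assignmentsD[OF e] by simp
next
  case (2 f ts)
  let ?K = "uprod L A U N"
  have cs: "list_all2 (\<lambda>c s. c \<in> univ ?K s) (map (eval ?K e) ts) (fun_dom L f)"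
    unfolding list_all2_map1 using 2(2) by (rule list_all2_mono) blast
  have "eventually (\<lambda>i. \<forall>t\<in>set ts. urep (eval ?K e t) i = eval (N i) (\<lambda>x. urep (e x) i) t) U"
    using 2(2) by (auto simp: eventually_ball_finite_distrib list_all2_conv_all_nth in_set_conv_nth)
  then have "eventually (\<lambda>i. map (\<lambda>c. urep c i) (map (eval ?K e) ts) =
      map (eval (N i) (\<lambda>x. urep (e x) i)) ts) U"
    by (rule eventually_mono) simp
  with uprod_fun(2)[OF 2(1) cs]
  have "eventually (\<lambda>i. urep (fun_int ?K f (map (eval ?K e) ts)) i =
      fun_int (N i) f (map (eval (N i) (\<lambda>x. urep (e x) i)) ts)) U"
    by (rule eventually_elim2) (simp only:)
  then show ?case using uprod_fun(1)[OF 2(1) cs] by simp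
qed

theorem Los:
  "wf_fm L \<phi> \<Longrightarrow> e \<in> assignments (uprod L A U N) \<Longrightarrow>
    sat (uprod L A U N) e \<phi> \<longleftrightarrow> eventually (\<lambda>i. sat (N i) (\<lambda>x. urep (e x) i) \<phi>) U"
proof (induction \<phi> arbitrary: e)
  case (Eq t t')
  then obtain s where s: "has_sort L t s" "has_sort L t' s" by auto
  note t = eval_uprod[OF Eq.prems(2) s(1)] eval_uprod[OF Eq.prems(2) s(2)]
  have "eventually (\<lambda>i. (urep (eval (uprod L A U N) e t) i = urep (eval (uprod L A U N) e t') i) \<longleftrightarrow>
      eval (N i) (\<lambda>x. urep (e x) i) t = eval (N i) (\<lambda>x. urep (e x) i) t') U"
    using t[THEN conjunct2] by (rule eventually_elim2) simp
  then show ?case using uprod_eq_iff[OF t[THEN conjunct1]] by (simp add: eventually_subst)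
next
  case (Rel P ts)
  let ?K = "uprod L A U N"
  have "eventually (\<lambda>i. \<forall>t\<in>set ts. urep (eval ?K e t) i = eval (N i) (\<lambda>x. urep (e x) i) t) U"
    using Rel.prems eval_uprod[OF Rel.prems(2)]
    by (fastforce simp: eventually_ball_finite_distrib list_all2_conv_all_nth in_set_conv_nth)
  then have "eventually (\<lambda>i. rel_int (N i) P (map (\<lambda>c. urep c i) (map (eval ?K e) ts)) \<longleftrightarrow>
      rel_int (N i) P (map (eval (N i) (\<lambda>x. urep (e x) i)) ts)) U"
    by (rule eventually_mono) (auto simp: o_def cong: map_cong)
  from eventually_subst[OF this] show ?case by (simp add: uprod_def)
next
  case (Neg \<phi>)
  then show ?case by (simp add: ultrafilter_not[OF U])
next
  case (Conj \<phi> \<psi>)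
  then show ?case by (simp add: eventually_conj_iff)
next
  case (Ex x \<phi>)
  let ?K = "uprod L A U N"
  have A: "eventually (\<lambda>i. i \<in> A) U" using U by (simp add: ultrafilter_on_def)
  have upd: "(\<lambda>y. urep ((e(x := c)) y) i) = (\<lambda>y. urep (e y) i)(x := urep c i)" for c i
    by (auto simp: fun_eq_iff)
  have IH: "sat ?K (e(x := c)) \<phi> \<longleftrightarrow>
      eventually (\<lambda>i. sat (N i) ((\<lambda>y. urep (e y) i)(x := urep c i)) \<phi>) U"
    if "c \<in> univ ?K (fst x)" for c
    using Ex.IH[of "e(x := c)"] Ex.prems that by (simp only: upd wf_fm.simps assignments_upd)
  show ?case
  proof
    assume "sat ?K e (Ex x \<phi>)"
    then obtain c where c: "c \<in> univ ?K (fst x)"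
      "eventually (\<lambda>i. sat (N i) ((\<lambda>y. urep (e y) i)(x := urep c i)) \<phi>) U"
      using IH by auto
    from A c(2) show "eventually (\<lambda>i. sat (N i) (\<lambda>y. urep (e y) i) (Ex x \<phi>)) U"
      by (rule eventually_elim2) (use uprod_univ_urep(1)[OF c(1)] in auto)
  next
    assume h: "eventually (\<lambda>i. sat (N i) (\<lambda>y. urep (e y) i) (Ex x \<phi>)) U"
    \<comment> \<open>A witness wherever one exists and any element of the sort elsewhere, so that
      \<open>w\<close> lies in the full product.\<close>
    define w where "w = (\<lambda>i. SOME b. b \<in> univ (N i) (fst x) \<and>
       ((\<exists>b\<in>univ (N i) (fst x). sat (N i) ((\<lambda>y. urep (e y) i)(x := b)) \<phi>)
         \<longrightarrow> sat (N i) ((\<lambda>y. urep (e y) i)(x := b)) \<phi>))"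
    have w: "w i \<in> univ (N i) (fst x) \<and>
       ((\<exists>b\<in>univ (N i) (fst x). sat (N i) ((\<lambda>y. urep (e y) i)(x := b)) \<phi>)
         \<longrightarrow> sat (N i) ((\<lambda>y. urep (e y) i)(x := w i)) \<phi>)" if "i \<in> A" for i
      unfolding w_def by (rule someI_ex) (use is_struct_nonempty[OF N[OF that]] in blast)
    let ?c = "uclass A U (\<lambda>i. univ (N i) (fst x)) w"
    have wA: "w \<in> (\<Pi> i\<in>A. univ (N i) (fst x))" using w by blast
    have "eventually (\<lambda>i. sat (N i) ((\<lambda>y. urep (e y) i)(x := w i)) \<phi>) U"
      using A h by (rule eventually_elim2) (use w in auto)
    with urep_uclass(2)[OF wA] have "eventually (\<lambda>i. sat (N i) ((\<lambda>y. urep (e y) i)(x := urep ?c i)) \<phi>) U"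
      by (rule eventually_elim2) simp
    then show "sat ?K e (Ex x \<phi>)" using IH uprod_univI[OF wA] by auto
  qed
qed

lemma models_uprod:
  assumes "\<phi> \<in> sentences L"
  shows "uprod L A U N \<Turnstile> \<phi> \<longleftrightarrow> eventually (\<lambda>i. N i \<Turnstile> \<phi>) U"
proof -
  have A: "eventually (\<lambda>i. i \<in> A) U" using U by (simp add: ultrafilter_on_def)
  obtain e where e: "e \<in> assignments (uprod L A U N)"
    using ex_assignment is_struct_nonempty[OF is_struct_uprod] by blast
  have \<phi>: "wf_fm L \<phi>" "fv \<phi> = {}" using assms by (auto simp: sentences_def fms_def)
  have "eventually (\<lambda>i. sat (N i) (\<lambda>x. urep (e x) i) \<phi> \<longleftrightarrow> N i \<Turnstile> \<phi>) U"
    using A by (rule eventually_mono) (metis models_iff_sat \<phi>(2) is_struct_nonempty N)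
  from eventually_subst[OF this] show ?thesis
    using models_iff_sat[OF \<phi>(2), of "uprod L A U N" e] is_struct_nonempty[OF is_struct_uprod]
      Los[OF \<phi>(1) e] by blast
qed

end

text \<open>The final segments of the directed set of pairs (finite set of rows, number of columns).\<close>

definition grid_filter :: "'i set \<Rightarrow> ('i set \<times> nat) filter" where
  "grid_filter I = (INF p\<in>{p. finite (fst p) \<and> fst p \<subseteq> I}.
     principal {q. finite (fst q) \<and> fst q \<subseteq> I \<and> fst p \<subseteq> fst q \<and> snd p \<le> snd q})"

lemma eventually_grid_filter:
  "eventually P (grid_filter I) \<longleftrightarrow> (\<exists>I0 n. finite I0 \<and> I0 \<subseteq> I \<and>
     (\<forall>I1 m. finite I1 \<longrightarrow> I1 \<subseteq> I \<longrightarrow> I0 \<subseteq> I1 \<longrightarrow> n \<le> m \<longrightarrow> P (I1, m)))"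
proof -
  let ?D = "{p. finite (fst p) \<and> fst p \<subseteq> I} :: ('a set \<times> nat) set"
  let ?F = "\<lambda>p. principal {q. finite (fst q) \<and> fst q \<subseteq> I \<and> fst p \<subseteq> fst q \<and> snd p \<le> snd q}
    :: ('a set \<times> nat) filter"
  have "eventually P (grid_filter I) \<longleftrightarrow> (\<exists>p\<in>?D. eventually P (?F p))"
    unfolding grid_filter_def
  proof (rule eventually_INF_base)
    show "?D \<noteq> {}" by (auto intro!: exI[of _ "({}, 0)"])
    fix p p' assume "p \<in> ?D" "p' \<in> ?D"
    then show "\<exists>x\<in>?D. ?F x \<le> inf (?F p) (?F p')"
      by (intro bexI[of _ "(fst p \<union> fst p', max (snd p) (snd p'))"]) auto
  qed
  then show ?thesis
    by (simp add: eventually_principal split_paired_Ex split_paired_All Bex_def imp_conjL)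
qed

lemma grid_filter_not_bot: "grid_filter I \<noteq> bot"
  unfolding trivial_limit_def eventually_grid_filter by auto

lemma eventually_grid_filterI:
  assumes "finite I0" "I0 \<subseteq> I" "U \<le> grid_filter I"
  shows "eventually (\<lambda>q. finite (fst q) \<and> fst q \<subseteq> I \<and> I0 \<subseteq> fst q \<and> n \<le> snd q) U"
  by (rule filter_leD[OF assms(3)]) (use assms in \<open>auto simp: eventually_grid_filter\<close>)

text \<open>\<open>K\<close> is an ultrapower of \<open>M\<close> indexed by pairs (finite set of
  rows, number of columns); at the index \<open>q\<close> the parameters are those of an
  approximation of size \<open>q\<close>. A given row condition or finite path lies inside the
  approximation for almost all \<open>q\<close>, and \<open>Los\<close> carries it to
  \<open>K\<close>.\<close>

lemma compactness_inp_pattern: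
  fixes M :: "('s, 'f, 'p, 'a) struct" and I :: "'i set"
  assumes M: "is_struct L M" and \<phi>: "\<And>i. i \<in> I \<Longrightarrow> \<phi> i \<in> fms L"
    and apx: "\<And>I0 n. finite I0 \<Longrightarrow> I0 \<subseteq> I \<Longrightarrow> fapprox M x \<phi> k I0 n"
  shows "\<exists>(K :: ('s, 'f, 'p, ('i set \<times> nat \<Rightarrow> 'a) set) struct) a. is_struct L K \<and>
    (\<forall>\<psi>\<in>sentences L. K \<Turnstile> \<psi> \<longleftrightarrow> M \<Turnstile> \<psi>) \<and> inp_pattern L K x I \<phi> a k \<and> (\<forall>i j. a i j \<in> assignments K)"
proof -
  obtain U where U: "U \<le> grid_filter I" "ultrafilter_on UNIV U"
    using ultrafilter_exists[OF grid_filter_not_bot] by blast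
  have "\<exists>a. (\<forall>i j. a i j \<in> assignments M) \<and> (finite (fst q) \<longrightarrow> fst q \<subseteq> I \<longrightarrow>
     (\<forall>i\<in>fst q. \<forall>J\<subseteq>{..snd q}. card J = k i \<longrightarrow> \<not> (\<exists>b\<in>univ M (fst x). \<forall>j\<in>J. sat M ((a i j)(x := b)) (\<phi> i))) \<and>
     (\<forall>f. (\<forall>i\<in>fst q. f i \<le> snd q) \<longrightarrow> (\<exists>b\<in>univ M (fst x). \<forall>i\<in>fst q. sat M ((a i (f i))(x := b)) (\<phi> i))))"
    for q :: "'i set \<times> nat"
    using apx[of "fst q" "snd q"] ex_assignment[OF is_struct_nonempty[OF M]] unfolding approx_def
    by (cases "finite (fst q) \<and> fst q \<subseteq> I") auto
  then obtain a :: "'i set \<times> nat \<Rightarrow> 'i \<Rightarrow> nat \<Rightarrow> 's var \<Rightarrow> 'a" where a: "\<And>q i j. a q i j \<in> assignments M"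
    and rows: "\<And>q i J. finite (fst q) \<Longrightarrow> fst q \<subseteq> I \<Longrightarrow> i \<in> fst q \<Longrightarrow> J \<subseteq> {..snd q} \<Longrightarrow> card J = k i \<Longrightarrow>
      \<not> (\<exists>b\<in>univ M (fst x). \<forall>j\<in>J. sat M ((a q i j)(x := b)) (\<phi> i))"
    and paths: "\<And>q f. finite (fst q) \<Longrightarrow> fst q \<subseteq> I \<Longrightarrow> (\<forall>i\<in>fst q. f i \<le> snd q) \<Longrightarrow>
      (\<exists>b\<in>univ M (fst x). \<forall>i\<in>fst q. sat M ((a q i (f i))(x := b)) (\<phi> i))"
    by metis
  let ?K = "uprod L UNIV U (\<lambda>_. M)"
  define d where "d = (\<lambda>i j y. uclass UNIV U (\<lambda>_. univ M (fst y)) (\<lambda>q. a q i j y))"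
  have aPi: "(\<lambda>q. a q i j y) \<in> (\<Pi> q\<in>UNIV. univ M (fst y))" for i j y
    using assignmentsD[OF a] by auto
  have dK: "d i j \<in> assignments ?K" for i j
    unfolding assignments_def d_def using uprod_univI[OF U(2) M aPi] by blast
  have drep: "eventually (\<lambda>q. urep (d i j y) q = a q i j y) U" for i j y
    unfolding d_def by (rule urep_uclass(2)[OF aPi])
  have sat: "sat ?K ((d i j)(x := b)) (\<phi> i) \<longleftrightarrow> eventually (\<lambda>q. sat M ((a q i j)(x := urep b q)) (\<phi> i)) U"
    if "b \<in> univ ?K (fst x)" "i \<in> I" for i j b
  proof -
    have "eventually (\<lambda>q. \<forall>y\<in>fv (\<phi> i). urep (d i j y) q = a q i j y) U"
      using drep by (simp add: eventually_ball_finite_distrib)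
    then have "eventually (\<lambda>q. sat M (\<lambda>y. urep (((d i j)(x := b)) y) q) (\<phi> i)
        \<longleftrightarrow> sat M ((a q i j)(x := urep b q)) (\<phi> i)) U"
      by (rule eventually_mono) (auto intro!: sat_cong)
    from eventually_subst[OF this] show ?thesis
      using Los[OF U(2) M, of "\<phi> i" "(d i j)(x := b)"] dK that \<phi>[OF that(2)] by (simp add: fms_def)
  qed
  have "inp_pattern L ?K x I \<phi> d k"
    unfolding inp_pattern_def
  proof (intro conjI ballI allI impI)
    fix i and J :: "nat set" assume i: "i \<in> I" and J: "finite J \<and> card J = k i"
    show "\<not> (\<exists>b\<in>univ ?K (fst x). \<forall>j\<in>J. sat ?K ((d i j)(x := b)) (\<phi> i))"
    proof
      assume "\<exists>b\<in>univ ?K (fst x). \<forall>j\<in>J. sat ?K ((d i j)(x := b)) (\<phi> i)"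
      then obtain b where b: "b \<in> univ ?K (fst x)" "\<forall>j\<in>J. sat ?K ((d i j)(x := b)) (\<phi> i)" by blast
      then have "eventually (\<lambda>q. \<forall>j\<in>J. sat M ((a q i j)(x := urep b q)) (\<phi> i)) U"
        using J sat[OF b(1) i] by (simp add: eventually_ball_finite_distrib)
      \<comment> \<open>\<open>insert 0\<close> gives \<open>Max\<close> a value when
        \<open>J\<close> is empty, which happens if \<open>k i = 0\<close>.\<close>
      moreover have "eventually (\<lambda>q. finite (fst q) \<and> fst q \<subseteq> I \<and> {i} \<subseteq> fst q \<and> Max (insert 0 J) \<le> snd q) U"
        using i by (intro eventually_grid_filterI U(1)) auto
      ultimately have "eventually (\<lambda>q. False) U"
      proof (rule eventually_elim2)
        fix q assume 1: "\<forall>j\<in>J. sat M ((a q i j)(x := urep b q)) (\<phi> i)"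
          and 2: "finite (fst q) \<and> fst q \<subseteq> I \<and> {i} \<subseteq> fst q \<and> Max (insert 0 J) \<le> snd q"
        have "J \<subseteq> {..snd q}" using 2 J by auto
        moreover have "urep b q \<in> univ M (fst x)" using uprod_univ_urep(1)[OF U(2) M b(1)] by auto
        ultimately show False using rows[of q i J] 1 2 J by auto
      qed
      then show False using U(2) by (simp add: ultrafilter_on_def)
    qed
  next
    fix f :: "'i \<Rightarrow> nat" and I0 assume I0: "I0 \<subseteq> I" "finite I0"
    define g where "g = (\<lambda>q. SOME b. b \<in> univ M (fst x) \<and>
       ((\<exists>b\<in>univ M (fst x). \<forall>i\<in>I0. sat M ((a q i (f i))(x := b)) (\<phi> i))
        \<longrightarrow> (\<forall>i\<in>I0. sat M ((a q i (f i))(x := b)) (\<phi> i))))"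
    have g: "g q \<in> univ M (fst x) \<and>
       ((\<exists>b\<in>univ M (fst x). \<forall>i\<in>I0. sat M ((a q i (f i))(x := b)) (\<phi> i))
        \<longrightarrow> (\<forall>i\<in>I0. sat M ((a q i (f i))(x := g q)) (\<phi> i)))" for q
      unfolding g_def by (rule someI_ex) (use is_struct_nonempty[OF M] in blast)
    have gPi: "g \<in> (\<Pi> q\<in>UNIV. univ M (fst x))" using g by auto
    let ?b = "uclass UNIV U (\<lambda>_. univ M (fst x)) g"
    have b: "?b \<in> univ ?K (fst x)" by (rule uprod_univI[OF U(2) M gPi])
    have "eventually (\<lambda>q. finite (fst q) \<and> fst q \<subseteq> I \<and> I0 \<subseteq> fst q \<and> Max (insert 0 (f ` I0)) \<le> snd q) U"
      using I0 by (intro eventually_grid_filterI U(1)) auto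
    then have "eventually (\<lambda>q. \<forall>i\<in>I0. sat M ((a q i (f i))(x := g q)) (\<phi> i)) U"
    proof (rule eventually_mono)
      fix q assume 2: "finite (fst q) \<and> fst q \<subseteq> I \<and> I0 \<subseteq> fst q \<and> Max (insert 0 (f ` I0)) \<le> snd q"
      have "f i \<le> snd q" if "i \<in> I0" for i
        using 2 I0 that by auto
      then have "\<forall>i\<in>fst q. (if i \<in> I0 then f i else 0) \<le> snd q" by simp
      from paths[OF _ _ this] 2 obtain b where b: "b\<in>univ M (fst x)" and
        bi: "\<forall>i\<in>fst q. sat M ((a q i (if i \<in> I0 then f i else 0))(x := b)) (\<phi> i)" by blast
      have "sat M ((a q i (f i))(x := b)) (\<phi> i)" if "i \<in> I0" for i
        using bspec[OF bi, of i] that 2 by auto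
      with b g[of q] show "\<forall>i\<in>I0. sat M ((a q i (f i))(x := g q)) (\<phi> i)" by blast
    qed
    with urep_uclass(2)[OF gPi]
    have "eventually (\<lambda>q. \<forall>i\<in>I0. sat M ((a q i (f i))(x := urep ?b q)) (\<phi> i)) U"
      by (rule eventually_elim2) simp
    then have "\<forall>i\<in>I0. sat ?K ((d i (f i))(x := ?b)) (\<phi> i)"
      using sat[OF b] I0 by (simp add: eventually_ball_finite_distrib subset_iff)
    with b show "\<exists>b\<in>univ ?K (fst x). \<forall>i\<in>I0. sat ?K ((d i (f i))(x := b)) (\<phi> i)" by blast
  qed (use dK \<phi> in auto)
  moreover have "is_struct L ?K" by (rule is_struct_uprod[OF U(2) M])
  moreover have "?K \<Turnstile> \<psi> \<longleftrightarrow> M \<Turnstile> \<psi>" if "\<psi> \<in> sentences L" for \<psi>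
    using models_uprod[OF U(2) M that] U(2) by (simp add: ultrafilter_on_def)
  ultimately show ?thesis using dK by blast
qed

section \<open>Downward Loewenheim-Skolem and a finitary description of the burden\<close>

text \<open>Folding a pairing function over a list is injective only on lists of equal length; the
  length, embedded through \<open>\<iota>\<close>, is therefore paired with the result.\<close>

lemma infinite_inj_list:
  assumes "infinite (UNIV :: 'c set)"
  shows "\<exists>l :: 'c list \<Rightarrow> 'c. inj l"
proof -
  have "|UNIV \<times> UNIV :: ('c \<times> 'c) set| \<le>o |UNIV :: 'c set|"
    using card_of_Times_same_infinite[OF assms] ordIso_imp_ordLeq by blast
  then obtain p :: "'c \<times> 'c \<Rightarrow> 'c" where p: "inj p"
    by (auto simp: card_of_ordLeq[symmetric])
  obtain \<iota> :: "nat \<Rightarrow> 'c" where \<iota>: "inj \<iota>"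
    using assms infinite_countable_subset by blast
  define l where "l = (\<lambda>xs. foldr (\<lambda>a b. p (a, b)) xs (\<iota> 0))"
  have l: "xs = ys" if "length xs = length ys" "l xs = l ys" for xs ys
    using that by (induction rule: list_induct2) (auto simp: l_def dest: injD[OF p])
  have "inj (\<lambda>xs. p (\<iota> (length xs), l xs))"
    by (rule injI) (auto dest!: injD[OF p] dest: injD[OF \<iota>] intro: l)
  then show ?thesis by blast
qed

text \<open>Names for the elements of a Skolem hull: parameters and witnesses.\<close>

datatype ('s, 'f, 'p, 'i) skolem =
    Param 'i nat "'s var"
  | Witness "'s var" "('s, 'f, 'p) fm" "'s var list" "('s, 'f, 'p, 'i) skolem list"

context
  fixes l :: "'c list \<Rightarrow> 'c" and tg :: "nat \<Rightarrow> 'c" and ss :: "'s \<Rightarrow> 'c" and ff :: "'f \<Rightarrow> 'c"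
    and pp :: "'p \<Rightarrow> 'c" and ii :: "'i \<Rightarrow> 'c"
begin

definition enc_var :: "'s var \<Rightarrow> 'c" where
  "enc_var y = l [ss (fst y), tg (snd y)]"

primrec enc_trm :: "('s, 'f) trm \<Rightarrow> 'c" where
  "enc_trm (Var y) = l [tg 0, enc_var y]"
| "enc_trm (Fn f ts) = l (tg 1 # ff f # map enc_trm ts)"

primrec enc_fm :: "('s, 'f, 'p) fm \<Rightarrow> 'c" where
  "enc_fm (Eq t t') = l [tg 0, enc_trm t, enc_trm t']"
| "enc_fm (Rel P ts) = l (tg 1 # pp P # map enc_trm ts)"
| "enc_fm (Neg \<phi>) = l [tg 2, enc_fm \<phi>]"
| "enc_fm (Conj \<phi> \<psi>) = l [tg 3, enc_fm \<phi>, enc_fm \<psi>]"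
| "enc_fm (Ex x \<phi>) = l [tg 4, enc_var x, enc_fm \<phi>]"

primrec enc_skolem :: "('s, 'f, 'p, 'i) skolem \<Rightarrow> 'c" where
  "enc_skolem (Param i j y) = l [tg 0, ii i, tg j, enc_var y]"
| "enc_skolem (Witness x \<phi> ys cs) = l [tg 1, enc_var x, enc_fm \<phi>, l (map enc_var ys), l (map enc_skolem cs)]"

text \<open>Terms, formulas and names become lists with a leading tag for the constructor. Codes of
  variables, terms and formulas may coincide with one another, but they occur at positions where
  only one kind of object is possible. So all names fit into the type of elements prescribed in
  \<open>bdn\<close>.\<close>

lemma inj_enc_skolem:
  assumes "inj l" "inj tg" "inj ss" "inj ff" "inj pp" "inj ii"
  shows "inj enc_skolem"
proof -
  note [simp] = assms[THEN inj_eq]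
  have v: "enc_var y = enc_var y' \<longleftrightarrow> y = y'" for y y'
    by (auto simp: enc_var_def prod_eq_iff)
  have t: "enc_trm t = enc_trm t' \<Longrightarrow> t = t'" for t t'
  proof (induction t arbitrary: t')
    case (Fn f ts)
    then show ?case by (cases t') (auto dest: list.inj_map_strong[rotated])
  qed (case_tac t'; simp add: v)
  have ts: "map enc_trm ts = map enc_trm ts' \<Longrightarrow> ts = ts'" for ts ts'
    by (rule list.inj_map_strong[OF t])
  have f: "enc_fm \<phi> = enc_fm \<psi> \<Longrightarrow> \<phi> = \<psi>" for \<phi> \<psi>
    by (induction \<phi> arbitrary: \<psi>; case_tac \<psi>; simp add: v) (auto dest: t ts)
  have vs: "map enc_var ys = map enc_var ys' \<Longrightarrow> ys = ys'" for ys ys'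
    by (rule list.inj_map_strong) (auto simp: v)
  have "enc_skolem c = enc_skolem c' \<Longrightarrow> c = c'" for c c'
  proof (induction c arbitrary: c')
    case (Witness x \<phi> ys cs)
    then show ?case by (cases c') (auto simp: v dest: f vs list.inj_map_strong[rotated])
  qed (case_tac c'; simp add: v)
  then show ?thesis by (rule injI)
qed

end

text \<open>A witness that does not exist still has a value, possibly outside every sort; the hull
  is therefore intersected with the carriers when the small structure is built.\<close>

primrec skolem_val ::
  "('s, 'f, 'p, 'a) struct \<Rightarrow> ('i \<Rightarrow> nat \<Rightarrow> 's var \<Rightarrow> 'a) \<Rightarrow> ('s, 'f, 'p, 'i) skolem \<Rightarrow> 'a" where
  "skolem_val K a (Param i j y) = a i j y"
| "skolem_val K a (Witness x \<phi> ys cs) = (SOME b. b \<in> univ K (fst x) \<and>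
     sat K ((\<lambda>y. the (map_of (zip ys (map (skolem_val K a) cs)) y))(x := b)) \<phi>)"

text \<open>The Tarski-Vaught criterion for the hull: the parameters of \<open>\<phi>\<close> have
  names, and these names together with \<open>\<phi>\<close> name a witness.\<close>

lemma skolem_hull_witness:
  assumes "\<And>y. y \<in> fv \<phi> - {x} \<Longrightarrow> e y \<in> range (skolem_val K a)"
    and "\<exists>b\<in>univ K (fst x). sat K (e(x := b)) \<phi>"
  shows "\<exists>b\<in>univ K (fst x) \<inter> range (skolem_val K a). sat K (e(x := b)) \<phi>"
proof -
  obtain ys where ys: "set ys = fv \<phi> - {x}" "distinct ys"
    using finite_distinct_list[of "fv \<phi> - {x}"] by auto
  define c where "c = (\<lambda>y. SOME c. skolem_val K a c = e y)"
  have c: "skolem_val K a (c y) = e y" if "y \<in> set ys" for y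
    unfolding c_def by (rule someI_ex) (use assms(1)[of y] that ys in auto)
  have sat: "sat K ((\<lambda>y. the (map_of (zip ys (map (skolem_val K a) (map c ys))) y))(x := b)) \<phi>
      \<longleftrightarrow> sat K (e(x := b)) \<phi>" for b
  proof (rule sat_cong)
    fix y assume y: "y \<in> fv \<phi>"
    show "((\<lambda>y. the (map_of (zip ys (map (skolem_val K a) (map c ys))) y))(x := b)) y = (e(x := b)) y"
    proof (cases "y = x")
      case False
      with y ys have "y \<in> set ys" by auto
      then show ?thesis using False c[of y] by (simp add: map_of_zip_map)
    qed simp
  qed
  let ?w = "skolem_val K a (Witness x \<phi> ys (map c ys))"
  have "?w \<in> univ K (fst x) \<and> sat K (e(x := ?w)) \<phi>"
    unfolding skolem_val.simps sat by (rule someI_ex) (use assms(2) in blast)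
  then show ?thesis by blast
qed

text \<open>Closure under \<open>f\<close> is an instance of the witness property, for the formula
  \<open>f(ys) = x\<close>. The arguments get positive indices so that \<open>x\<close>, with index
  \<open>0\<close>, is fresh.\<close>

lemma skolem_hull_fun:
  fixes K :: "('s, 'f, 'p, 'a) struct"
  assumes K: "is_struct L K" and f: "f \<in> funs L"
    and as: "list_all2 (\<lambda>a s. a \<in> univ K s) as (fun_dom L f)" "set as \<subseteq> range (skolem_val K a)"
  shows "fun_int K f as \<in> univ K (fun_cod L f) \<inter> range (skolem_val K a)"
proof -
  define ys where "ys = map (\<lambda>i. (fun_dom L f ! i, Suc i)) [0..<length as]"
  define x where "x = (fun_cod L f, 0 :: nat)"
  define e where "e = (\<lambda>y :: 's var. as ! (snd y - 1))"
  have fx: "fun_int K f as \<in> univ K (fun_cod L f)" using K f as(1) by (simp add: is_struct_def)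
  have ev: "map (eval K (e(x := b))) (map Var ys) = as" for b
    by (rule nth_equalityI) (auto simp: ys_def e_def x_def)
  have sat: "sat K (e(x := b)) (Eq (Fn f (map Var ys)) (Var x)) \<longleftrightarrow> fun_int K f as = b" for b
    unfolding sat.simps eval.simps ev by simp
  have "\<exists>b\<in>univ K (fst x) \<inter> range (skolem_val K a). sat K (e(x := b)) (Eq (Fn f (map Var ys)) (Var x))"
  proof (rule skolem_hull_witness)
    fix y assume "y \<in> fv (Eq (Fn f (map Var ys)) (Var x)) - {x}"
    then have "e y \<in> set as" by (auto simp: ys_def e_def)
    then show "e y \<in> range (skolem_val K a)" using as(2) by blast
  qed (unfold sat, use fx in \<open>simp add: x_def\<close>)
  then obtain b where "b \<in> univ K (fst x) \<inter> range (skolem_val K a)" "fun_int K f as = b"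
    unfolding sat by blast
  then show ?thesis by (simp add: x_def)
qed

text \<open>\<open>K'\<close> lives on codes of names: \<open>d\<close> sends an element of the hull
  to the code of a chosen name, and \<open>g\<close> inverts it. So \<open>K'\<close> is a copy of
  the hull, an elementary substructure that contains the parameters of the pattern.\<close>

lemma Loewenheim_Skolem_inp_pattern:
  fixes K :: "('s, 'f, 'p, 'a) struct" and a :: "'i \<Rightarrow> nat \<Rightarrow> 's var \<Rightarrow> 'a"
    and h :: "('s, 'f, 'p, 'i) skolem \<Rightarrow> 'c"
  assumes K: "is_struct L K" and h: "inj h" and inp: "inp_pattern L K x I \<phi> a k"
  shows "\<exists>(K' :: ('s, 'f, 'p, 'c) struct) a'. is_struct L K' \<and>
    (\<forall>\<psi>\<in>sentences L. K' \<Turnstile> \<psi> \<longleftrightarrow> K \<Turnstile> \<psi>) \<and> inp_pattern L K' x I \<phi> a' k"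
proof -
  define H where "H = range (skolem_val K a)"
  define d where "d = (\<lambda>b. h (SOME c. skolem_val K a c = b))"
  have dinj: "inj_on d H"
  proof (rule inj_onI)
    fix b b' assume b: "b \<in> H" "b' \<in> H" and eq: "d b = d b'"
    have "skolem_val K a (SOME c. skolem_val K a c = b) = b" if "b \<in> H" for b
      by (rule someI_ex) (use that in \<open>auto simp: H_def\<close>)
    then show "b = b'" using eq b by (metis d_def h injD)
  qed
  define g where "g = inv_into H d"
  have gd [simp]: "g (d b) = b" if "b \<in> H" for b
    unfolding g_def by (rule inv_into_f_f[OF dinj that])
  define K' where "K' = \<lparr>univ = \<lambda>s. d ` (univ K s \<inter> H), fun_int = \<lambda>f as. d (fun_int K f (map g as)),
     rel_int = \<lambda>P as. rel_int K P (map g as)\<rparr>"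
  have uK': "univ K' s = d ` (univ K s \<inter> H)" for s by (simp add: K'_def)
  have gu: "g b \<in> univ K s \<inter> H" "d (g b) = b" if "b \<in> univ K' s" for b s
    using that by (auto simp: uK')
  have witness: "\<exists>b\<in>univ K (fst x) \<inter> H. sat K (e(x := b)) \<phi>"
    if "\<And>y. y \<in> fv \<phi> - {x} \<Longrightarrow> e y \<in> H" "\<exists>b\<in>univ K (fst x). sat K (e(x := b)) \<phi>" for e x \<phi>
    unfolding H_def by (rule skolem_hull_witness) (use that in \<open>auto simp: H_def\<close>)
  have fun_closed: "fun_int K f as \<in> univ K (fun_cod L f) \<inter> H"
    if "f \<in> funs L" "list_all2 (\<lambda>a s. a \<in> univ K s \<inter> H) as (fun_dom L f)" for f as
    unfolding H_def
  proof (rule skolem_hull_fun[OF K that(1)])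
    show "list_all2 (\<lambda>a s. a \<in> univ K s) as (fun_dom L f)"
      using that(2) by (rule list_all2_mono) blast
    show "set as \<subseteq> range (skolem_val K a)"
      using that(2) by (auto simp: H_def list_all2_conv_all_nth in_set_conv_nth)
  qed
  have K's: "is_struct L K'"
    unfolding is_struct_def
  proof (intro conjI allI ballI impI)
    fix s
    have "\<exists>b\<in>univ K s \<inter> H. True"
      using witness[of "Eq (Var (s, 0)) (Var (s, 0))" "(s, 0)"] is_struct_nonempty[OF K, of s] by auto
    then show "univ K' s \<noteq> {}" by (auto simp: uK')
  next
    fix f as assume f: "f \<in> funs L" and as: "list_all2 (\<lambda>a s. a \<in> univ K' s) as (fun_dom L f)"
    have "list_all2 (\<lambda>a s. a \<in> univ K s \<inter> H) (map g as) (fun_dom L f)"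
      unfolding list_all2_map1 using as by (rule list_all2_mono) (use gu(1) in blast)
    from fun_closed[OF f this] show "fun_int K' f as \<in> univ K' (fun_cod L f)"
      by (auto simp: K'_def)
  qed
  have eval: "has_sort L t s \<Longrightarrow> eval K' e t = d (eval K (g \<circ> e) t) \<and> eval K (g \<circ> e) t \<in> univ K s \<inter> H"
    if e: "e \<in> assignments K'" for e t s
  proof (induction rule: has_sort.induct)
    case (1 y)
    show ?case using gu[OF assignmentsD[OF e, of y]] by simp
  next
    case (2 f ts)
    have "map g (map (eval K' e) ts) = map (eval K (g \<circ> e)) ts"
      using 2(2) by (auto simp: list_all2_conv_all_nth in_set_conv_nth o_def)
    moreover have "list_all2 (\<lambda>a s. a \<in> univ K s \<inter> H) (map (eval K (g \<circ> e)) ts) (fun_dom L f)"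
      unfolding list_all2_map1 using 2(2) by (rule list_all2_mono) blast
    moreover have "fun_int K' f cs = d (fun_int K f (map g cs))" for cs by (simp add: K'_def)
    ultimately show ?case using fun_closed[OF 2(1)] by (simp only: eval.simps)
  qed
  have sat: "wf_fm L \<psi> \<Longrightarrow> e \<in> assignments K' \<Longrightarrow> sat K' e \<psi> \<longleftrightarrow> sat K (g \<circ> e) \<psi>" for \<psi> e
  proof (induction \<psi> arbitrary: e)
    case (Eq t t')
    then obtain s where s: "has_sort L t s" "has_sort L t' s" by auto
    show ?case using eval[OF Eq.prems(2) s(1)] eval[OF Eq.prems(2) s(2)]
      by (simp add: inj_on_eq_iff[OF dinj] o_def)
  next
    case (Rel P ts)
    have "map g (map (eval K' e) ts) = map (eval K (g \<circ> e)) ts"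
      using Rel.prems eval[OF Rel.prems(2)]
      by (fastforce simp: list_all2_conv_all_nth in_set_conv_nth)
    moreover have "rel_int K' P cs = rel_int K P (map g cs)" for cs by (simp add: K'_def)
    ultimately show ?case by (simp only: sat.simps)
  next
    case (Ex x \<psi>)
    have upd: "g \<circ> e(x := d b) = (g \<circ> e)(x := b)" if "b \<in> H" for b
      using that by (auto simp: fun_eq_iff)
    have IH: "sat K' (e(x := d b)) \<psi> \<longleftrightarrow> sat K ((g \<circ> e)(x := b)) \<psi>" if "b \<in> univ K (fst x) \<inter> H" for b
      using Ex.IH[of "e(x := d b)"] Ex.prems that upd[of b]
      by (simp only: wf_fm.simps assignments_upd uK' image_eqI IntD2)
    have "\<exists>b\<in>univ K (fst x) \<inter> H. sat K ((g \<circ> e)(x := b)) \<psi>"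
      if "\<exists>b\<in>univ K (fst x). sat K ((g \<circ> e)(x := b)) \<psi>"
      by (rule witness[OF _ that]) (use gu(1)[OF assignmentsD[OF Ex.prems(2)]] in auto)
    then show ?case using IH unfolding sat.simps uK' by blast
  qed auto
  have models: "K' \<Turnstile> \<psi> \<longleftrightarrow> K \<Turnstile> \<psi>" if "\<psi> \<in> sentences L" for \<psi>
  proof -
    obtain e where e: "e \<in> assignments K'" using ex_assignment is_struct_nonempty[OF K's] by blast
    have "K' \<Turnstile> \<psi> \<longleftrightarrow> sat K' e \<psi>"
      using that is_struct_nonempty[OF K's] by (intro models_iff_sat) (auto simp: sentences_def)
    also have "\<dots> \<longleftrightarrow> sat K (g \<circ> e) \<psi>" using that sat[OF _ e] by (simp add: sentences_def fms_def)
    also have "\<dots> \<longleftrightarrow> K \<Turnstile> \<psi>"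
      using that is_struct_nonempty[OF K] by (intro models_iff_sat[symmetric]) (auto simp: sentences_def)
    finally show ?thesis .
  qed
  have aH: "a i j y \<in> H" for i j y
    unfolding H_def by (rule range_eqI[of _ _ "Param i j y"]) simp
  have aK': "d \<circ> a i j \<in> assignments K'" if "i \<in> I" for i j
    using inp that assignmentsD[of "a i j" K] aH by (auto simp: inp_pattern_def assignments_def uK')
  have sat_a: "sat K' ((d \<circ> a i j)(x := d b)) (\<phi> i) \<longleftrightarrow> sat K ((a i j)(x := b)) (\<phi> i)"
    if "i \<in> I" "b \<in> univ K (fst x) \<inter> H" for i j b
  proof -
    have "g \<circ> (d \<circ> a i j)(x := d b) = (a i j)(x := b)" using that aH by (auto simp: fun_eq_iff)
    then show ?thesis using sat[of "\<phi> i" "(d \<circ> a i j)(x := d b)"] that aK' inp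
      by (simp only: inp_pattern_def fms_def mem_Collect_eq assignments_upd uK' image_eqI)
  qed
  have "inp_pattern L K' x I \<phi> (\<lambda>i j. d \<circ> a i j) k"
    unfolding inp_pattern_def
  proof (intro conjI ballI allI impI)
    fix i and J :: "nat set" assume i: "i \<in> I" and J: "finite J \<and> card J = k i"
    have "\<not> (\<exists>b\<in>univ K (fst x). \<forall>j\<in>J. sat K ((a i j)(x := b)) (\<phi> i))"
      using inp i J unfolding inp_pattern_def by blast
    then show "\<not> (\<exists>b\<in>univ K' (fst x). \<forall>j\<in>J. sat K' ((d \<circ> a i j)(x := b)) (\<phi> i))"
      unfolding uK' using sat_a[OF i] by auto
  next
    fix f :: "'i \<Rightarrow> nat" and I0 assume I0: "I0 \<subseteq> I" "finite I0"
    \<comment> \<open>The finitely many conditions on a path are merged into one formula with one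
      assignment of parameters, so that a single use of the witness property yields a common
      solution in the hull.\<close>
    let ?\<psi> = "Conjs ((\<lambda>i. rename_fm (param_var x (param_index I0 i (f i))) (\<phi> i)) ` I0)"
    let ?x = "param_var x 0 x" and ?e = "combine_params I0 a"
    have s: "sat K (?e(?x := b)) ?\<psi> \<longleftrightarrow> (\<forall>i\<in>I0. sat K ((a i (f i))(x := b)) (\<phi> i))" for b
      using sat_param_var[where i = "\<lambda>i. i", OF I0(2) is_struct_nonempty[OF K]] I0(2)
      by (simp add: combine_params_param_var)
    have "\<exists>b\<in>univ K (fst ?x) \<inter> H. sat K (?e(?x := b)) ?\<psi>"
    proof (rule witness)
      show "?e y \<in> H" for y using combine_params_value[of I0 a y] aH by auto
      show "\<exists>b\<in>univ K (fst ?x). sat K (?e(?x := b)) ?\<psi>"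
        unfolding s using inp I0 by (auto simp: inp_pattern_def)
    qed
    then obtain b where "b \<in> univ K (fst x) \<inter> H" "\<forall>i\<in>I0. sat K ((a i (f i))(x := b)) (\<phi> i)"
      unfolding s by auto
    then show "\<exists>b\<in>univ K' (fst x). \<forall>i\<in>I0. sat K' ((d \<circ> a i (f i))(x := b)) (\<phi> i)"
      using sat_a I0(1) unfolding uK' by blast
  qed (use inp aK' in \<open>auto simp: inp_pattern_def\<close>)
  then show ?thesis using K's models by blast
qed

lemma Neg_sentences: "\<phi> \<in> sentences L \<Longrightarrow> Neg \<phi> \<in> sentences L"
  by (simp add: sentences_def fms_def)

lemma models_Neg:
  assumes "\<phi> \<in> sentences L" "\<And>s. univ M s \<noteq> {}"
  shows "M \<Turnstile> Neg \<phi> \<longleftrightarrow> \<not> M \<Turnstile> \<phi>"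
proof -
  obtain e where "e \<in> assignments M" using ex_assignment[OF assms(2)] by blast
  moreover have "fv \<phi> = {}" using assms(1) by (simp add: sentences_def)
  ultimately show ?thesis
    using models_iff_sat[of \<phi> M e, OF _ assms(2)] models_iff_sat[of "Neg \<phi>" M e, OF _ assms(2)] by simp
qed

section \<open>Burden in terms of finite approximations\<close>

definition approximable :: "('s, 'f, 'p) lang \<Rightarrow> ('s, 'f, 'p, 'a) struct \<Rightarrow> 'i set \<Rightarrow> bool" where
  "approximable L M I \<longleftrightarrow> (\<exists>x \<phi> k. (\<forall>i\<in>I. \<phi> i \<in> fms L) \<and>
     (\<forall>I0 n. finite I0 \<longrightarrow> I0 \<subseteq> I \<longrightarrow> fapprox M x \<phi> k I0 n))"

lemma inp_patternD:
  assumes "inp_pattern L K x I \<phi> a k"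
  shows "\<And>i. i \<in> I \<Longrightarrow> \<phi> i \<in> fms L" "\<And>i j. i \<in> I \<Longrightarrow> a i j \<in> assignments K"
    "\<And>i J. i \<in> I \<Longrightarrow> finite J \<Longrightarrow> card J = k i \<Longrightarrow>
        \<not> (\<exists>b\<in>univ K (fst x). \<forall>j\<in>J. sat K ((a i j)(x := b)) (\<phi> i))"
    "\<And>f I0. I0 \<subseteq> I \<Longrightarrow> finite I0 \<Longrightarrow>
        \<exists>b\<in>univ K (fst x). \<forall>i\<in>I0. sat K ((a i (f i))(x := b)) (\<phi> i)"
  using assms unfolding inp_pattern_def by simp_all

lemma inp_pattern_fapprox:
  assumes K: "is_struct L K" and inp: "inp_pattern L K x I \<phi> a k" and I0: "finite I0" "I0 \<subseteq> I"
  shows "fapprox K x \<phi> k I0 n"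
proof -
  obtain e where e: "e \<in> assignments K" using ex_assignment is_struct_nonempty[OF K] by blast
  \<comment> \<open>The pattern says nothing about rows outside \<open>I\<close>, whereas
    \<open>approx\<close> asks for assignments everywhere.\<close>
  define a' where "a' = (\<lambda>i. if i \<in> I then a i else (\<lambda>_. e))"
  have a': "a' i = a i" if "i \<in> I0" for i using that I0 by (auto simp: a'_def)
  have 1: "a' i j \<in> assignments K" for i j
    using inp_patternD(2)[OF inp] e by (auto simp: a'_def)
  have 2: "\<not> (\<exists>b\<in>univ K (fst x). \<forall>j\<in>J. sat K ((a' i j)(x := b)) (\<phi> i))"
    if "i \<in> I0" "J \<subseteq> {..n}" "card J = k i" for i J
    unfolding a'[OF that(1)]
    by (rule inp_patternD(3)[OF inp]) (use that I0 finite_subset[OF that(2)] in auto)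
  have 3: "\<exists>b\<in>univ K (fst x). \<forall>i\<in>I0. sat K ((a' i (f i))(x := b)) (\<phi> i)" for f
    using inp_patternD(4)[OF inp I0(2,1), of f] by (simp add: a' cong: ball_cong)
  show ?thesis
    unfolding approx_def by (intro exI[of _ a'] conjI allI ballI impI 1 2 3)
qed

text \<open>If an approximation failed in \<open>M\<close>, the negation of its sentence would
  belong to \<open>Th L M\<close> and refute the pattern in \<open>M'\<close>. Conversely, the
  ultrapower given by compactness lives on another type; Loewenheim-Skolem brings it back to the one
  prescribed in \<open>bdn\<close>. The right-hand side no longer mentions that type, so burdens of
  structures on different types become comparable.\<close>

theorem bdn_eq_Sup_approximable:
  fixes M :: "('s, 'f, 'p, 'a) struct"
  assumes M: "is_struct L M"
  shows "bdn L M = Sup {cardinality I | I :: 'u set. approximable L M I}"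
proof -
  have "(\<exists>(M' :: ('s, 'f, 'p, 's + 'f + 'p + 'u + nat) struct) x \<phi> a k.
       is_struct L M' \<and> (\<forall>\<psi>\<in>Th L M. M' \<Turnstile> \<psi>) \<and> inp_pattern L M' x I \<phi> a k) \<longleftrightarrow> approximable L M I"
    for I :: "'u set"
  proof
    assume "\<exists>(M' :: ('s, 'f, 'p, 's + 'f + 'p + 'u + nat) struct) x \<phi> a k.
       is_struct L M' \<and> (\<forall>\<psi>\<in>Th L M. M' \<Turnstile> \<psi>) \<and> inp_pattern L M' x I \<phi> a k"
    then obtain M' :: "('s, 'f, 'p, 's + 'f + 'p + 'u + nat) struct" and x \<phi> a k where
      M': "is_struct L M'" "\<forall>\<psi>\<in>Th L M. M' \<Turnstile> \<psi>" and inp: "inp_pattern L M' x I \<phi> a k" by (elim exE conjE)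
    have "fapprox M x \<phi> k I0 n" if I0: "finite I0" "I0 \<subseteq> I" for I0 n
    proof (rule ccontr)
      let ?\<sigma> = "approx_sentence x \<phi> k I0 n"
      assume "\<not> fapprox M x \<phi> k I0 n"
      then have "\<not> M \<Turnstile> ?\<sigma>" unfolding models_approx_sentence[OF I0(1) is_struct_nonempty[OF M]] .
      moreover have s: "?\<sigma> \<in> sentences L"
        by (rule approx_sentence_sentences[OF I0(1)]) (rule inp_patternD(1)[OF inp], use I0(2) in blast)
      ultimately have "Neg ?\<sigma> \<in> Th L M"
        by (simp add: Th_def models_Neg[OF s is_struct_nonempty[OF M]] Neg_sentences)
      then have "M' \<Turnstile> Neg ?\<sigma>" by (rule bspec[OF M'(2)])
      moreover have "M' \<Turnstile> ?\<sigma>"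
        unfolding models_approx_sentence[OF I0(1) is_struct_nonempty[OF M'(1)]] by (rule inp_pattern_fapprox[OF M'(1) inp I0])
      ultimately show False
        by (simp add: models_Neg[OF s is_struct_nonempty[OF M'(1)]])
    qed
    then show "approximable L M I"
      unfolding approximable_def using inp_patternD(1)[OF inp]
      by (intro exI[of _ x] exI[of _ \<phi>] exI[of _ k] conjI ballI allI impI)
  next
    assume "approximable L M I"
    then obtain x \<phi> k where \<phi>: "\<forall>i\<in>I. \<phi> i \<in> fms L"
      and apx: "\<forall>I0 n. finite I0 \<longrightarrow> I0 \<subseteq> I \<longrightarrow> fapprox M x \<phi> k I0 n"
      unfolding approximable_def by (elim exE conjE)
    have "\<exists>(K :: ('s, 'f, 'p, ('u set \<times> nat \<Rightarrow> 'a) set) struct) a. is_struct L K \<and>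
      (\<forall>\<psi>\<in>sentences L. K \<Turnstile> \<psi> \<longleftrightarrow> M \<Turnstile> \<psi>) \<and> inp_pattern L K x I \<phi> a k \<and> (\<forall>i j. a i j \<in> assignments K)"
      using \<phi> apx by (intro compactness_inp_pattern[OF M]) simp_all
    then obtain K :: "('s, 'f, 'p, ('u set \<times> nat \<Rightarrow> 'a) set) struct" and a where K: "is_struct L K"
      "\<forall>\<psi>\<in>sentences L. K \<Turnstile> \<psi> \<longleftrightarrow> M \<Turnstile> \<psi>" "inp_pattern L K x I \<phi> a k"
      by (elim exE conjE)
    have "infinite (UNIV :: ('s + 'f + 'p + 'u + nat) set)"
      by (simp add: finite_Plus_UNIV_iff)
    then obtain l :: "('s + 'f + 'p + 'u + nat) list \<Rightarrow> 's + 'f + 'p + 'u + nat" where l: "inj l"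
      using infinite_inj_list by blast
    have "inj (enc_skolem l (\<lambda>n. Inr (Inr (Inr (Inr n)))) Inl (\<lambda>f. Inr (Inl f)) (\<lambda>p. Inr (Inr (Inl p)))
       (\<lambda>i. Inr (Inr (Inr (Inl i)))) :: ('s, 'f, 'p, 'u) skolem \<Rightarrow> _)"
      by (rule inj_enc_skolem[OF l]) (auto simp: inj_def)
    from Loewenheim_Skolem_inp_pattern[OF K(1) this K(3)]
    obtain M' :: "('s, 'f, 'p, 's + 'f + 'p + 'u + nat) struct" and a' where M': "is_struct L M'"
      "\<forall>\<psi>\<in>sentences L. M' \<Turnstile> \<psi> \<longleftrightarrow> K \<Turnstile> \<psi>" "inp_pattern L M' x I \<phi> a' k" by (elim exE conjE)
    have "\<forall>\<psi>\<in>Th L M. M' \<Turnstile> \<psi>" using M'(2) K(2) by (simp add: Th_def)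
    with M' show "\<exists>(M' :: ('s, 'f, 'p, 's + 'f + 'p + 'u + nat) struct) x \<phi> a k.
       is_struct L M' \<and> (\<forall>\<psi>\<in>Th L M. M' \<Turnstile> \<psi>) \<and> inp_pattern L M' x I \<phi> a k"
      by (intro exI conjI)
  qed
  then show ?thesis unfolding bdn_def by simp
qed

lemma cardinality_le_bdn:
  assumes "is_struct L M" "approximable L M I"
  shows "cardinality I \<le> bdn L M"
  unfolding bdn_eq_Sup_approximable[OF assms(1)] using assms(2) by (auto intro: Sup_upper)

section \<open>Elimination of quantifiers in a lexicographic product\<close>

text \<open>A bijection between the variables of the product and the variables of a one-sorted language.\<close>

definition enc :: "lex_sort var \<Rightarrow> unit var" where
  "enc x = ((), 3 * snd x + (case fst x of Main_Sort \<Rightarrow> 0 | Base_Sort \<Rightarrow> 1 | Main_Undet_Sort \<Rightarrow> 2))"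

definition dec :: "unit var \<Rightarrow> lex_sort var" where
  "dec z = (if snd z mod 3 = 0 then Main_Sort else if snd z mod 3 = 1 then Base_Sort
     else Main_Undet_Sort, snd z div 3)"

lemma dec_enc [simp]: "dec (enc x) = x"
  by (cases x) (auto simp: enc_def dec_def split: lex_sort.splits)

lemma enc_dec [simp]: "enc (dec z) = z"
proof -
  have "snd z mod 3 = 0 \<or> snd z mod 3 = 1 \<or> snd z mod 3 = 2" by presburger
  then have "snd (enc (dec z)) = snd z"
    using div_mult_mod_eq[of "snd z" 3] by (elim disjE) (simp_all add: enc_def dec_def)
  then show ?thesis by (simp add: prod_eq_iff)
qed

lemma dec_eq_iff: "dec z = x \<longleftrightarrow> z = enc x"
  by auto

lemma list_all2_unit: "list_all2 (\<lambda>x (s :: unit). P x) xs ys \<longleftrightarrow> length xs = length ys \<and> (\<forall>x\<in>set xs. P x)"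
  by (auto simp: list_all2_conv_all_nth all_set_conv_all_nth)

lemma assignments_unit: "e \<in> assignments M \<longleftrightarrow> (\<forall>z. e z \<in> dom1 M)"
  by (simp add: assignments_def)

lemma has_sort_unit_Var: "has_sort L (Var z) ()"
  using has_sort.intros(1)[of L z] by simp

lemma has_sort_unit_Fn:
  assumes "f \<in> funs L" "length ts = length (fun_dom L f)" "\<And>t. t \<in> set ts \<Longrightarrow> has_sort L t ()"
  shows "has_sort L (Fn f ts) ()"
proof -
  have "list_all2 (has_sort L) ts (fun_dom L f)"
    using assms(2,3) by (auto simp: list_all2_conv_all_nth)
  from has_sort.intros(2)[OF assms(1) this] show ?thesis by simp
qed

locale lex_sum =
  fixes LM :: "(unit, 'f, 'p) lang" and LN :: "(unit, 'g, 'q) lang"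
    and M :: "(unit, 'f, 'p, 'a) struct"
    and N :: "'a \<Rightarrow> (unit, 'g, 'q, 'b) struct"
  assumes M: "is_struct LM M"
    and N: "\<And>a. a \<in> dom1 M \<Longrightarrow> is_struct LN (N a)"
    and definable: "\<And>\<phi>. \<phi> \<in> sentences LN \<Longrightarrow> definable0 LM M {a \<in> dom1 M. N a \<Turnstile> \<phi>}"
begin

abbreviation "LS \<equiv> lex_lang LM LN"
abbreviation "S \<equiv> lex_product M N"

lemma M_nonempty: "univ M s \<noteq> {}"
  by (rule is_struct_nonempty[OF M])

lemma N_nonempty: "a \<in> dom1 M \<Longrightarrow> univ (N a) s \<noteq> {}"
  by (rule is_struct_nonempty[OF N])

lemma univ_S:
  "univ S Main_Sort = {Pt a b | a b. a \<in> dom1 M \<and> b \<in> dom1 (N a)}"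
  "univ S Base_Sort = Base ` dom1 M"
  "univ S Main_Undet_Sort = insert Undetermined {Pt a b | a b. a \<in> dom1 M \<and> b \<in> dom1 (N a)}"
  by (simp_all add: lex_product_def lex_main_def)

lemma is_struct_S: "is_struct LS S"
  unfolding is_struct_def
proof (intro conjI allI ballI impI)
  fix s show "univ S s \<noteq> {}"
    using M_nonempty N_nonempty by (cases s) (fastforce simp: univ_S)+
next
  fix h xs assume h: "h \<in> funs LS" and xs: "list_all2 (\<lambda>a s. a \<in> univ S s) xs (fun_dom LS h)"
  show "fun_int S h xs \<in> univ S (fun_cod LS h)"
  proof (cases h)
    case (Base_Fun f)
    then have f: "f \<in> funs LM" using h by (auto simp: lex_lang_def)
    have "list_all2 (\<lambda>a s. a \<in> univ M s) (map the_base xs) (fun_dom LM f)"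
      using xs Base_Fun by (auto simp: lex_lang_def univ_S list_all2_map1 list_all2_map2 elim!: list_all2_mono)
    then have "fun_int M f (map the_base xs) \<in> dom1 M" using M f by (simp add: is_struct_def)
    then show ?thesis using Base_Fun by (simp add: lex_lang_def univ_S) (simp add: lex_product_def)
  next
    case (Bullet_Fun f)
    then have f: "f \<in> funs LN" using h by (auto simp: lex_lang_def)
    have len: "length xs = length (fun_dom LN f)" and
      pts: "\<And>x. x \<in> set xs \<Longrightarrow> \<exists>a b. x = Pt a b \<and> a \<in> dom1 M \<and> b \<in> dom1 (N a)"
      using xs Bullet_Fun
      by (auto simp: lex_lang_def univ_S list_all2_map2 list_all2_unit)
    have "bullet_fun N f xs \<in> univ S Main_Undet_Sort"
    proof (cases "xs \<noteq> [] \<and> (\<forall>x\<in>set xs. fst_pt x = fst_pt (hd xs))")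
      case True
      let ?a = "fst_pt (hd xs)"
      have a: "?a \<in> dom1 M" using pts[of "hd xs"] hd_in_set[OF conjunct1[OF True]] by auto
      have "snd_pt x \<in> dom1 (N ?a)" if x: "x \<in> set xs" for x
      proof -
        obtain a b where ab: "x = Pt a b" "b \<in> dom1 (N a)" using pts[OF x] by blast
        have "fst_pt x = ?a" using True x by blast
        then show ?thesis using ab by simp
      qed
      then have "list_all2 (\<lambda>y s. y \<in> univ (N ?a) s) (map snd_pt xs) (fun_dom LN f)"
        using len by (simp add: list_all2_conv_all_nth)
      then have "fun_int (N ?a) f (map snd_pt xs) \<in> dom1 (N ?a)"
        using N[OF a] f by (simp add: is_struct_def)
      moreover have "bullet_fun N f xs = Pt ?a (fun_int (N ?a) f (map snd_pt xs))"
        using True unfolding bullet_fun_def by (rule if_P)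
      ultimately show ?thesis using a by (simp add: univ_S)
    next
      case False
      then have "bullet_fun N f xs = Undetermined" unfolding bullet_fun_def by (rule if_not_P)
      then show ?thesis by (simp add: univ_S)
    qed
    then show ?thesis using Bullet_Fun by (simp add: lex_lang_def) (simp add: lex_product_def)
  next
    case Proj
    then obtain x where "xs = [x]" "x \<in> univ S Main_Sort"
      using xs by (auto simp: lex_lang_def list_all2_Cons2)
    then show ?thesis using Proj by (auto simp: lex_lang_def univ_S) (auto simp: lex_product_def)
  next
    case Incl
    then obtain x where "xs = [x]" "x \<in> univ S Main_Sort"
      using xs by (auto simp: lex_lang_def list_all2_Cons2)
    then show ?thesis using Incl by (auto simp: lex_lang_def univ_S) (auto simp: lex_product_def)
  next
    case Undet
    then show ?thesis by (simp add: lex_lang_def univ_S) (simp add: lex_product_def)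
  qed
qed

lemma fun_int_S [simp]:
  "fun_int S (Base_Fun f) xs = Base (fun_int M f (map the_base xs))"
  "fun_int S (Bullet_Fun g) xs = bullet_fun N g xs"
  "fun_int S Proj xs = Base (fst_pt (hd xs))"
  "fun_int S Incl xs = hd xs"
  "fun_int S Undet xs = Undetermined"
  by (simp_all add: lex_product_def)

lemma rel_int_S [simp]:
  "rel_int S (Base_Rel P) xs = rel_int M P (map the_base xs)"
  "rel_int S (Bullet_Rel R) xs = bullet_rel (dom1 M) N R xs"
  by (simp_all add: lex_product_def)

text \<open>The value of \<open>bp\<close> at \<open>u\<close> is an arbitrary element of \<open>M\<close>, so that \<open>mval\<close> is always an assignment.\<close>

primrec bp :: "('a, 'b) lex_elem \<Rightarrow> 'a" where
  "bp (Pt a c) = a"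
| "bp (Base a) = a"
| "bp Undetermined = (SOME a. a \<in> dom1 M)"

definition mval :: "(lex_sort var \<Rightarrow> ('a, 'b) lex_elem) \<Rightarrow> unit var \<Rightarrow> 'a" where
  "mval e z = bp (e (dec z))"

definition pval :: "(lex_sort var \<Rightarrow> ('a, 'b) lex_elem) \<Rightarrow> unit var \<Rightarrow> 'b" where
  "pval e z = snd_pt (e (dec z))"

text \<open>
  The atoms to which formulas reduce: formulas of \<open>M\<close> about the projections of the variables, false
  by convention if some variable is \<open>u\<close>, and formulas of \<open>N a\<close> about variables in the fibre over
  \<open>a\<close>, false if the variables do not lie in a common fibre or if there are none.
\<close>

definition matom :: "(lex_sort var \<Rightarrow> ('a, 'b) lex_elem) \<Rightarrow> (unit, 'f, 'p) fm \<Rightarrow> bool" where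
  "matom e \<theta> \<longleftrightarrow> (\<forall>z\<in>fv \<theta>. e (dec z) \<noteq> Undetermined) \<and> sat M (mval e) \<theta>"

definition natom :: "(lex_sort var \<Rightarrow> ('a, 'b) lex_elem) \<Rightarrow> (unit, 'g, 'q) fm \<Rightarrow> bool" where
  "natom e \<psi> \<longleftrightarrow> fv \<psi> \<noteq> {} \<and>
     (\<exists>a. (\<forall>z\<in>fv \<psi>. \<exists>c. e (dec z) = Pt a c) \<and> sat (N a) (pval e) \<psi>)"

text \<open>Quantifier elimination in semantic form: instead of an equivalent Boolean combination of
  atoms, only the fact that finitely many atoms decide \<open>\<phi>\<close> is recorded. The atoms
  are formulas of \<open>LM\<close> and \<open>LN\<close>, not of the product.\<close>

definition determined where
  "determined \<phi> \<Theta> \<Psi> \<longleftrightarrow> finite \<Theta> \<and> finite \<Psi> \<and> \<Theta> \<subseteq> fms LM \<and> \<Psi> \<subseteq> fms LN \<and>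
     (\<forall>e\<in>assignments S. \<forall>e'\<in>assignments S.
        (\<forall>\<theta>\<in>\<Theta>. matom e \<theta> \<longleftrightarrow> matom e' \<theta>) \<longrightarrow> (\<forall>\<psi>\<in>\<Psi>. natom e \<psi> \<longleftrightarrow> natom e' \<psi>) \<longrightarrow>
        (sat S e \<phi> \<longleftrightarrow> sat S e' \<phi>))"

lemma bp_in: "b \<in> univ S s \<Longrightarrow> bp b \<in> dom1 M"
  using M_nonempty[of "()"] by (cases s) (auto simp: univ_S some_in_eq)

lemma mval_assignment: "e \<in> assignments S \<Longrightarrow> mval e \<in> assignments M"
  using bp_in[OF assignmentsD[of e S]] by (simp add: assignments_unit mval_def)

lemma mval_upd: "mval (e(x := b)) = (mval e)(enc x := bp b)"
  by (auto simp: fun_eq_iff mval_def dec_eq_iff)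

lemma pval_upd: "pval (e(x := b)) = (pval e)(enc x := snd_pt b)"
  by (auto simp: fun_eq_iff pval_def dec_eq_iff)

lemma univ_S_cases:
  assumes "b \<in> univ S s"
  obtains (Pt) a c where "b = Pt a c" "a \<in> dom1 M" "c \<in> dom1 (N a)" "s \<noteq> Base_Sort"
  | (Base) a where "b = Base a" "a \<in> dom1 M" "s = Base_Sort"
  | (Undet) "b = Undetermined" "s = Main_Undet_Sort"
  using assms by (cases s) (auto simp: univ_S)

lemma univ_S_Pt: "s \<noteq> Base_Sort \<Longrightarrow> Pt a c \<in> univ S s \<longleftrightarrow> a \<in> dom1 M \<and> c \<in> dom1 (N a)"
  by (cases s) (auto simp: univ_S)

section \<open>Terms and atomic formulas of the product\<close>

lemma defined_sort: "e \<in> assignments S \<Longrightarrow> fst x \<noteq> Main_Undet_Sort \<Longrightarrow> e x \<noteq> Undetermined"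
  using assignmentsD[of e S x] by (cases "fst x") (auto simp: univ_S)

text \<open>No function symbol takes values in the main sort, since the copies of the fibre
  functions may return \<open>u\<close>.\<close>

lemma main_term: "has_sort LS t Main_Sort \<Longrightarrow> \<exists>n. t = Var (Main_Sort, n)"
  by (erule has_sort.cases) (auto simp: lex_lang_def prod_eq_iff)

lemma main_terms:
  assumes "list_all2 (has_sort LS) ts (map (\<lambda>_. Main_Sort) ds)"
  shows "\<exists>ns. ts = map (\<lambda>n. Var (Main_Sort, n)) ns \<and> length ns = length ds"
proof -
  have "\<forall>t\<in>set ts. \<exists>n. t = Var (Main_Sort, n)"
    using assms main_term by (fastforce simp: list_all2_conv_all_nth in_set_conv_nth)
  then obtain f where "\<forall>t\<in>set ts. t = Var (Main_Sort, f t)" by metis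
  then have "ts = map (\<lambda>n. Var (Main_Sort, n)) (map f ts)"
    by (simp add: map_idI)
  moreover have "length (map f ts) = length ds" using assms by (auto dest: list_all2_lengthD)
  ultimately show ?thesis by blast
qed

text \<open>Besides the symbols of \<open>LM\<close> only \<open>Proj\<close> produces elements of
  \<open>M\<close>. Its argument is a variable by \<open>main_term\<close>, and \<open>mval\<close>
  reads the projection of that variable directly, so the symbol disappears.\<close>

lemma base_term:
  "has_sort LS t s \<Longrightarrow> s = Base_Sort \<Longrightarrow> \<exists>t'. has_sort LM t' () \<and>
     (\<forall>z\<in>fvt t'. fst (dec z) \<noteq> Main_Undet_Sort) \<and>
     (\<forall>e\<in>assignments S. eval S e t = Base (eval M (mval e) t'))"
proof (induction rule: has_sort.induct)
  case (1 x)
  have "e x = Base (bp (e x))" if "e \<in> assignments S" for e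
    using assignmentsD[OF that, of x] 1 by (auto simp: univ_S)
  then show ?case using 1
    by (intro exI[of _ "Var (enc x)"]) (auto simp: has_sort_unit_Var mval_def)
next
  case (2 h ts)
  show ?case
  proof (cases h)
    case (Base_Fun f)
    then have f: "f \<in> funs LM" and ts: "\<forall>t\<in>set ts. \<exists>t'. has_sort LM t' () \<and>
       (\<forall>z\<in>fvt t'. fst (dec z) \<noteq> Main_Undet_Sort) \<and>
       (\<forall>e\<in>assignments S. eval S e t = Base (eval M (mval e) t'))" and len: "length ts = length (fun_dom LM f)"
      using 2 by (auto simp: lex_lang_def list_all2_conv_all_nth in_set_conv_nth)
    obtain r where r: "\<forall>t\<in>set ts. has_sort LM (r t) () \<and>
       (\<forall>z\<in>fvt (r t). fst (dec z) \<noteq> Main_Undet_Sort) \<and>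
       (\<forall>e\<in>assignments S. eval S e t = Base (eval M (mval e) (r t)))" using bchoice[OF ts] by blast
    have "map (the_base \<circ> eval S e) ts = map (eval M (mval e)) (map r ts)" if "e \<in> assignments S" for e
      using r that by (auto simp: o_def)
    then have "eval S e (Fn h ts) = Base (eval M (mval e) (Fn f (map r ts)))" if "e \<in> assignments S" for e
      using that Base_Fun by (simp only: eval.simps fun_int_S map_map)
    moreover have "has_sort LM (Fn f (map r ts)) ()"
      using r len by (intro has_sort_unit_Fn f) auto
    ultimately show ?thesis using r by (intro exI[of _ "Fn f (map r ts)"]) auto
  next
    case Proj
    then obtain t where t: "ts = [t]" "has_sort LS t Main_Sort"
      using 2(2) by (auto simp: lex_lang_def list_all2_Cons2)
    then obtain n where n: "t = Var (Main_Sort, n)" using main_term by blast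
    have "Base (fst_pt (e (Main_Sort, n))) = Base (bp (e (Main_Sort, n)))" if "e \<in> assignments S" for e
      using assignmentsD[OF that, of "(Main_Sort, n)"] by (auto simp: univ_S)
    then show ?thesis using Proj t n
      by (intro exI[of _ "Var (enc (Main_Sort, n))"]) (auto simp: has_sort_unit_Var mval_def)
  qed (use 2 in \<open>auto simp: lex_lang_def\<close>)
qed

text \<open>The arguments of fibre functions are variables, so nothing is nested, and the value is a
  point over \<open>a\<close> precisely when all variables lie over \<open>a\<close>. The first
  alternative covers \<open>u\<close> and the constant symbols of the fibres.\<close>

lemma point_term:
  assumes "has_sort LS t s" "s \<noteq> Base_Sort"
  shows "(\<forall>e\<in>assignments S. eval S e t = Undetermined) \<or>
     (\<exists>t'. has_sort LN t' () \<and> fvt t' \<noteq> {} \<and> (\<forall>e\<in>assignments S. \<forall>a c. eval S e t = Pt a c \<longleftrightarrow>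
        (\<forall>z\<in>fvt t'. \<exists>c. e (dec z) = Pt a c) \<and> eval (N a) (pval e) t' = c))"
  using assms
proof (induction rule: has_sort.induct)
  case (1 x)
  then show ?case
    by (intro disjI2 exI[of _ "Var (enc x)"]) (auto simp: has_sort_unit_Var pval_def)
next
  case (2 h ts)
  show ?case
  proof (cases h)
    case (Bullet_Fun f)
    then have f: "f \<in> funs LN" using 2(1) by (auto simp: lex_lang_def)
    obtain ns where ns: "ts = map (\<lambda>n. Var (Main_Sort, n)) ns" "length ns = length (fun_dom LN f)"
      using main_terms[of ts "fun_dom LN f"] 2(2) Bullet_Fun by (auto simp: lex_lang_def list_all2_mono)
    have ev: "eval S e (Fn h ts) = bullet_fun N f (map (\<lambda>n. e (Main_Sort, n)) ns)" for e
      using Bullet_Fun ns(1) by (simp add: o_def)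
    show ?thesis
    proof (cases "ns = []")
      case True
      then show ?thesis unfolding ev by (simp add: bullet_fun_def)
    next
      case False
      let ?t = "Fn f (map (\<lambda>n. Var (enc (Main_Sort, n))) ns)"
      have evt: "eval (N a) (pval e) ?t = fun_int (N a) f (map snd_pt (map (\<lambda>n. e (Main_Sort, n)) ns))" for a e
        by (simp add: o_def pval_def)
      have "bullet_fun N f (map (\<lambda>n. e (Main_Sort, n)) ns) = Pt a c \<longleftrightarrow>
        (\<forall>n\<in>set ns. \<exists>c. e (Main_Sort, n) = Pt a c) \<and> eval (N a) (pval e) ?t = c"
        if e: "e \<in> assignments S" for e a c
      proof -
        have "\<exists>a c. e (Main_Sort, n) = Pt a c" for n
          using assignmentsD[OF e, of "(Main_Sort, n)"] by (auto simp: univ_S)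
        then have pt: "e (Main_Sort, n) = Pt (fst_pt (e (Main_Sort, n))) (snd_pt (e (Main_Sort, n)))" for n
          by (metis lex_elem.sel(1,2))
        have "(\<exists>c. e (Main_Sort, n) = Pt a c) \<longleftrightarrow> fst_pt (e (Main_Sort, n)) = a" for n
          using pt[of n] by (metis lex_elem.sel(1))
        then have "(\<forall>n\<in>set ns. \<exists>c. e (Main_Sort, n) = Pt a c) \<longleftrightarrow>
          (\<forall>n\<in>set ns. fst_pt (e (Main_Sort, n)) = fst_pt (e (Main_Sort, hd ns))) \<and> fst_pt (e (Main_Sort, hd ns)) = a"
          using hd_in_set[OF False] by auto
        moreover have "bullet_fun N f (map (\<lambda>n. e (Main_Sort, n)) ns) =
          (if \<forall>n\<in>set ns. fst_pt (e (Main_Sort, n)) = fst_pt (e (Main_Sort, hd ns))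
           then Pt (fst_pt (e (Main_Sort, hd ns))) (fun_int (N (fst_pt (e (Main_Sort, hd ns)))) f
             (map snd_pt (map (\<lambda>n. e (Main_Sort, n)) ns))) else Undetermined)"
          unfolding bullet_fun_def hd_map[OF False]
          by (simp only: map_is_Nil_conv False not_False_eq_True simp_thms set_map ball_simps)
        ultimately show ?thesis unfolding evt by auto
      qed
      moreover have "has_sort LN ?t ()"
        using ns(2) by (intro has_sort_unit_Fn f) (auto simp: has_sort_unit_Var)
      ultimately show ?thesis unfolding ev using False
        by (intro disjI2 exI[of _ ?t]) simp
    qed
  next
    case Incl
    then obtain t where t: "ts = [t]" "has_sort LS t Main_Sort"
      using 2(2) by (auto simp: lex_lang_def list_all2_Cons2)
    then obtain n where n: "t = Var (Main_Sort, n)" using main_term by blast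
    then show ?thesis using Incl t
      by (intro disjI2 exI[of _ "Var (enc (Main_Sort, n))"]) (auto simp: has_sort_unit_Var pval_def)
  qed (use 2 in \<open>auto simp: lex_lang_def\<close>)
qed

lemma eval_point_cases:
  assumes "has_sort LS t s" "s \<noteq> Base_Sort" "e \<in> assignments S"
  shows "eval S e t = Undetermined \<or> (\<exists>a c. eval S e t = Pt a c)"
proof -
  have "eval S e t \<in> univ S s" by (rule eval_in_univ[OF is_struct_S assms(3,1)])
  then show ?thesis using assms(2) by (cases rule: univ_S_cases) auto
qed

lemma determinedI:
  assumes "finite \<Theta>" "finite \<Psi>" "\<Theta> \<subseteq> fms LM" "\<Psi> \<subseteq> fms LN"
    "\<And>e e'. e \<in> assignments S \<Longrightarrow> e' \<in> assignments S \<Longrightarrow> (\<And>\<theta>. \<theta> \<in> \<Theta> \<Longrightarrow> matom e \<theta> \<longleftrightarrow> matom e' \<theta>) \<Longrightarrow>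
      (\<And>\<psi>. \<psi> \<in> \<Psi> \<Longrightarrow> natom e \<psi> \<longleftrightarrow> natom e' \<psi>) \<Longrightarrow> sat S e \<phi> \<longleftrightarrow> sat S e' \<phi>"
  shows "determined \<phi> \<Theta> \<Psi>"
  unfolding determined_def by (intro conjI ballI impI assms(1-4)) (rule assms(5); blast)

text \<open>Taking the same term twice, the atom says that its value is a point, i.e. not
  undetermined.\<close>

lemma natom_point:
  assumes t: "\<forall>e\<in>assignments S. \<forall>a c. eval S e t = Pt a c \<longleftrightarrow>
        (\<forall>z\<in>fvt t'. \<exists>c. e (dec z) = Pt a c) \<and> eval (N a) (pval e) t' = c"
    and u: "\<forall>e\<in>assignments S. \<forall>a c. eval S e u = Pt a c \<longleftrightarrow>
        (\<forall>z\<in>fvt u'. \<exists>c. e (dec z) = Pt a c) \<and> eval (N a) (pval e) u' = c"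
    and "fvt t' \<noteq> {}" and e: "e \<in> assignments S"
  shows "natom e (Eq t' u') \<longleftrightarrow> (\<exists>a c. eval S e t = Pt a c \<and> eval S e u = Pt a c)"
proof -
  have "natom e (Eq t' u') \<longleftrightarrow> (\<exists>a. (\<forall>z\<in>fvt t'. \<exists>c. e (dec z) = Pt a c) \<and> (\<forall>z\<in>fvt u'. \<exists>c. e (dec z) = Pt a c)
      \<and> eval (N a) (pval e) t' = eval (N a) (pval e) u')"
    using assms(3) unfolding natom_def fv.simps sat.simps ball_Un conj_assoc by blast
  also have "\<dots> \<longleftrightarrow> (\<exists>a c. ((\<forall>z\<in>fvt t'. \<exists>c. e (dec z) = Pt a c) \<and> eval (N a) (pval e) t' = c) \<and>
     ((\<forall>z\<in>fvt u'. \<exists>c. e (dec z) = Pt a c) \<and> eval (N a) (pval e) u' = c))"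
    by (intro iff_exI) auto
  finally show ?thesis using t e u by simp
qed

lemma determined_atomic_Eq:
  assumes "wf_fm LS (Eq t u)"
  shows "\<exists>\<Theta> \<Psi>. determined (Eq t u) \<Theta> \<Psi>"
proof -
  obtain s where s: "has_sort LS t s" "has_sort LS u s" using assms by auto
  show ?thesis
  proof (cases "s = Base_Sort")
    case True
    obtain t' where t': "has_sort LM t' ()" "\<forall>z\<in>fvt t'. fst (dec z) \<noteq> Main_Undet_Sort"
      "\<forall>e\<in>assignments S. eval S e t = Base (eval M (mval e) t')" using base_term[OF s(1) True] by blast
    obtain u' where u': "has_sort LM u' ()" "\<forall>z\<in>fvt u'. fst (dec z) \<noteq> Main_Undet_Sort"
      "\<forall>e\<in>assignments S. eval S e u = Base (eval M (mval e) u')" using base_term[OF s(2) True] by blast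
    have und: "e (dec z) \<noteq> Undetermined" if "e \<in> assignments S" "z \<in> fvt t' \<union> fvt u'" for e z
      using defined_sort[OF that(1), of "dec z"] that(2) t'(2) u'(2) by blast
    have "sat S e (Eq t u) \<longleftrightarrow> matom e (Eq t' u')" if "e \<in> assignments S" for e
      using that t'(3) u'(3) und[OF that] by (simp add: matom_def)
    then have "determined (Eq t u) {Eq t' u'} {}"
      using t'(1) u'(1) by (intro determinedI) (auto simp: fms_def)
    then show ?thesis by blast
  next
    case False
    \<comment> \<open>Two point terms are also equal when both are undetermined; in the general case
      this needs three atoms, one for the equality and one for each side being defined.\<close>
    have sat: "sat S e (Eq t u) \<longleftrightarrow> (\<exists>a c. eval S e t = Pt a c \<and> eval S e u = Pt a c) \<or>
        \<not> (\<exists>a c. eval S e t = Pt a c) \<and> \<not> (\<exists>a c. eval S e u = Pt a c)" if "e \<in> assignments S" for e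
      using eval_point_cases[OF s(1) False that] eval_point_cases[OF s(2) False that] by auto
    let ?U = "\<lambda>t. \<forall>e\<in>assignments S. eval S e t = Undetermined"
    let ?P = "\<lambda>t t'. has_sort LN t' () \<and> fvt t' \<noteq> {} \<and> (\<forall>e\<in>assignments S. \<forall>a c. eval S e t = Pt a c \<longleftrightarrow>
        (\<forall>z\<in>fvt t'. \<exists>c. e (dec z) = Pt a c) \<and> eval (N a) (pval e) t' = c)"
    consider "?U t" "?U u" | t' where "?P t t'" "?U u" | u' where "?U t" "?P u u'"
      | t' u' where "?P t t'" "?P u u'"
      using point_term[OF s(1) False] point_term[OF s(2) False] by blast
    then show ?thesis
    proof cases
      case 1
      then have "determined (Eq t u) {} {}" by (intro determinedI) auto
      then show ?thesis by blast
    next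
      case 2
      then have "natom e (Eq t' t') \<longleftrightarrow> (\<exists>a c. eval S e t = Pt a c)" if "e \<in> assignments S" for e
        using natom_point[of t t' t t'] that by blast
      then have "determined (Eq t u) {} {Eq t' t'}"
        using 2 by (intro determinedI) (auto simp: sat fms_def simp del: sat.simps)
      then show ?thesis by blast
    next
      case 3
      then have "natom e (Eq u' u') \<longleftrightarrow> (\<exists>a c. eval S e u = Pt a c)" if "e \<in> assignments S" for e
        using natom_point[of u u' u u'] that by blast
      then have "determined (Eq t u) {} {Eq u' u'}"
        using 3 by (intro determinedI) (auto simp: sat fms_def simp del: sat.simps)
      then show ?thesis by blast
    next
      case 4
      have n: "natom e (Eq t' t') \<longleftrightarrow> (\<exists>a c. eval S e t = Pt a c)"
        "natom e (Eq u' u') \<longleftrightarrow> (\<exists>a c. eval S e u = Pt a c)"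
        "natom e (Eq t' u') \<longleftrightarrow> (\<exists>a c. eval S e t = Pt a c \<and> eval S e u = Pt a c)" if "e \<in> assignments S" for e
        using natom_point[of t t' t t'] natom_point[of u u' u u'] natom_point[of t t' u u'] that 4 by auto
      have "determined (Eq t u) {} {Eq t' t', Eq u' u', Eq t' u'}"
      proof (rule determinedI)
        fix e e' assume e: "e \<in> assignments S" "e' \<in> assignments S"
          and nn: "\<And>\<psi>. \<psi> \<in> {Eq t' t', Eq u' u', Eq t' u'} \<Longrightarrow> natom e \<psi> \<longleftrightarrow> natom e' \<psi>"
        show "sat S e (Eq t u) \<longleftrightarrow> sat S e' (Eq t u)"
          unfolding sat[OF e(1)] sat[OF e(2)] n[OF e(1), symmetric] n[OF e(2), symmetric]
          using nn by simp
      qed (use 4 in \<open>auto simp: fms_def\<close>)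
      then show ?thesis by blast
    qed
  qed
qed

lemma determined_atomic_Rel:
  assumes "wf_fm LS (Rel R ts)"
  shows "\<exists>\<Theta> \<Psi>. determined (Rel R ts) \<Theta> \<Psi>"
proof (cases R)
  case (Base_Rel P)
  then have P: "P \<in> rels LM" and ts: "\<forall>t\<in>set ts. has_sort LS t Base_Sort" and len: "length ts = length (rel_dom LM P)"
    using assms by (auto simp: lex_lang_def list_all2_conv_all_nth in_set_conv_nth)
  have "\<forall>t\<in>set ts. \<exists>t'. has_sort LM t' () \<and> (\<forall>z\<in>fvt t'. fst (dec z) \<noteq> Main_Undet_Sort) \<and>
     (\<forall>e\<in>assignments S. eval S e t = Base (eval M (mval e) t'))"
    using ts base_term by blast
  from bchoice[OF this] obtain r where r: "\<forall>t\<in>set ts. has_sort LM (r t) () \<and>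
     (\<forall>z\<in>fvt (r t). fst (dec z) \<noteq> Main_Undet_Sort) \<and>
     (\<forall>e\<in>assignments S. eval S e t = Base (eval M (mval e) (r t)))" by blast
  let ?\<theta> = "Rel P (map r ts)"
  have "sat S e (Rel R ts) \<longleftrightarrow> matom e ?\<theta>" if e: "e \<in> assignments S" for e
  proof -
    have "map the_base (map (eval S e) ts) = map (eval M (mval e)) (map r ts)"
      using r e by auto
    then have "sat S e (Rel R ts) \<longleftrightarrow> sat M (mval e) ?\<theta>"
      using Base_Rel by (simp only: sat.simps rel_int_S)
    moreover have "e (dec z) \<noteq> Undetermined" if "z \<in> fv ?\<theta>" for z
      using defined_sort[OF e, of "dec z"] that r by auto
    ultimately show ?thesis by (simp add: matom_def)
  qed
  moreover have "?\<theta> \<in> fms LM"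
    using P r len by (auto simp: fms_def list_all2_conv_all_nth)
  ultimately have "determined (Rel R ts) {?\<theta>} {}"
    by (intro determinedI) auto
  then show ?thesis by blast
next
  case (Bullet_Rel P)
  then have P: "P \<in> rels LN" and l: "list_all2 (has_sort LS) ts (map (\<lambda>_. Main_Sort) (rel_dom LN P))"
    using assms by (auto simp: lex_lang_def)
  obtain ns where ns: "ts = map (\<lambda>n. Var (Main_Sort, n)) ns" "length ns = length (rel_dom LN P)"
    using main_terms[OF l] by blast
  show ?thesis
  proof (cases "ns = []")
    case True
    \<comment> \<open>A nullary fibre relation has a fixed truth value in the product: it holds if
      it holds in some fibre.\<close>
    then have "determined (Rel R ts) {} {}" using ns by (intro determinedI) auto
    then show ?thesis by blast
  next
    case False
    let ?\<psi> = "Rel P (map (\<lambda>n. Var (enc (Main_Sort, n))) ns)"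
    have "sat S e (Rel R ts) \<longleftrightarrow> natom e ?\<psi>" if e: "e \<in> assignments S" for e
    proof -
      have "sat S e (Rel R ts) \<longleftrightarrow> (\<exists>a\<in>dom1 M. \<exists>bs. map (\<lambda>n. e (Main_Sort, n)) ns = map (Pt a) bs \<and> rel_int (N a) P bs)"
        using Bullet_Rel ns(1) by (simp add: bullet_rel_def o_def)
      also have "\<dots> \<longleftrightarrow> (\<exists>a. (\<forall>n\<in>set ns. \<exists>c. e (Main_Sort, n) = Pt a c) \<and>
          rel_int (N a) P (map (\<lambda>n. snd_pt (e (Main_Sort, n))) ns))" (is "?l \<longleftrightarrow> ?r")
      proof
        assume ?l
        then obtain a bs where a: "map (\<lambda>n. e (Main_Sort, n)) ns = map (Pt a) bs" "rel_int (N a) P bs" by blast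
        have "map snd_pt (map (\<lambda>n. e (Main_Sort, n)) ns) = bs" unfolding a(1) by (simp add: o_def)
        moreover have "\<exists>c. e (Main_Sort, n) = Pt a c" if "n \<in> set ns" for n
        proof -
          have "e (Main_Sort, n) \<in> set (map (Pt a) bs)" unfolding a(1)[symmetric] using that by auto
          then show ?thesis by auto
        qed
        ultimately show ?r using a(2) by (intro exI[of _ a]) (simp add: o_def)
      next
        assume ?r
        then obtain a where a: "\<forall>n\<in>set ns. \<exists>c. e (Main_Sort, n) = Pt a c"
          "rel_int (N a) P (map (\<lambda>n. snd_pt (e (Main_Sort, n))) ns)" by blast
        obtain c where "e (Main_Sort, hd ns) = Pt a c" using a(1) hd_in_set[OF False] by blast
        then have "a \<in> dom1 M" using assignmentsD[OF e, of "(Main_Sort, hd ns)"] by (auto simp: univ_S)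
        moreover have "map (\<lambda>n. e (Main_Sort, n)) ns = map (Pt a) (map (\<lambda>n. snd_pt (e (Main_Sort, n))) ns)"
          using a(1) by fastforce
        ultimately show ?l using a(2) by blast
      qed
      also have "\<dots> \<longleftrightarrow> natom e ?\<psi>" using False by (auto simp: natom_def pval_def o_def)
      finally show ?thesis .
    qed
    moreover have "?\<psi> \<in> fms LN"
      using P ns by (auto simp: fms_def list_all2_conv_all_nth has_sort_unit_Var)
    ultimately have "determined (Rel R ts) {} {?\<psi>}"
      by (intro determinedI) auto
    then show ?thesis by blast
  qed
qed

end

section \<open>Back-and-forth between assignments that agree on finitely many atoms\<close>

definition signed :: "('s, 'f, 'p) fm set \<Rightarrow> ('s, 'f, 'p) fm set \<Rightarrow> ('s, 'f, 'p) fm" where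
  "signed T F = Conj (Conjs T) (Conjs (Neg ` F))"

lemma sat_signed:
  assumes "finite T" "finite F" "\<And>s. univ M s \<noteq> {}"
  shows "sat M e (signed T F) \<longleftrightarrow> (\<forall>\<theta>\<in>T. sat M e \<theta>) \<and> (\<forall>\<theta>\<in>F. \<not> sat M e \<theta>)"
  using assms by (simp add: signed_def sat_Conjs)

lemma fv_signed: "finite T \<Longrightarrow> finite F \<Longrightarrow> fv (signed T F) = \<Union> (fv ` T) \<union> \<Union> (fv ` F)"
  by (simp add: signed_def fv_Conjs)

lemma signed_fms:
  assumes "finite T" "finite F" "T \<subseteq> fms L" "F \<subseteq> fms L"
  shows "signed T F \<in> fms L"
proof -
  have "wf_fm L (Conjs T)" by (rule wf_Conjs) (use assms in \<open>auto simp: fms_def\<close>)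
  moreover have "wf_fm L (Conjs (Neg ` F))" by (rule wf_Conjs) (use assms in \<open>auto simp: fms_def\<close>)
  ultimately show ?thesis by (simp add: signed_def fms_def)
qed

lemma Ex_fms: "\<phi> \<in> fms L \<Longrightarrow> Ex x \<phi> \<in> fms L"
  by (simp add: fms_def)

context lex_sum
begin

text \<open>The hypothesis provides a formula in the variable with index \<open>0\<close>; shifting
  all indices by that of \<open>z\<close> is injective and moves this variable to
  \<open>z\<close>.\<close>

definition fibre_fm :: "unit var \<Rightarrow> (unit, 'g, 'q) fm \<Rightarrow> (unit, 'f, 'p) fm" where
  "fibre_fm z \<sigma> = rename_fm (\<lambda>y. ((), snd y + snd z))
     (SOME \<delta>. \<delta> \<in> fms1 LM \<and> {a \<in> dom1 M. N a \<Turnstile> \<sigma>} = solutions M \<delta>)"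

lemma fibre_fm:
  assumes "\<sigma> \<in> sentences LN"
  shows "fibre_fm z \<sigma> \<in> fms LM" "fv (fibre_fm z \<sigma>) \<subseteq> {z}"
    "e z \<in> dom1 M \<Longrightarrow> sat M e (fibre_fm z \<sigma>) \<longleftrightarrow> N (e z) \<Turnstile> \<sigma>"
proof -
  define \<delta> where "\<delta> = (SOME \<delta>. \<delta> \<in> fms1 LM \<and> {a \<in> dom1 M. N a \<Turnstile> \<sigma>} = solutions M \<delta>)"
  have \<delta>: "\<delta> \<in> fms1 LM \<and> {a \<in> dom1 M. N a \<Turnstile> \<sigma>} = solutions M \<delta>"
    unfolding \<delta>_def by (rule someI_ex) (use definable[OF assms] in \<open>auto simp: definable0_def\<close>)
  let ?r = "\<lambda>y :: unit var. ((), snd y + snd z)"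
  have r: "inj ?r" by (rule injI) (simp add: prod_eq_iff)
  have f: "fibre_fm z \<sigma> = rename_fm ?r \<delta>" by (simp add: fibre_fm_def \<delta>_def)
  have fv: "fv \<delta> \<subseteq> {((), 0)}" and wf: "wf_fm LM \<delta>" using \<delta> by (auto simp: fms1_def fms_def)
  show "fibre_fm z \<sigma> \<in> fms LM" unfolding f fms_def using wf_rename[of ?r LM \<delta>] wf by simp
  show "fv (fibre_fm z \<sigma>) \<subseteq> {z}" unfolding f fv_rename[OF r] using fv by (auto simp: prod_eq_iff)
  assume "e z \<in> dom1 M"
  have "sat M e (fibre_fm z \<sigma>) \<longleftrightarrow> sat M (e \<circ> ?r) \<delta>" unfolding f by (rule sat_rename[OF r]) simp
  also have "\<dots> \<longleftrightarrow> sat M (\<lambda>_. e z) \<delta>"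
  proof (rule sat_cong)
    fix y assume "y \<in> fv \<delta>"
    then have "y = ((), 0)" using fv by blast
    then show "(e \<circ> ?r) y = e z" by (cases z) simp
  qed
  also have "\<dots> \<longleftrightarrow> e z \<in> solutions M \<delta>" using \<open>e z \<in> dom1 M\<close> by (simp add: solutions_def)
  also have "\<dots> \<longleftrightarrow> N (e z) \<Turnstile> \<sigma>" using \<delta> \<open>e z \<in> dom1 M\<close> by blast
  finally show "sat M e (fibre_fm z \<sigma>) \<longleftrightarrow> N (e z) \<Turnstile> \<sigma>" .
qed

lemma matom_upd:
  "matom (e(x := b)) \<theta> \<longleftrightarrow> (enc x \<in> fv \<theta> \<longrightarrow> b \<noteq> Undetermined) \<and>
     (\<forall>z\<in>fv \<theta> - {enc x}. e (dec z) \<noteq> Undetermined) \<and> sat M ((mval e)(enc x := bp b)) \<theta>"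
  unfolding matom_def mval_upd by (auto simp: dec_eq_iff)

lemma matom_upd_notin:
  assumes "enc x \<notin> fv \<theta>"
  shows "matom (e(x := b)) \<theta> \<longleftrightarrow> matom e \<theta>"
proof -
  have "sat M ((mval e)(enc x := bp b)) \<theta> \<longleftrightarrow> sat M (mval e) \<theta>"
    by (rule sat_cong) (use assms in auto)
  moreover have "fv \<theta> - {enc x} = fv \<theta>" using assms by blast
  ultimately show ?thesis unfolding matom_upd using assms by (simp add: matom_def)
qed

lemma natom_upd_notin:
  assumes "enc x \<notin> fv \<psi>"
  shows "natom (e(x := b)) \<psi> \<longleftrightarrow> natom e \<psi>"
proof -
  have "sat (N a) (pval (e(x := b))) \<psi> \<longleftrightarrow> sat (N a) (pval e) \<psi>" for a
    unfolding pval_upd by (rule sat_cong) (use assms in auto)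
  moreover have "(e(x := b)) (dec z) = e (dec z)" if "z \<in> fv \<psi>" for z
    using that assms by (auto simp: dec_eq_iff)
  ultimately show ?thesis by (simp add: natom_def cong: ball_cong)
qed

lemma natom_upd_Pt:
  assumes "enc x \<in> fv \<psi>"
  shows "natom (e(x := Pt a c)) \<psi> \<longleftrightarrow>
    (\<forall>z\<in>fv \<psi> - {enc x}. \<exists>d. e (dec z) = Pt a d) \<and> sat (N a) ((pval e)(enc x := c)) \<psi>"
proof -
  have *: "(\<forall>z\<in>fv \<psi>. \<exists>d. (e(x := Pt a c)) (dec z) = Pt a' d) \<longleftrightarrow>
      a' = a \<and> (\<forall>z\<in>fv \<psi> - {enc x}. \<exists>d. e (dec z) = Pt a d)" for a'
    using assms by (auto simp: dec_eq_iff split: if_splits)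
  show ?thesis using assms unfolding natom_def * pval_upd by auto
qed

lemma natom_upd_nonPt:
  assumes "enc x \<in> fv \<psi>" "\<And>a c. b \<noteq> Pt a c"
  shows "\<not> natom (e(x := b)) \<psi>"
  using assms by (auto simp: natom_def dest!: bspec[of _ _ "enc x"])

lemma matom_Var_eq: "matom e (Eq (Var z) (Var z)) \<longleftrightarrow> e (dec z) \<noteq> Undetermined"
  by (simp add: matom_def)

text \<open>The equation \<open>z = z\<close>, false by convention at \<open>u\<close>, records
  whether the value of \<open>z\<close> is \<open>u\<close>. The other formulas express that some
  point of \<open>M\<close> has a given sign pattern on \<open>\<Theta>\<close>.\<close>

definition Mback :: "unit var \<Rightarrow> (unit, 'f, 'p) fm set \<Rightarrow> unit var set \<Rightarrow> (unit, 'f, 'p) fm set" where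
  "Mback zx \<Theta> V = (\<lambda>z. Eq (Var z) (Var z)) ` V \<union> (\<lambda>(T, F). Ex zx (signed T F)) ` (Pow \<Theta> \<times> Pow \<Theta>)"

text \<open>A matom fails as soon as one of its variables is \<open>u\<close>. The sign pattern of
  \<open>a\<close> is therefore taken only over those \<open>\<theta>\<close> whose other variables
  are defined; the quantified formula is then a true matom at \<open>e\<close>, hence at
  \<open>e'\<close>.\<close>

lemma Mback_step:
  assumes \<Theta>: "finite \<Theta>" "\<And>\<theta>. \<theta> \<in> \<Theta> \<Longrightarrow> fv \<theta> \<subseteq> insert zx V"
    and agree: "\<And>\<theta>. \<theta> \<in> Mback zx \<Theta> V \<Longrightarrow> matom e \<theta> \<longleftrightarrow> matom e' \<theta>"
    and a: "a \<in> dom1 M"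
  shows "\<exists>a'\<in>dom1 M. \<forall>\<theta>\<in>\<Theta>. (\<forall>z\<in>fv \<theta> - {zx}. e (dec z) \<noteq> Undetermined) \<longrightarrow>
     (sat M ((mval e)(zx := a)) \<theta> \<longleftrightarrow> sat M ((mval e')(zx := a')) \<theta>)"
proof -
  let ?d = "\<lambda>\<theta>. \<forall>z\<in>fv \<theta> - {zx}. e (dec z) \<noteq> Undetermined"
  define T where "T = {\<theta> \<in> \<Theta>. ?d \<theta> \<and> sat M ((mval e)(zx := a)) \<theta>}"
  define F where "F = {\<theta> \<in> \<Theta>. ?d \<theta> \<and> \<not> sat M ((mval e)(zx := a)) \<theta>}"
  have fin: "finite T" "finite F" using \<Theta>(1) by (auto simp: T_def F_def)
  have "sat M ((mval e)(zx := a)) (signed T F)"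
    unfolding sat_signed[OF fin M_nonempty] by (simp add: T_def F_def)
  then have "sat M (mval e) (Ex zx (signed T F))" using a by auto
  moreover have "\<forall>z\<in>fv (Ex zx (signed T F)). e (dec z) \<noteq> Undetermined"
    unfolding fv.simps fv_signed[OF fin] by (auto simp: T_def F_def)
  ultimately have "matom e (Ex zx (signed T F))" by (simp add: matom_def)
  moreover have "Ex zx (signed T F) \<in> Mback zx \<Theta> V"
    unfolding Mback_def T_def F_def by (intro UnI2 image_eqI[of _ _ "(T, F)"]) (auto simp: T_def F_def)
  ultimately have "matom e' (Ex zx (signed T F))" using agree by blast
  then obtain a' where a': "a' \<in> dom1 M" "sat M ((mval e')(zx := a')) (signed T F)"
    by (auto simp: matom_def)
  have TF: "\<theta> \<in> T \<Longrightarrow> sat M ((mval e')(zx := a')) \<theta>" "\<theta> \<in> F \<Longrightarrow> \<not> sat M ((mval e')(zx := a')) \<theta>" for \<theta>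
    using a'(2) unfolding sat_signed[OF fin M_nonempty] by blast+
  have "sat M ((mval e)(zx := a)) \<theta> \<longleftrightarrow> sat M ((mval e')(zx := a')) \<theta>" if "\<theta> \<in> \<Theta>" "?d \<theta>" for \<theta>
    using TF[of \<theta>] that unfolding T_def F_def by blast
  then show ?thesis using a'(1) by blast
qed

text \<open>The trivial equations make every element of \<open>W\<close> a free variable, so that
  the atom speaks about the fibre containing all of \<open>W\<close>, also when some of these
  variables do not occur in \<open>T\<close> and \<open>F\<close>.\<close>

definition Nback_fm :: "unit var \<Rightarrow> unit var set \<Rightarrow> (unit, 'g, 'q) fm set \<Rightarrow> (unit, 'g, 'q) fm set
    \<Rightarrow> (unit, 'g, 'q) fm" where
  "Nback_fm zx W T F = Conj (Conjs ((\<lambda>w. Eq (Var w) (Var w)) ` W)) (Ex zx (signed T F))"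

text \<open>If \<open>W\<close> is nonempty, it determines the fibre in which the quantified formula
  is evaluated on either side. If \<open>W\<close> is empty, that formula is a sentence, which
  \<open>natom\<close> cannot express; it is compared through the theories of the two
  fibres.\<close>

lemma Nback_step:
  assumes \<Psi>: "finite \<Psi>" "\<Psi> \<subseteq> fms LN" and W: "finite W" "zx \<notin> W"
    and eW: "\<And>w. w \<in> W \<Longrightarrow> \<exists>d. e (dec w) = Pt a d" and e'W: "\<And>w. w \<in> W \<Longrightarrow> \<exists>d. e' (dec w) = Pt a' d"
    and a: "a \<in> dom1 M" "a' \<in> dom1 M" and c: "c \<in> dom1 (N a)"
    and agree: "\<And>T F. T \<subseteq> \<Psi> \<Longrightarrow> F \<subseteq> \<Psi> \<Longrightarrow> W \<noteq> {} \<Longrightarrow> natom e (Nback_fm zx W T F) \<longleftrightarrow> natom e' (Nback_fm zx W T F)"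
    and agree0: "\<And>T F. T \<subseteq> \<Psi> \<Longrightarrow> F \<subseteq> \<Psi> \<Longrightarrow> (\<And>\<psi>. \<psi> \<in> T \<union> F \<Longrightarrow> fv \<psi> \<subseteq> {zx}) \<Longrightarrow> W = {} \<Longrightarrow>
       N a \<Turnstile> Ex zx (signed T F) \<longleftrightarrow> N a' \<Turnstile> Ex zx (signed T F)"
  shows "\<exists>c'\<in>dom1 (N a'). \<forall>\<psi>\<in>\<Psi>. fv \<psi> \<subseteq> insert zx W \<longrightarrow>
     (sat (N a) ((pval e)(zx := c)) \<psi> \<longleftrightarrow> sat (N a') ((pval e')(zx := c')) \<psi>)"
proof -
  define T where "T = {\<psi> \<in> \<Psi>. fv \<psi> \<subseteq> insert zx W \<and> sat (N a) ((pval e)(zx := c)) \<psi>}"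
  define F where "F = {\<psi> \<in> \<Psi>. fv \<psi> \<subseteq> insert zx W \<and> \<not> sat (N a) ((pval e)(zx := c)) \<psi>}"
  have fin: "finite T" "finite F" and sub: "T \<subseteq> \<Psi>" "F \<subseteq> \<Psi>" using \<Psi>(1) by (auto simp: T_def F_def)
  have "sat (N a) ((pval e)(zx := c)) (signed T F)"
    unfolding sat_signed[OF fin N_nonempty[OF a(1)]] by (simp add: T_def F_def)
  then have s: "sat (N a) (pval e) (Ex zx (signed T F))" using c by auto
  have fv: "fv (Ex zx (signed T F)) \<subseteq> W"
    unfolding fv.simps fv_signed[OF fin] by (auto simp: T_def F_def)
  have "sat (N a') (pval e') (Ex zx (signed T F))"
  proof (cases "W = {}")
    case True
    then have fv0: "fv (Ex zx (signed T F)) = {}" using fv by blast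
    have "N a \<Turnstile> Ex zx (signed T F)"
      using models_iff_sat[where M = "N a" and e = "pval e", OF fv0 N_nonempty[OF a(1)]] s by blast
    moreover have "fv \<psi> \<subseteq> {zx}" if "\<psi> \<in> T \<union> F" for \<psi> using that True by (auto simp: T_def F_def)
    ultimately have "N a' \<Turnstile> Ex zx (signed T F)" using agree0[OF sub] True by blast
    then show ?thesis
      using models_iff_sat[where M = "N a'" and e = "pval e'", OF fv0 N_nonempty[OF a(2)]] by blast
  next
    case False
    have fvn: "fv (Nback_fm zx W T F) = W"
      using fv W(1) by (auto simp: Nback_fm_def fv_Conjs)
    have satn: "sat (N b) g (Nback_fm zx W T F) \<longleftrightarrow> sat (N b) g (Ex zx (signed T F))" if "b \<in> dom1 M" for b g
      using sat_Conjs[of "(\<lambda>w. Eq (Var w) (Var w)) ` W" "N b" g] W(1) N_nonempty[OF that]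
      by (simp add: Nback_fm_def)
    have "natom e (Nback_fm zx W T F)"
      unfolding natom_def fvn using False eW s satn[OF a(1)] by blast
    then have "natom e' (Nback_fm zx W T F)" using agree[OF sub False] by blast
    then obtain b where b: "\<forall>z\<in>W. \<exists>c. e' (dec z) = Pt b c" "sat (N b) (pval e') (Nback_fm zx W T F)"
      unfolding natom_def fvn by blast
    obtain w where "w \<in> W" using False by blast
    then have "b = a'" using e'W[of w] b(1) by auto
    then show ?thesis using b(2) satn[OF a(2)] by simp
  qed
  then obtain c' where c': "c' \<in> dom1 (N a')" "sat (N a') ((pval e')(zx := c')) (signed T F)"
    by auto
  have TF: "\<psi> \<in> T \<Longrightarrow> sat (N a') ((pval e')(zx := c')) \<psi>" "\<psi> \<in> F \<Longrightarrow> \<not> sat (N a') ((pval e')(zx := c')) \<psi>" for \<psi>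
    using c'(2) unfolding sat_signed[OF fin N_nonempty[OF a(2)]] by blast+
  have "sat (N a) ((pval e)(zx := c)) \<psi> \<longleftrightarrow> sat (N a') ((pval e')(zx := c')) \<psi>"
    if "\<psi> \<in> \<Psi>" "fv \<psi> \<subseteq> insert zx W" for \<psi>
    using TF[of \<psi>] that unfolding T_def F_def by blast
  then show ?thesis using c'(1) by blast
qed

text \<open>The sentences whose truth in a fibre has to be known when a point is moved and no
  variable lies in its fibre.\<close>

definition fibre_sents :: "unit var \<Rightarrow> (unit, 'g, 'q) fm set \<Rightarrow> (unit, 'g, 'q) fm set" where
  "fibre_sents z \<Psi> = {Ex z (signed T F) | T F. T \<subseteq> \<Psi> \<and> F \<subseteq> \<Psi> \<and> (\<forall>\<psi>\<in>T \<union> F. fv \<psi> \<subseteq> {z})}"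

lemma finite_fibre_sents: "finite \<Psi> \<Longrightarrow> finite (fibre_sents z \<Psi>)"
  by (rule finite_subset[of _ "(\<lambda>(T, F). Ex z (signed T F)) ` (Pow \<Psi> \<times> Pow \<Psi>)"])
    (auto simp: fibre_sents_def)

lemma fibre_sentsI:
  "T \<subseteq> \<Psi> \<Longrightarrow> F \<subseteq> \<Psi> \<Longrightarrow> (\<And>\<psi>. \<psi> \<in> T \<union> F \<Longrightarrow> fv \<psi> \<subseteq> {z}) \<Longrightarrow> Ex z (signed T F) \<in> fibre_sents z \<Psi>"
  unfolding fibre_sents_def by blast

lemma fibre_sents_sentences:
  assumes \<Psi>: "finite \<Psi>" "\<Psi> \<subseteq> fms LN" and "\<sigma> \<in> fibre_sents z \<Psi>"
  shows "\<sigma> \<in> sentences LN"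
proof -
  obtain T F where TF: "\<sigma> = Ex z (signed T F)" "T \<subseteq> \<Psi>" "F \<subseteq> \<Psi>" "\<forall>\<psi>\<in>T \<union> F. fv \<psi> \<subseteq> {z}"
    using assms(3) unfolding fibre_sents_def by blast
  have fin: "finite T" "finite F" using TF(2,3) \<Psi>(1) by (auto intro: finite_subset)
  have "signed T F \<in> fms LN" by (rule signed_fms[OF fin]) (use TF \<Psi>(2) in auto)
  then have "\<sigma> \<in> fms LN" unfolding TF(1) by (rule Ex_fms)
  moreover have "fv \<sigma> = {}" using TF(4) unfolding TF(1) fv.simps fv_signed[OF fin] by blast
  ultimately show ?thesis by (simp add: sentences_def)
qed

text \<open>A point is moved in two stages. First its projection is moved in \<open>M\<close>, along
  with the equations that tell which variables share it and the formulas that tell which sentences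
  of \<open>\<Sigma>\<close> hold in its fibre. This is what the second stage needs to move the
  other coordinate into the fibre over the new projection.\<close>

lemma back_and_forth:
  assumes \<Theta>: "finite \<Theta>" and \<Psi>: "finite \<Psi>" "\<Psi> \<subseteq> fms LN"
    and V: "finite V" "enc x \<notin> V" "\<And>\<theta>. \<theta> \<in> \<Theta> \<Longrightarrow> fv \<theta> \<subseteq> insert (enc x) V"
      "\<And>\<psi>. \<psi> \<in> \<Psi> \<Longrightarrow> fv \<psi> \<subseteq> insert (enc x) V"
    and \<Sigma>: "\<Sigma> = fibre_sents (enc x) \<Psi>"
    and \<Theta>1: "\<Theta>1 = \<Theta> \<union> (\<lambda>z. Eq (Var (enc x)) (Var z)) ` V \<union> fibre_fm (enc x) ` \<Sigma>"
    and e: "e \<in> assignments S" "e' \<in> assignments S"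
    and agree: "\<And>\<theta>. \<theta> \<in> \<Theta> \<union> Mback (enc x) \<Theta>1 V \<Longrightarrow> matom e \<theta> \<longleftrightarrow> matom e' \<theta>"
      "\<And>\<psi>. \<psi> \<in> \<Psi> \<Longrightarrow> natom e \<psi> \<longleftrightarrow> natom e' \<psi>"
      "\<And>W T F. W \<subseteq> V \<Longrightarrow> T \<subseteq> \<Psi> \<Longrightarrow> F \<subseteq> \<Psi> \<Longrightarrow>
         natom e (Nback_fm (enc x) W T F) \<longleftrightarrow> natom e' (Nback_fm (enc x) W T F)"
    and b: "b \<in> univ S (fst x)"
  shows "\<exists>b'\<in>univ S (fst x). (\<forall>\<theta>\<in>\<Theta>. matom (e(x := b)) \<theta> \<longleftrightarrow> matom (e'(x := b')) \<theta>) \<and>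
    (\<forall>\<psi>\<in>\<Psi>. natom (e(x := b)) \<psi> \<longleftrightarrow> natom (e'(x := b')) \<psi>)"
proof (cases "b = Undetermined")
  case True
  have "matom (e(x := b)) \<theta> \<longleftrightarrow> matom (e'(x := b)) \<theta>" if "\<theta> \<in> \<Theta>" for \<theta>
    using agree(1)[of \<theta>] that True
    by (cases "enc x \<in> fv \<theta>") (simp add: matom_upd, simp add: matom_upd_notin)
  moreover have "natom (e(x := b)) \<psi> \<longleftrightarrow> natom (e'(x := b)) \<psi>" if "\<psi> \<in> \<Psi>" for \<psi>
    using agree(2)[OF that] natom_upd_nonPt[of x \<psi> b] True
    by (cases "enc x \<in> fv \<psi>") (auto simp: natom_upd_notin)
  ultimately show ?thesis using b by blast
next
  case False
  let ?zx = "enc x"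
  have fin\<Sigma>: "finite \<Sigma>" unfolding \<Sigma> by (rule finite_fibre_sents[OF \<Psi>(1)])
  note \<Sigma>s = fibre_sents_sentences[OF \<Psi>, of _ ?zx, folded \<Sigma>]
  have und: "e (dec z) = Undetermined \<longleftrightarrow> e' (dec z) = Undetermined" if "z \<in> V" for z
  proof -
    have "Eq (Var z) (Var z) \<in> Mback ?zx \<Theta>1 V" using that by (auto simp: Mback_def)
    then show ?thesis using agree(1) matom_Var_eq by blast
  qed
  have fin1: "finite \<Theta>1" unfolding \<Theta>1 using \<Theta> V(1) fin\<Sigma> by simp
  have fv1: "fv \<theta> \<subseteq> insert ?zx V" if "\<theta> \<in> \<Theta>1" for \<theta>
    using that V(3) fibre_fm(2)[OF \<Sigma>s, of _ ?zx] unfolding \<Theta>1 by auto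
  have aM: "bp b \<in> dom1 M" using b by (rule bp_in)
  have ag1: "matom e \<theta> \<longleftrightarrow> matom e' \<theta>" if "\<theta> \<in> Mback ?zx \<Theta>1 V" for \<theta> using agree(1) that by blast
  obtain a' where a': "a' \<in> dom1 M" and a'sat: "\<And>\<theta>. \<theta> \<in> \<Theta>1 \<Longrightarrow>
     (\<forall>z\<in>fv \<theta> - {?zx}. e (dec z) \<noteq> Undetermined) \<Longrightarrow>
     sat M ((mval e)(?zx := bp b)) \<theta> \<longleftrightarrow> sat M ((mval e')(?zx := a')) \<theta>"
    using Mback_step[OF fin1 fv1 ag1 aM] by blast
  have matoms: "matom (e(x := b)) \<theta> \<longleftrightarrow> matom (e'(x := b')) \<theta>"
    if "\<theta> \<in> \<Theta>" "b' \<noteq> Undetermined" "bp b' = a'" for \<theta> b'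
  proof -
    have "\<theta> \<in> \<Theta>1" using that by (simp add: \<Theta>1)
    moreover have "(\<forall>z\<in>fv \<theta> - {?zx}. e (dec z) \<noteq> Undetermined) \<longleftrightarrow>
       (\<forall>z\<in>fv \<theta> - {?zx}. e' (dec z) \<noteq> Undetermined)" using V(3)[OF that(1)] und by blast
    ultimately show ?thesis unfolding matom_upd that(3) using a'sat[of \<theta>] False that(2) by blast
  qed
  from b show ?thesis
  proof (cases rule: univ_S_cases)
    case (Base a)
    have "natom (e(x := b)) \<psi> \<longleftrightarrow> natom (e'(x := Base a')) \<psi>" if "\<psi> \<in> \<Psi>" for \<psi>
      using agree(2)[OF that] natom_upd_nonPt[of x \<psi> b] natom_upd_nonPt[of x \<psi> "Base a'"] Base
      by (cases "enc x \<in> fv \<psi>") (auto simp: natom_upd_notin)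
    moreover have "Base a' \<in> univ S (fst x)" using Base a' by (simp add: univ_S)
    ultimately show ?thesis using matoms by (intro bexI[of _ "Base a'"]) auto
  next
    case (Pt a c)
    define W where "W = {z \<in> V. \<exists>d. e (dec z) = Pt a d}"
    \<comment> \<open>To share a fibre means to be a point and to have the same projection; the
      former is recorded by the sort and by \<open>und\<close>, the latter by the equations in
      \<open>\<Theta>1\<close>.\<close>
    have W': "(\<exists>d. e' (dec z) = Pt a' d) \<longleftrightarrow> z \<in> W" if z: "z \<in> V" for z
    proof (cases "fst (dec z) = Base_Sort \<or> e (dec z) = Undetermined")
      case True
      then have "\<not> (\<exists>d. e (dec z) = Pt a d)" "\<not> (\<exists>d. e' (dec z) = Pt a' d)"
        using assignmentsD[OF e(1), of "dec z"] assignmentsD[OF e(2), of "dec z"] und[OF z]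
        by (auto simp: univ_S)
      then show ?thesis by (simp add: W_def)
    next
      case False
      obtain d1 d2 where d: "e (dec z) = Pt d1 d2"
        using assignmentsD[OF e(1), of "dec z"] False by (auto elim: univ_S_cases)
      obtain d1' d2' where d': "e' (dec z) = Pt d1' d2'"
        using assignmentsD[OF e(2), of "dec z"] False und[OF z] by (auto elim: univ_S_cases)
      have ne: "z \<noteq> ?zx" using z V(2) by auto
      have "Eq (Var ?zx) (Var z) \<in> \<Theta>1" using z by (auto simp: \<Theta>1)
      moreover have "\<forall>z'\<in>fv (Eq (Var ?zx) (Var z)) - {?zx}. e (dec z') \<noteq> Undetermined" using d by auto
      ultimately have "sat M ((mval e)(?zx := bp b)) (Eq (Var ?zx) (Var z)) \<longleftrightarrow>
          sat M ((mval e')(?zx := a')) (Eq (Var ?zx) (Var z))" by (rule a'sat)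
      then have "d1 = a \<longleftrightarrow> d1' = a'" using d d' ne Pt by (simp add: mval_def) (metis)
      then show ?thesis using d d' z by (auto simp: W_def)
    qed
    have "\<exists>c'\<in>dom1 (N a'). \<forall>\<psi>\<in>\<Psi>. fv \<psi> \<subseteq> insert ?zx W \<longrightarrow>
       (sat (N a) ((pval e)(?zx := c)) \<psi> \<longleftrightarrow> sat (N a') ((pval e')(?zx := c')) \<psi>)"
    proof (rule Nback_step[OF \<Psi>])
      show "finite W" "?zx \<notin> W" using V by (auto simp: W_def)
      show "\<exists>d. e (dec w) = Pt a d" if "w \<in> W" for w using that by (simp add: W_def)
      show "\<exists>d. e' (dec w) = Pt a' d" if "w \<in> W" for w using that W'[of w] by (simp add: W_def)
      show "natom e (Nback_fm ?zx W T F) \<longleftrightarrow> natom e' (Nback_fm ?zx W T F)" if "T \<subseteq> \<Psi>" "F \<subseteq> \<Psi>" for T F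
        by (rule agree(3)) (use that in \<open>auto simp: W_def\<close>)
      show "N a \<Turnstile> Ex ?zx (signed T F) \<longleftrightarrow> N a' \<Turnstile> Ex ?zx (signed T F)"
        if "T \<subseteq> \<Psi>" "F \<subseteq> \<Psi>" "\<And>\<psi>. \<psi> \<in> T \<union> F \<Longrightarrow> fv \<psi> \<subseteq> {?zx}" for T F
      proof -
        have \<sigma>: "Ex ?zx (signed T F) \<in> \<Sigma>"
          unfolding \<Sigma> by (rule fibre_sentsI) (use that in auto)
        then have "fibre_fm ?zx (Ex ?zx (signed T F)) \<in> \<Theta>1" by (simp add: \<Theta>1)
        moreover note f = fibre_fm[where z = ?zx, OF \<Sigma>s[OF \<sigma>]]
        ultimately have "sat M ((mval e)(?zx := bp b)) (fibre_fm ?zx (Ex ?zx (signed T F))) \<longleftrightarrow>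
            sat M ((mval e')(?zx := a')) (fibre_fm ?zx (Ex ?zx (signed T F)))"
          using f(2) by (intro a'sat) auto
        then show ?thesis using f(3)[of "(mval e)(?zx := bp b)"] f(3)[of "(mval e')(?zx := a')"] aM a' Pt(1)
          by simp
      qed
    qed (use Pt a' in auto)
    then obtain c' where c': "c' \<in> dom1 (N a')" and c'sat: "\<And>\<psi>. \<psi> \<in> \<Psi> \<Longrightarrow> fv \<psi> \<subseteq> insert ?zx W \<Longrightarrow>
       sat (N a) ((pval e)(?zx := c)) \<psi> \<longleftrightarrow> sat (N a') ((pval e')(?zx := c')) \<psi>" by blast
    have "natom (e(x := b)) \<psi> \<longleftrightarrow> natom (e'(x := Pt a' c')) \<psi>" if \<psi>: "\<psi> \<in> \<Psi>" for \<psi>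
    proof (cases "?zx \<in> fv \<psi>")
      case True
      have fv: "fv \<psi> - {?zx} \<subseteq> V" using V(4)[OF \<psi>] by blast
      have "(\<forall>z\<in>fv \<psi> - {?zx}. \<exists>d. e (dec z) = Pt a d) \<longleftrightarrow> fv \<psi> \<subseteq> insert ?zx W"
        using fv by (auto simp: W_def)
      moreover have "(\<forall>z\<in>fv \<psi> - {?zx}. \<exists>d. e' (dec z) = Pt a' d) \<longleftrightarrow> fv \<psi> \<subseteq> insert ?zx W"
        using fv W' by blast
      ultimately show ?thesis unfolding Pt(1) natom_upd_Pt[OF True] using c'sat[OF \<psi>] by blast
    qed (use agree(2)[OF \<psi>] in \<open>simp add: natom_upd_notin\<close>)
    moreover have "Pt a' c' \<in> univ S (fst x)" using Pt a' c' by (simp add: univ_S_Pt)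
    ultimately show ?thesis using matoms[of _ "Pt a' c'"] by (intro bexI[of _ "Pt a' c'"]) auto
  next
    case Undet
    then show ?thesis using False by simp
  qed
qed

lemma determined_Ex:
  assumes d: "determined \<phi> \<Theta> \<Psi>"
  shows "\<exists>\<Theta>' \<Psi>'. determined (Ex x \<phi>) \<Theta>' \<Psi>'"
proof -
  let ?zx = "enc x"
  have \<Theta>: "finite \<Theta>" "\<Theta> \<subseteq> fms LM" and \<Psi>: "finite \<Psi>" "\<Psi> \<subseteq> fms LN"
    and det: "\<And>e e'. e \<in> assignments S \<Longrightarrow> e' \<in> assignments S \<Longrightarrow>
      (\<forall>\<theta>\<in>\<Theta>. matom e \<theta> \<longleftrightarrow> matom e' \<theta>) \<Longrightarrow> (\<forall>\<psi>\<in>\<Psi>. natom e \<psi> \<longleftrightarrow> natom e' \<psi>) \<Longrightarrow> sat S e \<phi> \<longleftrightarrow> sat S e' \<phi>"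
    using d unfolding determined_def by blast+
  define V where "V = (\<Union> (fv ` \<Theta>) \<union> \<Union> (fv ` \<Psi>)) - {?zx}"
  have V: "finite V" "?zx \<notin> V" "\<And>\<theta>. \<theta> \<in> \<Theta> \<Longrightarrow> fv \<theta> \<subseteq> insert ?zx V" "\<And>\<psi>. \<psi> \<in> \<Psi> \<Longrightarrow> fv \<psi> \<subseteq> insert ?zx V"
    using \<Theta>(1) \<Psi>(1) by (auto simp: V_def)
  define \<Sigma> where "\<Sigma> = fibre_sents ?zx \<Psi>"
  define \<Theta>1 where "\<Theta>1 = \<Theta> \<union> (\<lambda>z. Eq (Var ?zx) (Var z)) ` V \<union> fibre_fm ?zx ` \<Sigma>"
  define \<Theta>' where "\<Theta>' = \<Theta> \<union> Mback ?zx \<Theta>1 V"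
  define \<Psi>' where "\<Psi>' = \<Psi> \<union> (\<lambda>(W, T, F). Nback_fm ?zx W T F) ` (Pow V \<times> Pow \<Psi> \<times> Pow \<Psi>)"
  have fin\<Sigma>: "finite \<Sigma>" unfolding \<Sigma>_def by (rule finite_fibre_sents[OF \<Psi>(1)])
  note \<Sigma>s = fibre_sents_sentences[OF \<Psi>, of _ ?zx, folded \<Sigma>_def]
  have fin1: "finite \<Theta>1" unfolding \<Theta>1_def using \<Theta> V(1) fin\<Sigma> by simp
  have fms_Eq: "Eq (Var z) (Var z') \<in> fms L" for z z' :: "unit var" and L :: "(unit, 'x, 'y) lang"
    by (auto simp: fms_def has_sort_unit_Var)
  have fms1: "\<Theta>1 \<subseteq> fms LM" unfolding \<Theta>1_def
    using \<Theta>(2) fms_Eq[of ?zx _ LM] fibre_fm(1)[OF \<Sigma>s, of _ ?zx] by blast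
  have fms': "Mback ?zx \<Theta>1 V \<subseteq> fms LM"
  proof -
    have "Ex ?zx (signed T F) \<in> fms LM" if "T \<subseteq> \<Theta>1" "F \<subseteq> \<Theta>1" for T F
      using that fin1 fms1 by (intro Ex_fms signed_fms) (auto intro: finite_subset)
    then show ?thesis using fms_Eq by (auto simp: Mback_def)
  qed
  have fmsN: "Nback_fm ?zx W T F \<in> fms LN" if "W \<subseteq> V" "T \<subseteq> \<Psi>" "F \<subseteq> \<Psi>" for W T F
  proof -
    have "Ex ?zx (signed T F) \<in> fms LN"
      using that \<Psi> by (intro Ex_fms signed_fms) (auto intro: finite_subset)
    moreover have "wf_fm LN (Conjs ((\<lambda>w. Eq (Var w) (Var w)) ` W))"
      using that V(1) by (intro wf_Conjs) (auto intro: finite_subset simp: has_sort_unit_Var)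
    ultimately show ?thesis by (simp add: Nback_fm_def fms_def)
  qed
  have half: "sat S e' (Ex x \<phi>)"
    if e: "e \<in> assignments S" "e' \<in> assignments S" and sat: "sat S e (Ex x \<phi>)"
      and ag: "\<And>\<theta>. \<theta> \<in> \<Theta>' \<Longrightarrow> matom e \<theta> \<longleftrightarrow> matom e' \<theta>" "\<And>\<psi>. \<psi> \<in> \<Psi>' \<Longrightarrow> natom e \<psi> \<longleftrightarrow> natom e' \<psi>"
    for e e'
  proof -
    obtain b where b: "b \<in> univ S (fst x)" "sat S (e(x := b)) \<phi>" using sat by auto
    have "\<exists>b'\<in>univ S (fst x). (\<forall>\<theta>\<in>\<Theta>. matom (e(x := b)) \<theta> \<longleftrightarrow> matom (e'(x := b')) \<theta>) \<and>
      (\<forall>\<psi>\<in>\<Psi>. natom (e(x := b)) \<psi> \<longleftrightarrow> natom (e'(x := b')) \<psi>)"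
    proof (rule back_and_forth[OF \<Theta>(1) \<Psi> V \<Sigma>_def \<Theta>1_def e _ _ _ b(1)])
      show "matom e \<theta> \<longleftrightarrow> matom e' \<theta>" if "\<theta> \<in> \<Theta> \<union> Mback ?zx \<Theta>1 V" for \<theta>
        using ag(1) that by (simp add: \<Theta>'_def)
      show "natom e \<psi> \<longleftrightarrow> natom e' \<psi>" if "\<psi> \<in> \<Psi>" for \<psi>
        using ag(2) that by (simp add: \<Psi>'_def)
      show "natom e (Nback_fm ?zx W T F) \<longleftrightarrow> natom e' (Nback_fm ?zx W T F)"
        if "W \<subseteq> V" "T \<subseteq> \<Psi>" "F \<subseteq> \<Psi>" for W T F
        by (rule ag(2)) (use that in \<open>auto simp: \<Psi>'_def intro!: image_eqI[of _ _ "(W, T, F)"]\<close>)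
    qed
    then obtain b' where b': "b' \<in> univ S (fst x)" "\<forall>\<theta>\<in>\<Theta>. matom (e(x := b)) \<theta> \<longleftrightarrow> matom (e'(x := b')) \<theta>"
      "\<forall>\<psi>\<in>\<Psi>. natom (e(x := b)) \<psi> \<longleftrightarrow> natom (e'(x := b')) \<psi>" by blast
    have "sat S (e'(x := b')) \<phi>"
      using det[OF assignments_upd[OF e(1) b(1)] assignments_upd[OF e(2) b'(1)] b'(2,3)] b(2) by blast
    then show ?thesis using b'(1) by auto
  qed
  have "determined (Ex x \<phi>) \<Theta>' \<Psi>'"
  proof (rule determinedI)
    show "finite \<Theta>'" unfolding \<Theta>'_def Mback_def using \<Theta>(1) V(1) fin1 by simp
    show "finite \<Psi>'" unfolding \<Psi>'_def using \<Psi>(1) V(1) by simp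
    show "\<Theta>' \<subseteq> fms LM" unfolding \<Theta>'_def using \<Theta>(2) fms' by blast
    show "\<Psi>' \<subseteq> fms LN" unfolding \<Psi>'_def using \<Psi>(2) fmsN by auto
    fix e e' assume e: "e \<in> assignments S" "e' \<in> assignments S"
      and ag: "\<And>\<theta>. \<theta> \<in> \<Theta>' \<Longrightarrow> matom e \<theta> \<longleftrightarrow> matom e' \<theta>" "\<And>\<psi>. \<psi> \<in> \<Psi>' \<Longrightarrow> natom e \<psi> \<longleftrightarrow> natom e' \<psi>"
    show "sat S e (Ex x \<phi>) \<longleftrightarrow> sat S e' (Ex x \<phi>)"
      using half[OF e _ ag] half[OF e(2,1) _ ag(1)[symmetric] ag(2)[symmetric]] by blast
  qed
  then show ?thesis by blast
qed

theorem quantifier_elimination: "wf_fm LS \<phi> \<Longrightarrow> \<exists>\<Theta> \<Psi>. determined \<phi> \<Theta> \<Psi>"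
proof (induction \<phi>)
  case (Eq t u)
  then show ?case by (rule determined_atomic_Eq)
next
  case (Rel R ts)
  then show ?case by (rule determined_atomic_Rel)
next
  case (Neg \<phi>)
  then have "\<exists>\<Theta> \<Psi>. determined \<phi> \<Theta> \<Psi>" by simp
  then obtain \<Theta> \<Psi> where "determined \<phi> \<Theta> \<Psi>" by blast
  moreover have "determined (Neg \<phi>) \<Theta> \<Psi> \<longleftrightarrow> determined \<phi> \<Theta> \<Psi>"
    by (simp only: determined_def sat.simps simp_thms)
  ultimately show ?case by blast
next
  case (Conj \<phi> \<phi>')
  then have "\<exists>\<Theta> \<Psi>. determined \<phi> \<Theta> \<Psi>" "\<exists>\<Theta> \<Psi>. determined \<phi>' \<Theta> \<Psi>" by simp_all
  then obtain \<Theta> \<Psi> \<Theta>' \<Psi>' where d: "determined \<phi> \<Theta> \<Psi>" "determined \<phi>' \<Theta>' \<Psi>'"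
    by (elim exE)
  note d1 = d(1)[unfolded determined_def] and d2 = d(2)[unfolded determined_def]
  have "determined (Conj \<phi> \<phi>') (\<Theta> \<union> \<Theta>') (\<Psi> \<union> \<Psi>')"
  proof (rule determinedI)
    fix e e' assume e: "e \<in> assignments S" "e' \<in> assignments S"
      and ag: "\<And>\<theta>. \<theta> \<in> \<Theta> \<union> \<Theta>' \<Longrightarrow> matom e \<theta> \<longleftrightarrow> matom e' \<theta>" "\<And>\<psi>. \<psi> \<in> \<Psi> \<union> \<Psi>' \<Longrightarrow> natom e \<psi> \<longleftrightarrow> natom e' \<psi>"
    have "sat S e \<phi> \<longleftrightarrow> sat S e' \<phi>"
      using d1 e ag by (meson UnI1)
    moreover have "sat S e \<phi>' \<longleftrightarrow> sat S e' \<phi>'"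
      using d2 e ag by (meson UnI2)
    ultimately show "sat S e (Conj \<phi> \<phi>') \<longleftrightarrow> sat S e' (Conj \<phi> \<phi>')" by simp
  qed (use d1 d2 in auto)
  then show ?case by blast
next
  case (Ex x \<phi>)
  then have "\<exists>\<Theta> \<Psi>. determined \<phi> \<Theta> \<Psi>" by simp
  then obtain \<Theta> \<Psi> where "determined \<phi> \<Theta> \<Psi>" by blast
  then show ?case by (rule determined_Ex)
qed

end

section \<open>Homogeneous subgrids\<close>

text \<open>\<open>{..p}\<close> has \<open>p + 1 > n * card C\<close> elements, so some class has
  more than \<open>n\<close>.\<close>

lemma pigeonhole_fibre:
  assumes "finite C" "\<And>j. v j \<in> C" "n * card C \<le> p"
  shows "\<exists>c\<in>C. \<exists>J\<subseteq>{..p::nat}. card J = Suc n \<and> (\<forall>j\<in>J. v j = c)"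
proof (rule ccontr)
  assume h: "\<not> ?thesis"
  have "card {j \<in> {..p}. v j = c} \<le> n" if "c \<in> C" for c
  proof (rule ccontr)
    assume "\<not> card {j \<in> {..p}. v j = c} \<le> n"
    then obtain J where "J \<subseteq> {j \<in> {..p}. v j = c}" "card J = Suc n"
      by (meson not_less_eq_eq obtain_subset_with_card_n)
    then have "J \<subseteq> {..p}" "card J = Suc n" "\<forall>j\<in>J. v j = c" by auto
    with h that show False by blast
  qed
  then have "(\<Sum>c\<in>C. card {j \<in> {..p}. v j = c}) \<le> card C * n"
    using sum_bounded_above[of C "\<lambda>c. card {j \<in> {..p}. v j = c}" n] by simp
  moreover have eq: "(\<Union>c\<in>C. {j \<in> {..p}. v j = c}) = {..p}" using assms(2) by auto
  have "card {..p} \<le> (\<Sum>c\<in>C. card {j \<in> {..p}. v j = c})"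
    using card_UN_le[OF assms(1), of "\<lambda>c. {j \<in> {..p}. v j = c}"] unfolding eq .
  ultimately have "card {..p} \<le> card C * n" by linarith
  then show False using assms(3) by (simp add: mult.commute)
qed

text \<open>Colours are natural numbers because the induction replaces them by tuples of colours.\<close>

lemma homogeneous_subgrid:
  assumes "finite I"
  shows "finite (C :: nat set) \<Longrightarrow> \<exists>m. \<forall>\<chi> :: ('i \<Rightarrow> nat) \<Rightarrow> nat. (\<forall>f. \<chi> f \<in> C) \<longrightarrow>
     (\<forall>f g. (\<forall>i\<in>I. f i = g i) \<longrightarrow> \<chi> f = \<chi> g) \<longrightarrow>
     (\<exists>J c. (\<forall>i\<in>I. J i \<subseteq> {..m} \<and> card (J i) = Suc n) \<and> (\<forall>f. (\<forall>i\<in>I. f i \<in> J i) \<longrightarrow> \<chi> f = c))"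
  using assms
proof (induction I arbitrary: C rule: finite_induct)
  case empty
  show ?case
  proof (intro exI allI impI)
    fix \<chi> :: "('i \<Rightarrow> nat) \<Rightarrow> nat"
    assume "\<forall>f g. (\<forall>i\<in>{}. f i = g i) \<longrightarrow> \<chi> f = \<chi> g"
    then have "\<chi> f = \<chi> (\<lambda>_. 0)" for f by (metis empty_iff)
    then show "(\<forall>i\<in>{}. (\<lambda>_. {}) i \<subseteq> {..0} \<and> card ((\<lambda>_. {}) i) = Suc n) \<and>
       (\<forall>f. (\<forall>i\<in>{}. f i \<in> (\<lambda>_. {}) i) \<longrightarrow> \<chi> f = \<chi> (\<lambda>_. 0))" by simp
  qed
next
  case (insert i I)
  \<comment> \<open>Large enough for the pigeonhole principle to leave \<open>Suc n\<close> columns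
    of row \<open>i\<close>.\<close>
  define p where "p = n * card C"
  define C' where "C' = list_encode ` {xs. set xs \<subseteq> C \<and> length xs = Suc p}"
  have "finite C'" unfolding C'_def using insert.prems by (intro finite_imageI finite_lists_length_eq)
  from insert.IH[OF this] obtain m where m0: "\<forall>\<chi> :: ('i \<Rightarrow> nat) \<Rightarrow> nat. (\<forall>f. \<chi> f \<in> C') \<longrightarrow>
     (\<forall>f g. (\<forall>i\<in>I. f i = g i) \<longrightarrow> \<chi> f = \<chi> g) \<longrightarrow>
     (\<exists>J c. (\<forall>i\<in>I. J i \<subseteq> {..m} \<and> card (J i) = Suc n) \<and> (\<forall>f. (\<forall>i\<in>I. f i \<in> J i) \<longrightarrow> \<chi> f = c))"
    by (elim exE)
  note m = m0[THEN spec, THEN mp, THEN mp]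
  show ?case
  proof (intro exI[of _ "max m p"] allI impI)
    fix \<chi> :: "('i \<Rightarrow> nat) \<Rightarrow> nat"
    assume \<chi>C: "\<forall>f. \<chi> f \<in> C" and dep: "\<forall>f g. (\<forall>i\<in>insert i I. f i = g i) \<longrightarrow> \<chi> f = \<chi> g"
    \<comment> \<open>The new colour of \<open>f\<close> is the list of all old colours along row
      \<open>i\<close>; on a subgrid homogeneous for it, the old colour depends on the column in row
      \<open>i\<close> only.\<close>
    define \<chi>' where "\<chi>' = (\<lambda>f. list_encode (map (\<lambda>j. \<chi> (f(i := j))) [0..<Suc p]))"
    have "\<forall>f. \<chi>' f \<in> C'" unfolding \<chi>'_def C'_def
      by (intro allI imageI CollectI) (use \<chi>C in auto)
    moreover have "\<chi>' f = \<chi>' g" if "\<forall>i\<in>I. f i = g i" for f g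
    proof -
      have "\<chi> (f(i := j)) = \<chi> (g(i := j))" for j
        by (rule dep[rule_format]) (use that in auto)
      then show ?thesis by (simp add: \<chi>'_def)
    qed
    ultimately obtain J c where J: "\<forall>i\<in>I. J i \<subseteq> {..m} \<and> card (J i) = Suc n"
      and c: "\<And>f. (\<forall>i\<in>I. f i \<in> J i) \<Longrightarrow> \<chi>' f = c" using m[of \<chi>'] by blast
    have "\<forall>i\<in>I. \<exists>j. j \<in> J i" using J by (metis card.empty ex_in_conv nat.distinct(1))
    from bchoice[OF this] obtain f0 where f0: "\<forall>i\<in>I. f0 i \<in> J i" by (elim exE)
    define v where "v = (\<lambda>j. \<chi> (f0(i := j)))"
    have v: "\<chi> (f(i := j)) = v j" if "\<forall>i\<in>I. f i \<in> J i" "j \<le> p" for f j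
    proof -
      have "\<chi>' f = \<chi>' f0" using c[OF that(1)] c[OF f0] by simp
      then have "map (\<lambda>j. \<chi> (f(i := j))) [0..<Suc p] = map v [0..<Suc p]"
        unfolding \<chi>'_def v_def by (simp only: list_encode_eq)
      moreover have "j \<in> set [0..<Suc p]" using that(2) by auto
      ultimately show ?thesis unfolding map_eq_conv by blast
    qed
    have "\<exists>c\<in>C. \<exists>J\<subseteq>{..p}. card J = Suc n \<and> (\<forall>j\<in>J. v j = c)"
      by (rule pigeonhole_fibre) (use insert.prems \<chi>C in \<open>auto simp: v_def p_def\<close>)
    then obtain c' J' where J': "J' \<subseteq> {..p}" "card J' = Suc n" "\<forall>j\<in>J'. v j = c'" by blast
    show "\<exists>J c. (\<forall>i\<in>insert i I. J i \<subseteq> {..max m p} \<and> card (J i) = Suc n) \<and>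
        (\<forall>f. (\<forall>i\<in>insert i I. f i \<in> J i) \<longrightarrow> \<chi> f = c)"
    proof (intro exI[of _ "J(i := J')"] exI[of _ c'] conjI ballI allI impI)
      fix i' assume i': "i' \<in> insert i I"
      have "{..m} \<subseteq> {..max m p}" "{..p} \<subseteq> {..max m p}" by auto
      moreover have "J i' \<subseteq> {..m}" if "i' \<noteq> i" using that i' J by blast
      ultimately show "(J(i := J')) i' \<subseteq> {..max m p}"
        using subset_trans[OF J'(1)] subset_trans[of "J i'" "{..m}"] by (cases "i' = i") (simp_all only: fun_upd_apply if_True if_False simp_thms)
      show "card ((J(i := J')) i') = Suc n" using i' J J'(2) by (cases "i' = i") auto
    next
      fix f assume f: "\<forall>i'\<in>insert i I. f i' \<in> (J(i := J')) i'"
      have "f i \<in> J'" using f by simp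
      moreover have "\<forall>i'\<in>I. f i' \<in> J i'" using f insert.hyps(2) by (metis fun_upd_other insertCI)
      ultimately have "\<chi> (f(i := f i)) = c'" using v[of f "f i"] J' by auto
      then show "\<chi> f = c'" by simp
    qed
  qed
qed

lemma approx_cong:
  assumes "\<And>i e b. i \<in> I \<Longrightarrow> Q i e b \<longleftrightarrow> Q' i e b" "\<And>i e b. i \<in> I \<Longrightarrow> R i e b \<longleftrightarrow> R' i e b"
  shows "approx P B Q R k I n \<longleftrightarrow> approx P B Q' R' k I n"
  unfolding approx_def using assms by (simp cong: ball_cong)

text \<open>On a homogeneous subgrid the chosen solutions of all paths have the same tuple of
  colours, one for each row. Passing to a subgrid keeps the row condition, which concerns
  \<open>Q\<close> alone, while the path condition is strengthened; this is the reason for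
  separating \<open>Q\<close> from \<open>R\<close>.\<close>

lemma approx_colour_finite:
  fixes I :: "'i set"
  assumes apx: "\<And>n. approx P B Q R k I n" and I: "finite I"
    and C: "\<And>i. i \<in> I \<Longrightarrow> finite (C i)" "\<And>i e b. i \<in> I \<Longrightarrow> e \<in> P \<Longrightarrow> b \<in> B \<Longrightarrow> col i e b \<in> C i"
  shows "\<exists>c. (\<forall>i\<in>I. c i \<in> C i) \<and> approx P B Q (\<lambda>i e b. R i e b \<and> col i e b = c i) k I n"
proof -
  define D where "D = PiE I C"
  have D: "finite D" unfolding D_def using I C(1) by (intro finite_PiE)
  obtain m where m: "\<And>\<chi> :: ('i \<Rightarrow> nat) \<Rightarrow> nat. (\<forall>f. \<chi> f \<in> to_nat_on D ` D) \<Longrightarrow>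
     (\<forall>f g. (\<forall>i\<in>I. f i = g i) \<longrightarrow> \<chi> f = \<chi> g) \<Longrightarrow>
     (\<exists>J c. (\<forall>i\<in>I. J i \<subseteq> {..m} \<and> card (J i) = Suc n) \<and> (\<forall>f. (\<forall>i\<in>I. f i \<in> J i) \<longrightarrow> \<chi> f = c))"
    using homogeneous_subgrid[OF I, of "to_nat_on D ` D" n] D by auto
  from apx[of m, unfolded approx_def] obtain a where a: "\<forall>i j. a i j \<in> P"
    and rows: "\<forall>i\<in>I. \<forall>J\<subseteq>{..m}. card J = k i \<longrightarrow> \<not> (\<exists>b\<in>B. \<forall>j\<in>J. Q i (a i j) b)"
    and paths: "\<forall>f. (\<forall>i\<in>I. f i \<le> m) \<longrightarrow> (\<exists>b\<in>B. \<forall>i\<in>I. R i (a i (f i)) b)"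
    by (elim exE conjE)
  \<comment> \<open>Truncation to the grid makes the colour defined for all functions and dependent
    only on their values on \<open>I\<close>.\<close>
  define t where "t = (\<lambda>f i. if i \<in> I then min (f i) m else 0)"
  have path: "\<exists>b. b \<in> B \<and> (\<forall>i\<in>I. R i (a i (t f i)) b)" for f
    using paths[rule_format, of "t f"] by (auto simp: t_def)
  define b where "b = (\<lambda>g. SOME b. b \<in> B \<and> (\<forall>i\<in>I. R i (a i (g i)) b))"
  have "b (t f) \<in> B \<and> (\<forall>i\<in>I. R i (a i (t f i)) (b (t f)))" for f
    unfolding b_def by (rule someI_ex[OF path])
  then have b: "b (t f) \<in> B" "\<forall>i\<in>I. R i (a i (t f i)) (b (t f))" for f
    by blast+
  define \<chi>0 where "\<chi>0 = (\<lambda>f. restrict (\<lambda>i. col i (a i (t f i)) (b (t f))) I)"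
  have \<chi>0: "\<chi>0 f \<in> D" for f using C(2) a b(1) by (auto simp: \<chi>0_def D_def)
  have tt: "t f = t g" if "\<forall>i\<in>I. f i = g i" for f g using that by (auto simp: t_def)
  have "\<chi>0 f = \<chi>0 g" if "\<forall>i\<in>I. f i = g i" for f g unfolding \<chi>0_def tt[OF that] ..
  then obtain J c0 where J: "\<And>i. i \<in> I \<Longrightarrow> J i \<subseteq> {..m} \<and> card (J i) = Suc n"
    and c0: "\<And>f. (\<forall>i\<in>I. f i \<in> J i) \<Longrightarrow> to_nat_on D (\<chi>0 f) = c0"
    using m[of "\<lambda>f. to_nat_on D (\<chi>0 f)"] \<chi>0 by (metis image_eqI)
  \<comment> \<open>\<open>J i\<close> has as many elements as \<open>{..n}\<close>;
    \<open>h i\<close> renumbers its columns.\<close>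
  have "\<exists>h. bij_betw h {..n} (J i)" if "i \<in> I" for i
    using J[OF that] by (intro finite_same_card_bij) (auto intro: finite_subset)
  then obtain h where h: "\<And>i. i \<in> I \<Longrightarrow> bij_betw (h i) {..n} (J i)" by metis
  have hJ: "h i j \<in> J i" if "i \<in> I" "j \<le> n" for i j using h[OF that(1)] that(2) by (auto simp: bij_betw_def)
  define c where "c = \<chi>0 (\<lambda>i. h i 0)"
  have \<chi>c: "\<chi>0 f = c" if "\<forall>i\<in>I. f i \<in> J i" for f
  proof -
    have "to_nat_on D (\<chi>0 f) = to_nat_on D c"
      unfolding c_def using c0[OF that] c0[of "\<lambda>i. h i 0"] hJ by auto
    then show ?thesis using \<chi>0 countable_finite[OF D] by (simp add: c_def)
  qed
  have "approx P B Q (\<lambda>i e b. R i e b \<and> col i e b = c i) k I n"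
    unfolding approx_def
  proof (intro exI[of _ "\<lambda>i j. a i (h i j)"] conjI allI ballI impI)
    show "a i (h i j) \<in> P" for i j using a by blast
  next
    fix i J' assume i: "i \<in> I" and J': "J' \<subseteq> {..n}" "card J' = k i"
    have "inj_on (h i) J'" using h[OF i] J'(1) by (auto simp: bij_betw_def intro: inj_on_subset)
    then have "card (h i ` J') = k i" using J'(2) by (simp add: card_image)
    moreover have "h i ` J' \<subseteq> {..m}" using hJ[OF i] J'(1) J[OF i] by blast
    ultimately have "\<not> (\<exists>b\<in>B. \<forall>j\<in>h i ` J'. Q i (a i j) b)" using rows i by blast
    then show "\<not> (\<exists>b\<in>B. \<forall>j\<in>J'. Q i (a i (h i j)) b)" by simp
  next
    fix f assume f: "\<forall>i\<in>I. f i \<le> n"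
    let ?f = "\<lambda>i. h i (f i)"
    have fJ: "\<forall>i\<in>I. ?f i \<in> J i" using f hJ by blast
    have t: "t ?f i = ?f i" if "i \<in> I" for i using J[OF that] fJ that by (auto simp: t_def)
    have "col i (a i (t ?f i)) (b (t ?f)) = c i" if "i \<in> I" for i
      using fun_cong[OF \<chi>c[OF fJ], of i] that by (simp add: \<chi>0_def)
    then have "\<forall>i\<in>I. R i (a i (?f i)) (b (t ?f)) \<and> col i (a i (?f i)) (b (t ?f)) = c i"
      using b(2)[of ?f] t by simp
    then show "\<exists>b\<in>B. \<forall>i\<in>I. R i (a i (h i (f i))) b \<and> col i (a i (h i (f i))) b = c i"
      using b(1)[of ?f] by blast
  qed
  moreover have "\<forall>i\<in>I. c i \<in> C i" using \<chi>0[of "\<lambda>i. h i 0"] by (auto simp: D_def c_def)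
  ultimately show ?thesis by blast
qed

text \<open>The colours found for the finite parts of a pattern are glued along an ultrafilter.\<close>

lemma approx_colour:
  assumes apx: "\<And>I0 n. finite I0 \<Longrightarrow> I0 \<subseteq> I \<Longrightarrow> approx P B Q R k I0 n"
    and C: "\<And>i. i \<in> I \<Longrightarrow> finite (C i)" "\<And>i e b. i \<in> I \<Longrightarrow> e \<in> P \<Longrightarrow> b \<in> B \<Longrightarrow> col i e b \<in> C i"
  shows "\<exists>c. \<forall>I0 n. finite I0 \<longrightarrow> I0 \<subseteq> I \<longrightarrow>
     approx P B Q (\<lambda>i e b. R i e b \<and> col i e b = c i) k I0 n"
proof -
  obtain U where U: "U \<le> grid_filter I" "ultrafilter_on UNIV U"
    using ultrafilter_exists[OF grid_filter_not_bot] by blast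
  have ex: "\<forall>q. \<exists>c. finite (fst q) \<longrightarrow> fst q \<subseteq> I \<longrightarrow> (\<forall>i\<in>fst q. c i \<in> C i) \<and>
     approx P B Q (\<lambda>i e b. R i e b \<and> col i e b = c i) k (fst q) (snd q)"
  proof
    fix q
    show "\<exists>c. finite (fst q) \<longrightarrow> fst q \<subseteq> I \<longrightarrow> (\<forall>i\<in>fst q. c i \<in> C i) \<and>
     approx P B Q (\<lambda>i e b. R i e b \<and> col i e b = c i) k (fst q) (snd q)"
  proof (cases "finite (fst q) \<and> fst q \<subseteq> I")
    case True
    then have "\<exists>c. (\<forall>i\<in>fst q. c i \<in> C i) \<and> approx P B Q (\<lambda>i e b. R i e b \<and> col i e b = c i) k (fst q) (snd q)"
      using C apx by (intro approx_colour_finite) auto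
    then show ?thesis by blast
  qed auto
  qed
  from choice[OF ex] obtain d where d0: "\<forall>q. finite (fst q) \<longrightarrow> fst q \<subseteq> I \<longrightarrow>
     (\<forall>i\<in>fst q. d q i \<in> C i) \<and> approx P B Q (\<lambda>i e b. R i e b \<and> col i e b = d q i) k (fst q) (snd q)"
    by (elim exE)
  note d = d0[THEN spec, THEN mp, THEN mp]
  have "\<exists>c. eventually (\<lambda>q. d q i = c) U" if i: "i \<in> I" for i
  proof -
    have "eventually (\<lambda>q. finite (fst q) \<and> fst q \<subseteq> I \<and> {i} \<subseteq> fst q \<and> 0 \<le> snd q) U"
      using i by (intro eventually_grid_filterI U(1)) auto
    then have "eventually (\<lambda>q. d q i \<in> C i) U"
      by (rule eventually_mono) (use d in auto)
    from ultrafilter_finite_value[OF U(2) C(1)[OF i] this] show ?thesis by blast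
  qed
  then obtain c where c: "\<And>i. i \<in> I \<Longrightarrow> eventually (\<lambda>q. d q i = c i) U" by metis
  have "approx P B Q (\<lambda>i e b. R i e b \<and> col i e b = c i) k I0 n" if I0: "finite I0" "I0 \<subseteq> I" for I0 n
  proof -
    have "eventually (\<lambda>q. \<forall>i\<in>I0. d q i = c i) U"
      using I0 c by (simp add: eventually_ball_finite_distrib subset_iff)
    moreover have "eventually (\<lambda>q. finite (fst q) \<and> fst q \<subseteq> I \<and> I0 \<subseteq> fst q \<and> n \<le> snd q) U"
      by (rule eventually_grid_filterI[OF I0 U(1)])
    ultimately have "eventually (\<lambda>q. (\<forall>i\<in>I0. d q i = c i) \<and>
        finite (fst q) \<and> fst q \<subseteq> I \<and> I0 \<subseteq> fst q \<and> n \<le> snd q) U"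
      by (rule eventually_conj)
    from eventually_happens'[OF _ this] obtain q where q: "\<forall>i\<in>I0. d q i = c i" "finite (fst q)" "fst q \<subseteq> I" "I0 \<subseteq> fst q" "n \<le> snd q"
      using U(2) eventually_happens' unfolding ultrafilter_on_def by blast
    have "approx P B Q (\<lambda>i e b. R i e b \<and> col i e b = d q i) k I0 n"
      using d[OF q(2,3)] q(4,5) by (blast intro: approx_mono)
    moreover have "approx P B Q (\<lambda>i e b. R i e b \<and> col i e b = d q i) k I0 n \<longleftrightarrow>
        approx P B Q (\<lambda>i e b. R i e b \<and> col i e b = c i) k I0 n"
      by (rule approx_cong) (use q(1) in auto)
    ultimately show ?thesis by blast
  qed
  then show ?thesis by blast
qed

section \<open>Colours\<close>

context lex_sum
begin

text \<open>
  The components are the sets of true atoms, the variables with value \<open>u\<close>, the variables in the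
  fibre of \<open>b\<close>, and the information whether \<open>b\<close> is \<open>u\<close>.
\<close>

definition colour where
  "colour x \<Theta> \<Psi> V e b = ({\<theta> \<in> \<Theta>. matom (e(x := b)) \<theta>}, {\<psi> \<in> \<Psi>. natom (e(x := b)) \<psi>},
     {z \<in> V. e (dec z) = Undetermined}, {z \<in> V. \<exists>a d d'. e (dec z) = Pt a d \<and> b = Pt a d'}, b = Undetermined)"

lemma colour_eqD:
  assumes "colour x \<Theta> \<Psi> V e b = (TM, TN, D, W, u)"
  shows "\<And>\<theta>. \<theta> \<in> \<Theta> \<Longrightarrow> matom (e(x := b)) \<theta> \<longleftrightarrow> \<theta> \<in> TM"
    "\<And>\<psi>. \<psi> \<in> \<Psi> \<Longrightarrow> natom (e(x := b)) \<psi> \<longleftrightarrow> \<psi> \<in> TN"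
    "\<And>z. z \<in> V \<Longrightarrow> e (dec z) = Undetermined \<longleftrightarrow> z \<in> D"
    "\<And>z. z \<in> V \<Longrightarrow> (\<exists>a d d'. e (dec z) = Pt a d \<and> b = Pt a d') \<longleftrightarrow> z \<in> W"
    "b = Undetermined \<longleftrightarrow> u" "TM \<subseteq> \<Theta>" "TN \<subseteq> \<Psi>" "D \<subseteq> V" "W \<subseteq> V"
  using assms by (auto simp: colour_def)

lemma colour_eqI:
  assumes c: "colour x \<Theta> \<Psi> V e b0 = (TM, TN, D, W, u)"
    and "\<And>\<theta>. \<theta> \<in> \<Theta> \<Longrightarrow> matom (e(x := b)) \<theta> \<longleftrightarrow> \<theta> \<in> TM"
    and "\<And>\<psi>. \<psi> \<in> \<Psi> \<Longrightarrow> natom (e(x := b)) \<psi> \<longleftrightarrow> \<psi> \<in> TN"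
    and "\<And>z. z \<in> V \<Longrightarrow> (\<exists>a d d'. e (dec z) = Pt a d \<and> b = Pt a d') \<longleftrightarrow> z \<in> W"
    and "b = Undetermined \<longleftrightarrow> u"
  shows "colour x \<Theta> \<Psi> V e b = (TM, TN, D, W, u)"
proof -
  note d = colour_eqD[OF c]
  have 1: "{\<theta> \<in> \<Theta>. matom (e(x := b)) \<theta>} = TM" using assms(2) d(6) by blast
  have 2: "{\<psi> \<in> \<Psi>. natom (e(x := b)) \<psi>} = TN" using assms(3) d(7) by blast
  have 3: "{z \<in> V. e (dec z) = Undetermined} = D" using d(3,8) by blast
  have 4: "{z \<in> V. \<exists>a d d'. e (dec z) = Pt a d \<and> b = Pt a d'} = W"
  proof (rule set_eqI)
    fix z
    show "z \<in> {z \<in> V. \<exists>a d d'. e (dec z) = Pt a d \<and> b = Pt a d'} \<longleftrightarrow> z \<in> W"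
    proof (cases "z \<in> V")
      case True
      then show ?thesis using assms(4)[OF True] by (simp only: mem_Collect_eq simp_thms)
    qed (use d(9) in blast)
  qed
  show ?thesis unfolding colour_def 1 2 3 4 assms(5) ..
qed

definition colour_set where
  "colour_set \<Theta> \<Psi> V = Pow \<Theta> \<times> Pow \<Psi> \<times> Pow V \<times> Pow V \<times> (UNIV :: bool set)"

lemma finite_colour_set: "finite \<Theta> \<Longrightarrow> finite \<Psi> \<Longrightarrow> finite V \<Longrightarrow> finite (colour_set \<Theta> \<Psi> V)"
  by (simp add: colour_set_def)

lemma colour_in_set: "colour x \<Theta> \<Psi> V e b \<in> colour_set \<Theta> \<Psi> V"
  by (auto simp: colour_def colour_set_def)

lemma colour_determines:
  assumes d: "determined \<phi> \<Theta> \<Psi>" and e: "e \<in> assignments S" "e' \<in> assignments S"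
    and b: "b \<in> univ S (fst x)" "b' \<in> univ S (fst x)"
    and eq: "colour x \<Theta> \<Psi> V e b = colour x \<Theta> \<Psi> V e' b'"
  shows "sat S (e(x := b)) \<phi> \<longleftrightarrow> sat S (e'(x := b')) \<phi>"
proof -
  obtain TM TN D W u where c: "colour x \<Theta> \<Psi> V e b = (TM, TN, D, W, u)" by (metis prod_cases5)
  note 1 = colour_eqD[OF c] and 2 = colour_eqD[OF eq[symmetric, unfolded c]]
  have "\<forall>\<theta>\<in>\<Theta>. matom (e(x := b)) \<theta> \<longleftrightarrow> matom (e'(x := b')) \<theta>" using 1(1) 2(1) by blast
  moreover have "\<forall>\<psi>\<in>\<Psi>. natom (e(x := b)) \<psi> \<longleftrightarrow> natom (e'(x := b')) \<psi>" using 1(2) 2(2) by blast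
  ultimately show ?thesis
    using d assignments_upd[OF e(1) b(1)] assignments_upd[OF e(2) b(2)] unfolding determined_def by blast
qed

text \<open>
  If no variable lies in the fibre of \<open>b\<close>, the colour of \<open>b\<close> only depends on its projection and on the
  type of \<open>b\<close> in its fibre without parameters: \<open>colour_fm_M\<close> expresses that a projection comes from
  some \<open>b\<close> of the given colour.  Once the fibre is fixed, the colour is expressed in it by
  \<open>colour_fm_N\<close>.
\<close>

definition colour_sent where
  "colour_sent zx \<Psi> TN = Ex zx (signed {\<psi> \<in> TN. fv \<psi> = {zx}} {\<psi> \<in> \<Psi> - TN. fv \<psi> = {zx}})"

definition colour_fm_M where
  "colour_fm_M x \<Theta> \<Psi> V TM TN D = Conj (signed {\<theta> \<in> TM. fv \<theta> \<inter> D = {}} {\<theta> \<in> \<Theta> - TM. fv \<theta> \<inter> D = {}})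
     (if fst x = Base_Sort then Verum
      else Conj (signed {} ((\<lambda>z. Eq (Var (enc x)) (Var z)) ` {z \<in> V. fst (dec z) \<noteq> Base_Sort \<and> z \<notin> D}))
        (fibre_fm (enc x) (colour_sent (enc x) \<Psi> TN)))"

definition colour_fm_N where
  "colour_fm_N zx \<Psi> TN W = signed {\<psi> \<in> TN. zx \<in> fv \<psi> \<and> fv \<psi> \<subseteq> insert zx W}
     {\<psi> \<in> \<Psi> - TN. zx \<in> fv \<psi> \<and> fv \<psi> \<subseteq> insert zx W}"

context
  fixes x :: "lex_sort var" and \<Theta> \<Psi> V
  assumes \<Theta>: "finite \<Theta>" "\<Theta> \<subseteq> fms LM" and \<Psi>: "finite \<Psi>" "\<Psi> \<subseteq> fms LN"
    and V: "finite V" "enc x \<notin> V" "\<And>\<theta>. \<theta> \<in> \<Theta> \<Longrightarrow> fv \<theta> \<subseteq> insert (enc x) V"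
      "\<And>\<psi>. \<psi> \<in> \<Psi> \<Longrightarrow> fv \<psi> \<subseteq> insert (enc x) V"
begin

lemma colour_sent_sentences:
  assumes "TN \<subseteq> \<Psi>"
  shows "colour_sent (enc x) \<Psi> TN \<in> sentences LN"
  by (rule fibre_sents_sentences[OF \<Psi>]) (use assms in \<open>auto simp: colour_sent_def intro!: fibre_sentsI\<close>)

lemma colour_fm_M_fms:
  assumes "TM \<subseteq> \<Theta>" "TN \<subseteq> \<Psi>"
  shows "colour_fm_M x \<Theta> \<Psi> V TM TN D \<in> fms LM"
proof -
  have "signed {\<theta> \<in> TM. fv \<theta> \<inter> D = {}} {\<theta> \<in> \<Theta> - TM. fv \<theta> \<inter> D = {}} \<in> fms LM"
    using assms(1) \<Theta> finite_subset[OF assms(1) \<Theta>(1)] by (intro signed_fms) auto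
  moreover have "signed {} ((\<lambda>z. Eq (Var (enc x)) (Var z)) ` {z \<in> V. fst (dec z) \<noteq> Base_Sort \<and> z \<notin> D}) \<in> fms LM"
  proof (rule signed_fms)
    have "Eq (Var (enc x)) (Var z) \<in> fms LM" for z using has_sort_unit_Var[of LM] by (auto simp: fms_def)
    then show "(\<lambda>z. Eq (Var (enc x)) (Var z)) ` {z \<in> V. fst (dec z) \<noteq> Base_Sort \<and> z \<notin> D} \<subseteq> fms LM" by blast
  qed (use V(1) in auto)
  moreover have "fibre_fm (enc x) (colour_sent (enc x) \<Psi> TN) \<in> fms LM"
    by (rule fibre_fm(1)[OF colour_sent_sentences[OF assms(2)]])
  ultimately show ?thesis by (simp add: colour_fm_M_def fms_def)
qed

lemma colour_fm_N_fms:
  assumes "TN \<subseteq> \<Psi>"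
  shows "colour_fm_N (enc x) \<Psi> TN W \<in> fms LN"
  unfolding colour_fm_N_def using assms \<Psi> finite_subset[OF assms \<Psi>(1)] by (intro signed_fms) auto

lemma sat_colour_sent:
  assumes a: "a \<in> dom1 M" and TN: "TN \<subseteq> \<Psi>"
  shows "N a \<Turnstile> colour_sent (enc x) \<Psi> TN \<longleftrightarrow>
    (\<exists>c\<in>dom1 (N a). \<forall>\<psi>\<in>\<Psi>. fv \<psi> = {enc x} \<longrightarrow> (sat (N a) (g(enc x := c)) \<psi> \<longleftrightarrow> \<psi> \<in> TN))"
proof -
  have s: "sat (N a) h (signed {\<psi> \<in> TN. fv \<psi> = {enc x}} {\<psi> \<in> \<Psi> - TN. fv \<psi> = {enc x}}) \<longleftrightarrow>
      (\<forall>\<psi>\<in>\<Psi>. fv \<psi> = {enc x} \<longrightarrow> (sat (N a) h \<psi> \<longleftrightarrow> \<psi> \<in> TN))" for h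
  proof -
    have fin: "finite {\<psi> \<in> TN. fv \<psi> = {enc x}}" "finite {\<psi> \<in> \<Psi> - TN. fv \<psi> = {enc x}}"
      using \<Psi>(1) finite_subset[OF TN] by auto
    show ?thesis unfolding sat_signed[OF fin N_nonempty[OF a]] using TN by blast
  qed
  have "fv (colour_sent (enc x) \<Psi> TN) = {}" using colour_sent_sentences[OF TN] by (simp add: sentences_def)
  then have "N a \<Turnstile> colour_sent (enc x) \<Psi> TN \<longleftrightarrow> sat (N a) g (colour_sent (enc x) \<Psi> TN)"
    by (rule models_iff_sat[OF _ N_nonempty[OF a]])
  also have "\<dots> \<longleftrightarrow> (\<exists>c\<in>dom1 (N a). \<forall>\<psi>\<in>\<Psi>. fv \<psi> = {enc x} \<longrightarrow> (sat (N a) (g(enc x := c)) \<psi> \<longleftrightarrow> \<psi> \<in> TN))"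
    unfolding colour_sent_def sat.simps s by simp
  finally show ?thesis .
qed

lemma sat_colour_fm_M:
  assumes h: "h (enc x) \<in> dom1 M" and TM: "TM \<subseteq> \<Theta>" and TN: "TN \<subseteq> \<Psi>"
  shows "sat M h (colour_fm_M x \<Theta> \<Psi> V TM TN D) \<longleftrightarrow>
    (\<forall>\<theta>\<in>\<Theta>. fv \<theta> \<inter> D = {} \<longrightarrow> (sat M h \<theta> \<longleftrightarrow> \<theta> \<in> TM)) \<and>
    (fst x \<noteq> Base_Sort \<longrightarrow> (\<forall>z\<in>V. fst (dec z) \<noteq> Base_Sort \<longrightarrow> z \<notin> D \<longrightarrow> h z \<noteq> h (enc x)) \<and>
       N (h (enc x)) \<Turnstile> colour_sent (enc x) \<Psi> TN)"
proof -
  have fin: "finite {\<theta> \<in> TM. fv \<theta> \<inter> D = {}}" "finite {\<theta> \<in> \<Theta> - TM. fv \<theta> \<inter> D = {}}"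
    using \<Theta>(1) finite_subset[OF TM] by auto
  have 1: "sat M h (signed {\<theta> \<in> TM. fv \<theta> \<inter> D = {}} {\<theta> \<in> \<Theta> - TM. fv \<theta> \<inter> D = {}}) \<longleftrightarrow>
     (\<forall>\<theta>\<in>\<Theta>. fv \<theta> \<inter> D = {} \<longrightarrow> (sat M h \<theta> \<longleftrightarrow> \<theta> \<in> TM))"
    unfolding sat_signed[OF fin M_nonempty] using TM by blast
  let ?E = "(\<lambda>z. Eq (Var (enc x)) (Var z)) ` {z \<in> V. fst (dec z) \<noteq> Base_Sort \<and> z \<notin> D}"
  have E: "finite ?E" using V(1) by simp
  have 2: "sat M h (signed {} ?E) \<longleftrightarrow> (\<forall>z\<in>V. fst (dec z) \<noteq> Base_Sort \<longrightarrow> z \<notin> D \<longrightarrow> h z \<noteq> h (enc x))"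
    unfolding sat_signed[OF finite.emptyI E M_nonempty] by auto
  show ?thesis unfolding colour_fm_M_def sat.simps 1
    using 2 fibre_fm(3)[OF colour_sent_sentences[OF TN], of h "enc x"] h M_nonempty by simp
qed

lemma colour_fm_M_path:
  assumes e: "e \<in> assignments S" and b: "b \<in> univ S (fst x)"
    and c: "colour x \<Theta> \<Psi> V e b = (TM, TN, D, {}, False)"
  shows "sat M ((mval e)(enc x := bp b)) (colour_fm_M x \<Theta> \<Psi> V TM TN D)"
proof -
  note d = colour_eqD[OF c]
  have h: "((mval e)(enc x := bp b)) (enc x) \<in> dom1 M" using bp_in[OF b] by simp
  have "sat M ((mval e)(enc x := bp b)) \<theta> \<longleftrightarrow> \<theta> \<in> TM" if "\<theta> \<in> \<Theta>" "fv \<theta> \<inter> D = {}" for \<theta>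
  proof -
    have "\<forall>z\<in>fv \<theta> - {enc x}. e (dec z) \<noteq> Undetermined" using that V(3)[OF that(1)] d(3) by blast
    then show ?thesis using d(1)[OF that(1)] d(5) unfolding matom_upd by blast
  qed
  moreover have "((mval e)(enc x := bp b)) z \<noteq> ((mval e)(enc x := bp b)) (enc x)"
    if x: "fst x \<noteq> Base_Sort" and z: "z \<in> V" "fst (dec z) \<noteq> Base_Sort" "z \<notin> D" for z
  proof -
    obtain a c where ac: "b = Pt a c" using b x d(5) by (cases rule: univ_S_cases) auto
    have nu: "e (dec z) \<noteq> Undetermined" using d(3)[OF z(1)] z(3) by blast
    obtain a1 c1 where ac1: "e (dec z) = Pt a1 c1"
      using assignmentsD[OF e, of "dec z"] by (rule univ_S_cases) (use nu z(2) in auto)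
    have "a1 \<noteq> a" using d(4)[OF z(1)] ac ac1 by blast
    moreover have "z \<noteq> enc x" using z(1) V(2) by blast
    ultimately show ?thesis using ac ac1 by (simp add: mval_def)
  qed
  moreover have "N (bp b) \<Turnstile> colour_sent (enc x) \<Psi> TN" if x: "fst x \<noteq> Base_Sort"
  proof -
    obtain a c where ac: "b = Pt a c" "a \<in> dom1 M" "c \<in> dom1 (N a)"
      using b x d(5) by (cases rule: univ_S_cases) auto
    have "sat (N a) ((pval e)(enc x := c)) \<psi> \<longleftrightarrow> \<psi> \<in> TN" if "\<psi> \<in> \<Psi>" "fv \<psi> = {enc x}" for \<psi>
      using d(2)[OF that(1)] natom_upd_Pt[of x \<psi> e a c] that(2) ac(1) by simp
    then show ?thesis using ac(3) unfolding ac(1) bp.simps sat_colour_sent[OF ac(2) d(7), of "pval e"] by blast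
  qed
  ultimately show ?thesis unfolding sat_colour_fm_M[where h = "(mval e)(enc x := bp b)", OF h d(6,7)] by simp
qed

text \<open>\<open>b0\<close> shows that the colour occurs at \<open>e\<close> at all. Atoms without
  the variable of \<open>x\<close> do not distinguish \<open>b\<close> from \<open>b0\<close>;
  matoms with a variable in \<open>D\<close> fail for both, and so do natoms that involve the
  variable of \<open>x\<close> and another one, because no variable lies in the fibre of
  \<open>b\<close> or \<open>b0\<close>.\<close>

lemma colour_fm_M_colour:
  assumes e: "e \<in> assignments S" and b: "b \<in> univ S (fst x)" "b \<noteq> Undetermined"
    and b0u: "b0 \<in> univ S (fst x)"
    and c: "colour x \<Theta> \<Psi> V e b0 = (TM, TN, D, {}, False)"
    and sat: "sat M ((mval e)(enc x := bp b)) (colour_fm_M x \<Theta> \<Psi> V TM TN D)"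
    and bN: "\<And>a c \<psi>. b = Pt a c \<Longrightarrow> \<psi> \<in> \<Psi> \<Longrightarrow> fv \<psi> = {enc x} \<Longrightarrow>
      sat (N a) ((pval e)(enc x := c)) \<psi> \<longleftrightarrow> \<psi> \<in> TN"
  shows "colour x \<Theta> \<Psi> V e b = (TM, TN, D, {}, False)"
proof (rule colour_eqI[OF c])
  note d = colour_eqD[OF c]
  have h: "((mval e)(enc x := bp b)) (enc x) \<in> dom1 M" using bp_in[OF b(1)] by simp
  note s = sat[unfolded sat_colour_fm_M[where h = "(mval e)(enc x := bp b)", OF h d(6,7)]]
  have b0: "b0 \<noteq> Undetermined" using d(5) by blast
  show "matom (e(x := b)) \<theta> \<longleftrightarrow> \<theta> \<in> TM" if \<theta>: "\<theta> \<in> \<Theta>" for \<theta>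
  proof (cases "fv \<theta> \<inter> D = {}")
    case True
    then have "\<forall>z\<in>fv \<theta> - {enc x}. e (dec z) \<noteq> Undetermined" using V(3)[OF \<theta>] d(3) by blast
    then show ?thesis unfolding matom_upd using s \<theta> True b(2) by blast
  next
    case False
    then obtain z where z: "z \<in> fv \<theta>" "z \<in> D" by blast
    then have "z \<in> fv \<theta> - {enc x}" "e (dec z) = Undetermined" using d(8) V(2) d(3) by blast+
    then have "\<not> matom (e(x := b)) \<theta>" "\<not> matom (e(x := b0)) \<theta>" unfolding matom_upd by blast+
    then show ?thesis using d(1)[OF \<theta>] by blast
  qed
  have far: "\<not> (\<exists>a d d'. e (dec z) = Pt a d \<and> b = Pt a d')" if z: "z \<in> V" for z
  proof
    assume "\<exists>a d d'. e (dec z) = Pt a d \<and> b = Pt a d'"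
    then obtain a d1 d' where ad: "e (dec z) = Pt a d1" "b = Pt a d'" by blast
    have x: "fst x \<noteq> Base_Sort" using b(1) ad(2) by (auto simp: univ_S)
    have "z \<notin> D" using d(3)[OF z] ad(1) by simp
    moreover have "fst (dec z) \<noteq> Base_Sort" using assignmentsD[OF e, of "dec z"] ad(1) by (auto simp: univ_S)
    ultimately have "((mval e)(enc x := bp b)) z \<noteq> ((mval e)(enc x := bp b)) (enc x)"
      using s x z by blast
    moreover have "z \<noteq> enc x" using z V(2) by blast
    ultimately show False using ad by (simp add: mval_def)
  qed
  show "(\<exists>a d d'. e (dec z) = Pt a d \<and> b = Pt a d') \<longleftrightarrow> z \<in> {}" if "z \<in> V" for z
    using far[OF that] by blast
  show "natom (e(x := b)) \<psi> \<longleftrightarrow> \<psi> \<in> TN" if \<psi>: "\<psi> \<in> \<Psi>" for \<psi>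
  proof (cases "enc x \<in> fv \<psi>")
    case False
    then show ?thesis using d(2)[OF \<psi>] by (simp add: natom_upd_notin)
  next
    case zx: True
    show ?thesis
    proof (cases "\<exists>a c. b = Pt a c")
      case True
      then obtain a c where ac: "b = Pt a c" by blast
      show ?thesis
      proof (cases "fv \<psi> = {enc x}")
        case True
        then show ?thesis using natom_upd_Pt[OF zx, of e a c] bN[OF ac \<psi> True] ac by simp
      next
        case False
        then obtain z where z: "z \<in> fv \<psi> - {enc x}" using zx by blast
        then have zV: "z \<in> V" using V(4)[OF \<psi>] by blast
        have "\<not> natom (e(x := b)) \<psi>" unfolding ac natom_upd_Pt[OF zx] using z far[OF zV] ac by blast
        moreover have "\<not> natom (e(x := b0)) \<psi>"
        proof (cases "\<exists>a0 c0. b0 = Pt a0 c0")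
          case True
          then obtain a0 c0 where ac0: "b0 = Pt a0 c0" by blast
          show ?thesis unfolding ac0 natom_upd_Pt[OF zx] using z d(4)[OF zV] ac0 by blast
        next
          case False
          then show ?thesis using natom_upd_nonPt[OF zx] by blast
        qed
        ultimately show ?thesis using d(2)[OF \<psi>] by blast
      qed
    next
      case False
      then have n: "\<not> natom (e(x := b)) \<psi>" using natom_upd_nonPt[OF zx] by blast
      have "\<psi> \<notin> TN"
      proof
        assume "\<psi> \<in> TN"
        then have "natom (e(x := b0)) \<psi>" using d(2)[OF \<psi>] by blast
        moreover have "fst x = Base_Sort" using b False by (cases rule: univ_S_cases) auto
        then have "b0 \<noteq> Pt a c" for a c using b0u by (auto simp: univ_S)
        ultimately show False using natom_upd_nonPt[OF zx, of b0 e] by blast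
      qed
      then show ?thesis using n by blast
    qed
  qed
  show "b = Undetermined \<longleftrightarrow> False" using b(2) by blast
qed

text \<open>\<open>colour_sent\<close> has no parameters, so an element \<open>c\<close> of the
  fibre over \<open>a\<close> found for one column serves all columns: \<open>Pt a c\<close> is a
  common solution. If \<open>x\<close> has the base sort, \<open>Base a\<close> is one.\<close>

lemma colour_fm_M_row:
  assumes J: "J \<noteq> {}" and e: "\<And>j. j \<in> J \<Longrightarrow> e j \<in> assignments S"
    and b0: "\<And>j. j \<in> J \<Longrightarrow> b0 j \<in> univ S (fst x)"
      "\<And>j. j \<in> J \<Longrightarrow> colour x \<Theta> \<Psi> V (e j) (b0 j) = (TM, TN, D, {}, False)"
    and a: "a \<in> dom1 M"
    and sat: "\<And>j. j \<in> J \<Longrightarrow> sat M ((mval (e j))(enc x := a)) (colour_fm_M x \<Theta> \<Psi> V TM TN D)"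
  shows "\<exists>b\<in>univ S (fst x). \<forall>j\<in>J. colour x \<Theta> \<Psi> V (e j) b = (TM, TN, D, {}, False)"
proof -
  obtain j0 where j0: "j0 \<in> J" using J by blast
  note d = colour_eqD[OF b0(2)[OF j0]]
  show ?thesis
  proof (cases "fst x = Base_Sort")
    case True
    then have b: "Base a \<in> univ S (fst x)" using a by (simp add: univ_S)
    have "colour x \<Theta> \<Psi> V (e j) (Base a) = (TM, TN, D, {}, False)" if "j \<in> J" for j
      by (rule colour_fm_M_colour[OF e[OF that] b _ b0[OF that]]) (use sat[OF that] in auto)
    then show ?thesis using b by blast
  next
    case False
    have h: "((mval (e j0))(enc x := a)) (enc x) \<in> dom1 M" using a by simp
    have "N a \<Turnstile> colour_sent (enc x) \<Psi> TN"
      using sat[OF j0] False unfolding sat_colour_fm_M[where h = "(mval (e j0))(enc x := a)", OF h d(6,7)] by simp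
    then obtain c where c: "c \<in> dom1 (N a)" and
      cs: "\<forall>\<psi>\<in>\<Psi>. fv \<psi> = {enc x} \<longrightarrow> (sat (N a) ((pval (e j0))(enc x := c)) \<psi> \<longleftrightarrow> \<psi> \<in> TN)"
      unfolding sat_colour_sent[OF a d(7), of "pval (e j0)"] by blast
    have b: "Pt a c \<in> univ S (fst x)" using a c False by (simp add: univ_S_Pt)
    have "colour x \<Theta> \<Psi> V (e j) (Pt a c) = (TM, TN, D, {}, False)" if j: "j \<in> J" for j
    proof (rule colour_fm_M_colour[OF e[OF j] b _ b0[OF j]])
      show "sat M ((mval (e j))(enc x := bp (Pt a c))) (colour_fm_M x \<Theta> \<Psi> V TM TN D)" using sat[OF j] by simp
      fix a' c' \<psi> assume "Pt a c = Pt a' c'" "\<psi> \<in> \<Psi>" and fv: "fv \<psi> = {enc x}"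
      moreover have "sat (N a) ((pval (e j))(enc x := c)) \<psi> \<longleftrightarrow> sat (N a) ((pval (e j0))(enc x := c)) \<psi>"
        by (rule sat_cong) (use fv in auto)
      ultimately show "sat (N a') ((pval (e j))(enc x := c')) \<psi> \<longleftrightarrow> \<psi> \<in> TN" using cs by simp
    qed simp
    then show ?thesis using b by blast
  qed
qed

lemma fv_colour_fm_N: "TN \<subseteq> \<Psi> \<Longrightarrow> fv (colour_fm_N (enc x) \<Psi> TN W) \<subseteq> insert (enc x) W"
  using \<Psi>(1) finite_subset[of TN \<Psi>] by (simp add: colour_fm_N_def fv_signed) blast

lemma sat_colour_fm_N:
  assumes "TN \<subseteq> \<Psi>" "\<alpha> \<in> dom1 M"
  shows "sat (N \<alpha>) h (colour_fm_N (enc x) \<Psi> TN W) \<longleftrightarrow>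
    (\<forall>\<psi>\<in>\<Psi>. enc x \<in> fv \<psi> \<longrightarrow> fv \<psi> \<subseteq> insert (enc x) W \<longrightarrow> (sat (N \<alpha>) h \<psi> \<longleftrightarrow> \<psi> \<in> TN))"
proof -
  have fin: "finite {\<psi> \<in> TN. enc x \<in> fv \<psi> \<and> fv \<psi> \<subseteq> insert (enc x) W}"
    "finite {\<psi> \<in> \<Psi> - TN. enc x \<in> fv \<psi> \<and> fv \<psi> \<subseteq> insert (enc x) W}"
    using \<Psi>(1) finite_subset[OF assms(1)] by auto
  show ?thesis unfolding colour_fm_N_def sat_signed[OF fin N_nonempty[OF assms(2)]] using assms(1) by blast
qed

lemma colour_fibre:
  assumes c: "colour x \<Theta> \<Psi> V e (Pt \<alpha> d) = (TM, TN, D, W, u)" and z: "z \<in> V"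
  shows "(\<exists>d. e (dec z) = Pt \<alpha> d) \<longleftrightarrow> z \<in> W"
  using colour_eqD(4)[OF c z] by simp

lemma colour_fm_N_path:
  assumes c: "colour x \<Theta> \<Psi> V e (Pt \<alpha> d) = (TM, TN, D, W, u)" and \<alpha>: "\<alpha> \<in> dom1 M"
  shows "sat (N \<alpha>) ((pval e)(enc x := d)) (colour_fm_N (enc x) \<Psi> TN W)"
  unfolding sat_colour_fm_N[OF colour_eqD(7)[OF c] \<alpha>]
proof (intro ballI impI)
  fix \<psi> assume \<psi>: "\<psi> \<in> \<Psi>" "enc x \<in> fv \<psi>" "fv \<psi> \<subseteq> insert (enc x) W"
  have "\<forall>z\<in>fv \<psi> - {enc x}. \<exists>d. e (dec z) = Pt \<alpha> d"
    using \<psi>(3) colour_fibre[OF c] colour_eqD(9)[OF c] by blast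
  then show "sat (N \<alpha>) ((pval e)(enc x := d)) \<psi> \<longleftrightarrow> \<psi> \<in> TN"
    using colour_eqD(2)[OF c \<psi>(1)] unfolding natom_upd_Pt[OF \<psi>(2)] by blast
qed

text \<open>The two points have the same projection, so only natoms containing the variable of
  \<open>x\<close> can change. Those with another variable outside \<open>W\<close> fail for both
  points; the rest is fixed by \<open>colour_fm_N\<close>.\<close>

lemma colour_fm_N_row:
  assumes c: "colour x \<Theta> \<Psi> V e (Pt \<alpha> d0) = (TM, TN, D, W, u)" and \<alpha>: "\<alpha> \<in> dom1 M"
    and sat: "sat (N \<alpha>) ((pval e)(enc x := d)) (colour_fm_N (enc x) \<Psi> TN W)"
  shows "colour x \<Theta> \<Psi> V e (Pt \<alpha> d) = (TM, TN, D, W, u)"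
proof (rule colour_eqI[OF c])
  note cD = colour_eqD[OF c]
  note s = sat[unfolded sat_colour_fm_N[OF cD(7) \<alpha>]]
  show "matom (e(x := Pt \<alpha> d)) \<theta> \<longleftrightarrow> \<theta> \<in> TM" if "\<theta> \<in> \<Theta>" for \<theta>
    using cD(1)[OF that] unfolding matom_upd by simp
  show "(\<exists>a d1 d'. e (dec z) = Pt a d1 \<and> Pt \<alpha> d = Pt a d') \<longleftrightarrow> z \<in> W" if "z \<in> V" for z
    using colour_fibre[OF c that] by simp
  show "Pt \<alpha> d = Undetermined \<longleftrightarrow> u" using cD(5) by simp
  show "natom (e(x := Pt \<alpha> d)) \<psi> \<longleftrightarrow> \<psi> \<in> TN" if \<psi>: "\<psi> \<in> \<Psi>" for \<psi>
  proof (cases "enc x \<in> fv \<psi>")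
    case False
    then show ?thesis using cD(2)[OF \<psi>] by (simp add: natom_upd_notin)
  next
    case zx: True
    show ?thesis
    proof (cases "fv \<psi> \<subseteq> insert (enc x) W")
      case True
      have "\<forall>z\<in>fv \<psi> - {enc x}. \<exists>d. e (dec z) = Pt \<alpha> d"
        using True colour_fibre[OF c] cD(9) by blast
      then show ?thesis unfolding natom_upd_Pt[OF zx] using s \<psi> zx True by blast
    next
      case False
      then obtain z where z: "z \<in> fv \<psi> - {enc x}" "z \<notin> W" by blast
      then have "z \<in> V" using V(4)[OF \<psi>] by blast
      then have "\<not> (\<exists>d. e (dec z) = Pt \<alpha> d)" using colour_fibre[OF c] z(2) by blast
      then have "\<not> natom (e(x := Pt \<alpha> d)) \<psi>" "\<not> natom (e(x := Pt \<alpha> d0)) \<psi>"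
        unfolding natom_upd_Pt[OF zx] using z(1) by blast+
      then show ?thesis using cD(2)[OF \<psi>] by blast
    qed
  qed
qed

end

end

section \<open>The upper bound\<close>

text \<open>Pairwise distinct parameters in the formula \<open>x = y\<close> form a 2-inconsistent
  row.\<close>

lemma infinite_approximable:
  assumes "infinite (dom1 M)"
  shows "approximable L M {i}"
proof -
  let ?\<phi> = "\<lambda>_. Eq (Var ((), 0)) (Var ((), 1))"
  obtain g :: "nat \<Rightarrow> _" where g: "inj g" "range g \<subseteq> dom1 M"
    using infinite_countable_subset[OF assms] by blast
  have "fapprox M ((), 0) ?\<phi> (\<lambda>_. 2) I0 n" if I0: "I0 \<subseteq> {i}" for I0 n
    unfolding approx_def
  proof (intro exI[of _ "\<lambda>_ j _. g j"] conjI allI ballI impI)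
    show "(\<lambda>_. g j) \<in> assignments M" for j using g(2) by (auto simp: assignments_unit)
  next
    fix i' and J :: "nat set" assume "card J = (2 :: nat)"
    then obtain j j' where j: "J = {j, j'}" "j \<noteq> j'" by (auto simp: card_2_iff)
    show "\<not> (\<exists>b\<in>univ M (fst ((), 0)). \<forall>j\<in>J. sat M ((\<lambda>_. g j)(((), 0) := b)) (?\<phi> i'))"
      using j g(1) by (auto dest: injD)
  next
    fix f
    show "\<exists>b\<in>univ M (fst ((), 0)). \<forall>i\<in>I0. sat M ((\<lambda>_. g (f i))(((), 0) := b)) (?\<phi> i)"
      using g(2) I0 by (intro bexI[of _ "g (f i)"]) auto
  qed
  moreover have "?\<phi> i' \<in> fms L" for i' by (auto simp: fms_def has_sort_unit_Var)
  ultimately show ?thesis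
    unfolding approximable_def by (intro exI[of _ "((), 0)"] exI[of _ ?\<phi>] exI[of _ "\<lambda>_. 2"] conjI ballI allI impI)
qed

context lex_sum
begin

text \<open>Phrased through formulas in \<open>\<rho>\<close> and not through an ultraproduct,
  because the ultrafilter attached to \<open>\<rho>\<close> is fixed only later: whichever it is, it
  contains the solution set of \<open>\<delta>\<close>, so the approximations hold in the
  ultraproduct.\<close>

definition fibre_type where
  "fibre_type I \<rho> \<longleftrightarrow> \<rho> \<in> S1 LM M \<and> (\<exists>z \<psi> k. (\<forall>i\<in>I. \<psi> i \<in> fms LN) \<and>
     (\<forall>I0 n. finite I0 \<longrightarrow> I0 \<subseteq> I \<longrightarrow> (\<exists>\<delta>\<in>\<rho>. solutions M \<delta> = {a \<in> dom1 M. N a \<Turnstile> approx_sentence z \<psi> k I0 n})))"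

text \<open>Approximations in fibres that depend on the approximation are collected in the limit type
  of the fibres along an ultrafilter.\<close>

lemma limit_fibre_type:
  fixes I :: "'i set"
  assumes \<psi>: "\<And>i. i \<in> I \<Longrightarrow> \<psi> i \<in> fms LN"
    and apx: "\<And>I0 n. finite I0 \<Longrightarrow> I0 \<subseteq> I \<Longrightarrow> \<exists>a\<in>dom1 M. fapprox (N a) z \<psi> k I0 n"
  shows "\<exists>\<rho>. fibre_type I \<rho>"
proof -
  obtain U where U: "U \<le> grid_filter I" "ultrafilter_on UNIV U"
    using ultrafilter_exists[OF grid_filter_not_bot] by blast
  have ex: "\<forall>q. \<exists>a. a \<in> dom1 M \<and> (finite (fst q) \<longrightarrow> fst q \<subseteq> I \<longrightarrow> fapprox (N a) z \<psi> k (fst q) (snd q))"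
    using apx M_nonempty[of "()"] by (metis ex_in_conv)
  from choice[OF ex] obtain \<alpha> where \<alpha>: "\<forall>q. \<alpha> q \<in> dom1 M \<and>
     (finite (fst q) \<longrightarrow> fst q \<subseteq> I \<longrightarrow> fapprox (N (\<alpha> q)) z \<psi> k (fst q) (snd q))" by (elim exE)
  define \<rho> where "\<rho> = {\<theta> \<in> fms1 LM. eventually (\<lambda>q. \<alpha> q \<in> solutions M \<theta>) U}"
  have "\<rho> \<in> S1 LM M"
    unfolding S1_def
  proof (intro CollectI conjI allI impI ballI)
    show "\<rho> \<subseteq> fms1 LM" by (auto simp: \<rho>_def)
  next
    fix q assume q: "q \<subseteq> \<rho>" "finite q"
    then have "eventually (\<lambda>p. \<forall>\<phi>\<in>q. \<alpha> p \<in> solutions M \<phi>) U"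
      by (auto simp: eventually_ball_finite_distrib \<rho>_def)
    moreover have "U \<noteq> bot" using U(2) by (simp add: ultrafilter_on_def)
    ultimately obtain p where "\<forall>\<phi>\<in>q. \<alpha> p \<in> solutions M \<phi>" using eventually_happens' by blast
    then show "\<exists>a\<in>dom1 M. \<forall>\<phi>\<in>q. a \<in> solutions M \<phi>" using \<alpha> by blast
  next
    fix \<phi> assume \<phi>: "\<phi> \<in> fms1 LM"
    then have "Neg \<phi> \<in> fms1 LM" by (simp add: fms1_def fms_def)
    moreover have "\<alpha> q \<in> solutions M (Neg \<phi>) \<longleftrightarrow> \<not> \<alpha> q \<in> solutions M \<phi>" for q
      using \<alpha> by (simp add: solutions_def)
    ultimately show "\<phi> \<in> \<rho> \<or> Neg \<phi> \<in> \<rho>"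
      using \<phi> ultrafilter_not[OF U(2), of "\<lambda>q. \<alpha> q \<in> solutions M \<phi>"] by (simp add: \<rho>_def)
  qed
  moreover have "\<exists>\<delta>\<in>\<rho>. solutions M \<delta> = {a \<in> dom1 M. N a \<Turnstile> approx_sentence z \<psi> k I0 n}"
    if I0: "finite I0" "I0 \<subseteq> I" for I0 n
  proof -
    have "approx_sentence z \<psi> k I0 n \<in> sentences LN"
      by (rule approx_sentence_sentences[OF I0(1)]) (use \<psi> I0(2) in blast)
    from definable[OF this] obtain \<delta> where \<delta>: "\<delta> \<in> fms1 LM"
      "{a \<in> dom1 M. N a \<Turnstile> approx_sentence z \<psi> k I0 n} = solutions M \<delta>" unfolding definable0_def by blast
    have "eventually (\<lambda>q. finite (fst q) \<and> fst q \<subseteq> I \<and> I0 \<subseteq> fst q \<and> n \<le> snd q) U"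
      by (rule eventually_grid_filterI[OF I0 U(1)])
    then have "eventually (\<lambda>q. \<alpha> q \<in> solutions M \<delta>) U"
    proof (rule eventually_mono)
      fix q assume q: "finite (fst q) \<and> fst q \<subseteq> I \<and> I0 \<subseteq> fst q \<and> n \<le> snd q"
      have "\<alpha> q \<in> dom1 M" and ap: "fapprox (N (\<alpha> q)) z \<psi> k (fst q) (snd q)" using \<alpha> q by blast+
      have "fapprox (N (\<alpha> q)) z \<psi> k I0 n" by (rule approx_mono[OF ap]) (use q in blast)+
      then have "N (\<alpha> q) \<Turnstile> approx_sentence z \<psi> k I0 n"
        unfolding models_approx_sentence[OF I0(1) N_nonempty[OF \<open>\<alpha> q \<in> dom1 M\<close>]] .
      then show "\<alpha> q \<in> solutions M \<delta>" unfolding \<delta>(2)[symmetric] using \<open>\<alpha> q \<in> dom1 M\<close> by blast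
    qed
    then have "\<delta> \<in> \<rho>" using \<delta>(1) by (simp add: \<rho>_def)
    then show ?thesis using \<delta>(2) by blast
  qed
  ultimately have "fibre_type I \<rho>"
    unfolding fibre_type_def
    by (intro conjI exI[of _ z] exI[of _ \<psi>] exI[of _ k] ballI \<psi> allI impI)
  then show ?thesis by blast
qed

lemma approximable_lex_product:
  fixes I :: "'i set"
  assumes "approximable LS S I"
  shows "approximable LM M I \<or> (\<exists>\<rho>. fibre_type I \<rho>)"
proof -
  from assms obtain x \<phi> k where \<phi>: "\<forall>i\<in>I. \<phi> i \<in> fms LS"
    and apx: "\<forall>I0 n. finite I0 \<longrightarrow> I0 \<subseteq> I \<longrightarrow> fapprox S x \<phi> k I0 n"
    unfolding approximable_def by (elim exE conjE)
  let ?B = "univ S (fst x)" and ?z = "enc x"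
  have "\<exists>\<Theta>\<Psi>. determined (\<phi> i) (fst \<Theta>\<Psi>) (snd \<Theta>\<Psi>)" if "i \<in> I" for i
  proof -
    have "wf_fm LS (\<phi> i)" using \<phi> that by (simp add: fms_def)
    from quantifier_elimination[OF this] obtain \<Theta> \<Psi> where "determined (\<phi> i) \<Theta> \<Psi>" by (elim exE)
    then show ?thesis by (intro exI[of _ "(\<Theta>, \<Psi>)"]) simp
  qed
  then have "\<forall>i\<in>I. \<exists>\<Theta>\<Psi>. determined (\<phi> i) (fst \<Theta>\<Psi>) (snd \<Theta>\<Psi>)" by blast
  from bchoice[OF this] obtain \<Theta>\<Psi> where \<Theta>\<Psi>: "\<forall>i\<in>I. determined (\<phi> i) (fst (\<Theta>\<Psi> i)) (snd (\<Theta>\<Psi> i))" by (elim exE)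
  define \<Theta> where "\<Theta> = (\<lambda>i. fst (\<Theta>\<Psi> i))"
  define \<Psi> where "\<Psi> = (\<lambda>i. snd (\<Theta>\<Psi> i))"
  have det: "determined (\<phi> i) (\<Theta> i) (\<Psi> i)" if "i \<in> I" for i using \<Theta>\<Psi> that by (simp add: \<Theta>_def \<Psi>_def)
  define V where "V = (\<lambda>i. (\<Union> (fv ` \<Theta> i) \<union> \<Union> (fv ` \<Psi> i)) - {?z})"
  have g: "finite (\<Theta> i)" "\<Theta> i \<subseteq> fms LM" "finite (\<Psi> i)" "\<Psi> i \<subseteq> fms LN" if "i \<in> I" for i
    using det[OF that] unfolding determined_def by blast+
  have gV: "finite (V i)" "?z \<notin> V i" "\<And>\<theta>. \<theta> \<in> \<Theta> i \<Longrightarrow> fv \<theta> \<subseteq> insert ?z (V i)"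
    "\<And>\<psi>. \<psi> \<in> \<Psi> i \<Longrightarrow> fv \<psi> \<subseteq> insert ?z (V i)" if "i \<in> I" for i
    using g[OF that] by (auto simp: V_def)
  note gd = g gV
  \<comment> \<open>For finite \<open>M\<close> there are finitely many projections, so the
    projection of the solution can be part of the colour. This secures a common fibre even for a
    pattern with one row. For infinite \<open>M\<close> this component is constant.\<close>
  define col where "col = (\<lambda>i e b. (colour x (\<Theta> i) (\<Psi> i) (V i) e b, if finite (dom1 M) then bp b else undefined))"
  define C where "C = (\<lambda>i. colour_set (\<Theta> i) (\<Psi> i) (V i) \<times> (if finite (dom1 M) then dom1 M else {undefined}))"
  have "\<exists>c. \<forall>I0 n. finite I0 \<longrightarrow> I0 \<subseteq> I \<longrightarrow> approx (assignments S) ?B (\<lambda>i e b. sat S (e(x := b)) (\<phi> i))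
      (\<lambda>i e b. sat S (e(x := b)) (\<phi> i) \<and> col i e b = c i) k I0 n"
  proof (rule approx_colour)
    show "fapprox S x \<phi> k I0 n" if "finite I0" "I0 \<subseteq> I" for I0 n using apx that by blast
    show "finite (C i)" if "i \<in> I" for i
      using finite_colour_set[OF gd(1,3,5)[OF that]] by (simp add: C_def)
    show "col i e b \<in> C i" if "b \<in> ?B" for i e b
      using bp_in[OF that] colour_in_set by (simp add: col_def C_def)
  qed
  then obtain c where c: "\<forall>I0 n. finite I0 \<longrightarrow> I0 \<subseteq> I \<longrightarrow> approx (assignments S) ?B (\<lambda>i e b. sat S (e(x := b)) (\<phi> i))
      (\<lambda>i e b. sat S (e(x := b)) (\<phi> i) \<and> col i e b = c i) k I0 n" by (elim exE)
  define TM where "TM = (\<lambda>i. fst (fst (c i)))"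
  define TN where "TN = (\<lambda>i. fst (snd (fst (c i))))"
  define D where "D = (\<lambda>i. fst (snd (snd (fst (c i)))))"
  define W where "W = (\<lambda>i. fst (snd (snd (snd (fst (c i))))))"
  define u where "u = (\<lambda>i. snd (snd (snd (snd (fst (c i))))))"
  define \<alpha>0 where "\<alpha>0 = (\<lambda>i. snd (c i))"
  define Q where "Q = (\<lambda>i e b. colour x (\<Theta> i) (\<Psi> i) (V i) e b = (TM i, TN i, D i, W i, u i))"
  have col: "col i e b = c i \<longleftrightarrow> Q i e b \<and> (if finite (dom1 M) then bp b else undefined) = \<alpha>0 i" for i e b
    by (simp add: col_def Q_def TM_def TN_def D_def W_def u_def \<alpha>0_def prod_eq_iff)
  \<comment> \<open>The formulas are replaced by the conditions \<open>Q i\<close>. An element with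
    the prescribed colour at every column of a set would satisfy \<open>\<phi> i\<close> at each of
    them, because a path solution of the same colour at that column does; so rows remain
    inconsistent.\<close>
  have pure: "\<exists>a. (\<forall>i j. a i j \<in> assignments S) \<and>
      (\<forall>i\<in>I0. \<forall>J\<subseteq>{..n}. card J = k i \<longrightarrow> \<not> (\<exists>b\<in>?B. \<forall>j\<in>J. Q i (a i j) b)) \<and>
      (\<forall>f. (\<forall>i\<in>I0. f i \<le> n) \<longrightarrow> (\<exists>b\<in>?B. \<forall>i\<in>I0. Q i (a i (f i)) b \<and> (finite (dom1 M) \<longrightarrow> bp b = \<alpha>0 i)))"
    if I0: "finite I0" "I0 \<subseteq> I" for I0 and n :: nat
  proof -
    have "approx (assignments S) ?B (\<lambda>i e b. sat S (e(x := b)) (\<phi> i))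
      (\<lambda>i e b. sat S (e(x := b)) (\<phi> i) \<and> col i e b = c i) k I0 n" using c I0 by blast
    then obtain a where a: "\<forall>i j. a i j \<in> assignments S"
      and rows: "\<forall>i\<in>I0. \<forall>J\<subseteq>{..n}. card J = k i \<longrightarrow> \<not> (\<exists>b\<in>?B. \<forall>j\<in>J. sat S ((a i j)(x := b)) (\<phi> i))"
      and paths: "\<forall>f. (\<forall>i\<in>I0. f i \<le> n) \<longrightarrow>
         (\<exists>b\<in>?B. \<forall>i\<in>I0. sat S ((a i (f i))(x := b)) (\<phi> i) \<and> col i (a i (f i)) b = c i)"
      unfolding approx_def by (elim exE conjE)
    have "\<not> (\<exists>b\<in>?B. \<forall>j\<in>J. Q i (a i j) b)" if i: "i \<in> I0" and J: "J \<subseteq> {..n}" "card J = k i" for i J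
    proof
      assume "\<exists>b\<in>?B. \<forall>j\<in>J. Q i (a i j) b"
      then obtain b where b: "b \<in> ?B" "\<forall>j\<in>J. Q i (a i j) b" by blast
      have "sat S ((a i j)(x := b)) (\<phi> i)" if j: "j \<in> J" for j
      proof -
        have "\<forall>i\<in>I0. (\<lambda>_. j) i \<le> n" using j J(1) by auto
        from paths[THEN spec, THEN mp, OF this] obtain b' where b': "b' \<in> ?B"
          "sat S ((a i j)(x := b')) (\<phi> i)" "col i (a i j) b' = c i" using i by blast
        have "colour x (\<Theta> i) (\<Psi> i) (V i) (a i j) b = colour x (\<Theta> i) (\<Psi> i) (V i) (a i j) b'"
          using b'(3) b(2) j unfolding col Q_def by simp
        from colour_determines[OF det _ _ b(1) b'(1) this] show ?thesis using b'(2) a i I0(2) by blast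
      qed
      then show False using rows i J b(1) by blast
    qed
    moreover have "\<exists>b\<in>?B. \<forall>i\<in>I0. Q i (a i (f i)) b \<and> (finite (dom1 M) \<longrightarrow> bp b = \<alpha>0 i)"
      if f: "\<forall>i\<in>I0. f i \<le> n" for f
    proof -
      from paths[THEN spec, THEN mp, OF f] obtain b where b: "b \<in> ?B"
        "\<forall>i\<in>I0. sat S ((a i (f i))(x := b)) (\<phi> i) \<and> col i (a i (f i)) b = c i" by blast
      have "Q i (a i (f i)) b \<and> (finite (dom1 M) \<longrightarrow> bp b = \<alpha>0 i)" if "i \<in> I0" for i
        using b(2) that unfolding col by auto
      with b(1) show ?thesis by blast
    qed
    ultimately show ?thesis using a by (intro exI[of _ a] conjI allI ballI impI) blast+
  qed
  have B: "\<exists>b. b \<in> ?B" using is_struct_nonempty[OF is_struct_S] by blast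
  \<comment> \<open>Otherwise the undetermined element would be the only one of this colour, and it
    would solve all columns of the row at once.\<close>
  have u: "\<not> u i" if i: "i \<in> I" for i
  proof
    assume ui: "u i"
    from pure[of "{i}" "k i"] i obtain a where
      rows: "\<forall>i'\<in>{i}. \<forall>J\<subseteq>{..k i}. card J = k i' \<longrightarrow> \<not> (\<exists>b\<in>?B. \<forall>j\<in>J. Q i' (a i' j) b)" and
      paths: "\<forall>f. (\<forall>i'\<in>{i}. f i' \<le> k i) \<longrightarrow> (\<exists>b\<in>?B. \<forall>i'\<in>{i}. Q i' (a i' (f i')) b \<and> (finite (dom1 M) \<longrightarrow> bp b = \<alpha>0 i'))"
      by auto
    have *: "Undetermined \<in> ?B \<and> Q i (a i j) Undetermined" if j: "j \<le> k i" for j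
    proof -
      obtain b where b: "b \<in> ?B" "Q i (a i j) b" using paths[rule_format, of "\<lambda>_. j"] j by auto
      have "b = Undetermined" using colour_eqD(5)[OF b(2)[unfolded Q_def]] ui by blast
      then show ?thesis using b by simp
    qed
    have "{..<k i} \<subseteq> {..k i}" by auto
    then have "\<not> (\<exists>b\<in>?B. \<forall>j\<in>{..<k i}. Q i (a i j) b)" using rows by simp
    then show False using * by (metis lessThan_iff less_imp_le_nat zero_le)
  qed
  have Qeq: "colour x (\<Theta> i) (\<Psi> i) (V i) e b = (TM i, TN i, D i, W i, False)" if "i \<in> I" "Q i e b" for i e b
    using that u[OF that(1)] by (simp add: Q_def)
  have QI: "Q i e b" if "i \<in> I" "colour x (\<Theta> i) (\<Psi> i) (V i) e b = (TM i, TN i, D i, W i, False)" for i e b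
    using that u[OF that(1)] by (simp add: Q_def)
  have sub: "TM i \<subseteq> \<Theta> i" "TN i \<subseteq> \<Psi> i" if "i \<in> I" "Q i e b" for i e b
    using colour_eqD(6,7)[OF Qeq[OF that]] by blast+
  have subI: "TM i \<subseteq> \<Theta> i" "TN i \<subseteq> \<Psi> i" if i: "i \<in> I" for i
  proof -
    have "finite {i}" "{i} \<subseteq> I" using i by auto
    from pure[OF this, of 0] obtain a where p:
      "\<forall>f :: 'i \<Rightarrow> nat. (\<forall>i'\<in>{i}. f i' \<le> 0) \<longrightarrow> (\<exists>b\<in>?B. \<forall>i'\<in>{i}. Q i' (a i' (f i')) b \<and> (finite (dom1 M) \<longrightarrow> bp b = \<alpha>0 i'))"
      by (elim exE conjE)
    have "\<forall>i'\<in>{i}. (0 :: nat) \<le> 0" by simp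
    from p[THEN spec, of "\<lambda>_. 0", THEN mp, OF this] obtain e b where "Q i e b" by blast
    then show "TM i \<subseteq> \<Theta> i" "TN i \<subseteq> \<Psi> i" using sub i by blast+
  qed
  define \<chi>M where "\<chi>M = (\<lambda>i. colour_fm_M x (\<Theta> i) (\<Psi> i) (V i) (TM i) (TN i) (D i))"
  define \<chi>N where "\<chi>N = (\<lambda>i. colour_fm_N ?z (\<Psi> i) (TN i) (W i))"
  have Mpath: "sat M ((mval e)(?z := bp b)) (\<chi>M i)"
    if "i \<in> I" "W i = {}" "e \<in> assignments S" "b \<in> ?B" "Q i e b" for i e b
    unfolding \<chi>M_def using Qeq[OF that(1,5)] that(2)
    by (intro colour_fm_M_path[OF gd[OF that(1)] that(3,4)]) simp_all
  have Mrow: "\<exists>b\<in>?B. \<forall>j\<in>J. Q i (e j) b"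
    if i: "i \<in> I" "W i = {}" and e: "\<And>j. j \<in> J \<Longrightarrow> e j \<in> assignments S"
      and b: "\<And>j. j \<in> J \<Longrightarrow> b j \<in> ?B \<and> Q i (e j) (b j)" and a: "a \<in> dom1 M"
      and s: "\<And>j. j \<in> J \<Longrightarrow> sat M ((mval (e j))(?z := a)) (\<chi>M i)" for i e b a and J :: "nat set"
  proof (cases "J = {}")
    case True
    then show ?thesis using B by blast
  next
    case False
    have "\<exists>b\<in>?B. \<forall>j\<in>J. colour x (\<Theta> i) (\<Psi> i) (V i) (e j) b = (TM i, TN i, D i, {}, False)"
    proof (rule colour_fm_M_row[OF gd[OF i(1)] False e _ _ a])
      show "b j \<in> ?B" if "j \<in> J" for j using b that by blast
      show "colour x (\<Theta> i) (\<Psi> i) (V i) (e j) (b j) = (TM i, TN i, D i, {}, False)" if "j \<in> J" for j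
        using Qeq[OF i(1), of "e j" "b j"] b[OF that] i(2) by simp
      show "sat M ((mval (e j))(?z := a)) (colour_fm_M x (\<Theta> i) (\<Psi> i) (V i) (TM i) (TN i) (D i))" if "j \<in> J" for j
        using s[OF that] by (simp add: \<chi>M_def)
    qed
    then obtain b where b: "b \<in> ?B" "\<forall>j\<in>J. colour x (\<Theta> i) (\<Psi> i) (V i) (e j) b = (TM i, TN i, D i, {}, False)"
      by blast
    have "Q i (e j) b" if "j \<in> J" for j
      by (rule QI[OF i(1)]) (use b(2) that i(2) in simp)
    with b(1) show ?thesis by blast
  qed
  show ?thesis
  proof (cases "\<forall>i\<in>I. W i = {}")
    case W: True
    have "fapprox M ?z \<chi>M k I0 n" if I0: "finite I0" "I0 \<subseteq> I" for I0 n
    proof -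
      from pure[OF I0, of n] obtain a where a: "\<forall>i j. a i j \<in> assignments S"
        and rows: "\<forall>i\<in>I0. \<forall>J\<subseteq>{..n}. card J = k i \<longrightarrow> \<not> (\<exists>b\<in>?B. \<forall>j\<in>J. Q i (a i j) b)"
        and paths: "\<forall>f. (\<forall>i\<in>I0. f i \<le> n) \<longrightarrow> (\<exists>b\<in>?B. \<forall>i\<in>I0. Q i (a i (f i)) b \<and> (finite (dom1 M) \<longrightarrow> bp b = \<alpha>0 i))"
        by (elim exE conjE)
      show ?thesis
        unfolding approx_def
      proof (intro exI[of _ "\<lambda>i j. mval (a i j)"] conjI allI ballI impI)
        show "mval (a i j) \<in> assignments M" for i j using a mval_assignment by blast
      next
        fix i J assume i: "i \<in> I0" and J: "J \<subseteq> {..n}" "card J = k i"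
        have iI: "i \<in> I" using i I0 by blast
        show "\<not> (\<exists>b\<in>univ M (fst ?z). \<forall>j\<in>J. sat M ((mval (a i j))(?z := b)) (\<chi>M i))"
        proof
          assume "\<exists>b\<in>univ M (fst ?z). \<forall>j\<in>J. sat M ((mval (a i j))(?z := b)) (\<chi>M i)"
          then obtain m where m: "m \<in> dom1 M" "\<forall>j\<in>J. sat M ((mval (a i j))(?z := m)) (\<chi>M i)" by auto
          have "\<exists>b. b \<in> ?B \<and> Q i (a i j) b" if "j \<in> J" for j
            using paths[rule_format, of "\<lambda>_. j"] i that J(1) by auto
          then have "\<forall>j\<in>J. \<exists>b. b \<in> ?B \<and> Q i (a i j) b" by blast
          from bchoice[OF this] obtain b where b: "\<forall>j\<in>J. b j \<in> ?B \<and> Q i (a i j) (b j)" by (elim exE)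
          have "\<exists>b\<in>?B. \<forall>j\<in>J. Q i (a i j) b"
            by (rule Mrow[OF iI _ _ _ m(1), of J "a i" b]) (use W iI a b m(2) in auto)
          then show False using rows i J by blast
        qed
      next
        fix f assume "\<forall>i\<in>I0. f i \<le> n"
        then obtain b where b: "b \<in> ?B" "\<forall>i\<in>I0. Q i (a i (f i)) b" using paths by blast
        have "sat M ((mval (a i (f i)))(?z := bp b)) (\<chi>M i)" if "i \<in> I0" for i
          by (rule Mpath) (use W a b I0(2) that in auto)
        then show "\<exists>b\<in>univ M (fst ?z). \<forall>i\<in>I0. sat M ((mval (a i (f i)))(?z := b)) (\<chi>M i)"
          using bp_in[OF b(1)] by auto
      qed
    qed
    moreover have "\<chi>M i \<in> fms LM" if "i \<in> I" for i
      unfolding \<chi>M_def by (rule colour_fm_M_fms[OF gd[OF that] subI[OF that]])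
    ultimately have "approximable LM M I"
      unfolding approximable_def by (intro exI[of _ ?z] exI[of _ \<chi>M] exI[of _ k] conjI ballI allI impI)
    then show ?thesis by blast
  next
    case False
    then obtain i0 where i0: "i0 \<in> I" "W i0 \<noteq> {}" by blast
    have fibre: "\<exists>\<alpha> d d'. b = Pt \<alpha> d \<and> e (dec w) = Pt \<alpha> d'"
      if "i \<in> I" "w \<in> W i" "Q i e b" for i w e b
    proof -
      note q = Qeq[OF that(1,3)]
      have "w \<in> V i" using colour_eqD(9)[OF q] that(2) by blast
      from colour_eqD(4)[OF q this] that(2) show ?thesis by blast
    qed
    show ?thesis
    proof (cases "infinite (dom1 M) \<and> I = {i0}")
      case True
      then show ?thesis using infinite_approximable[of M LM i0] by simp
    next
      case nsing: False
      \<comment> \<open>Fixing the column of row \<open>i0\<close> pins the projection of the path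
        solutions while the column of row \<open>i1\<close> varies. This projection would satisfy
        \<open>\<chi>M i1\<close> at \<open>k i1\<close> columns simultaneously, and
        \<open>Mrow\<close> would turn it into a common solution.\<close>
      have WI: "W i1 \<noteq> {}" if i1: "i1 \<in> I" "i1 \<noteq> i0" for i1
      proof
        assume W1: "W i1 = {}"
        obtain w where w: "w \<in> W i0" using i0 by blast
        have "finite {i0, i1}" "{i0, i1} \<subseteq> I" using i0 i1 by auto
        from pure[OF this, of "k i1"] obtain a where a: "\<forall>i j. a i j \<in> assignments S"
          and rows: "\<forall>i\<in>{i0, i1}. \<forall>J\<subseteq>{..k i1}. card J = k i \<longrightarrow> \<not> (\<exists>b\<in>?B. \<forall>j\<in>J. Q i (a i j) b)"
          and paths: "\<forall>f. (\<forall>i\<in>{i0, i1}. f i \<le> k i1) \<longrightarrow>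
            (\<exists>b\<in>?B. \<forall>i\<in>{i0, i1}. Q i (a i (f i)) b \<and> (finite (dom1 M) \<longrightarrow> bp b = \<alpha>0 i))"
          by (elim exE conjE)
        have "\<exists>b. b \<in> ?B \<and> Q i1 (a i1 j) b \<and> Q i0 (a i0 0) b" if "j \<le> k i1" for j
        proof -
          have "\<forall>i\<in>{i0, i1}. (\<lambda>i. if i = i1 then j else 0) i \<le> k i1" using that by auto
          from paths[THEN spec, THEN mp, OF this] show ?thesis using i1(2) by auto
        qed
        then have "\<forall>j\<in>{..k i1}. \<exists>b. b \<in> ?B \<and> Q i1 (a i1 j) b \<and> Q i0 (a i0 0) b" by blast
        from bchoice[OF this] obtain b where
          b: "\<forall>j\<in>{..k i1}. b j \<in> ?B \<and> Q i1 (a i1 j) (b j) \<and> Q i0 (a i0 0) (b j)" by (elim exE)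
        have bp: "bp (b j) = bp (a i0 0 (dec w))" if "j \<le> k i1" for j
          using fibre[OF i0(1) w, of "a i0 0" "b j"] b that by auto
        have m: "bp (a i0 0 (dec w)) \<in> dom1 M" using bp_in[of "b 0"] bp[of 0] b by auto
        have "\<exists>b\<in>?B. \<forall>j\<in>{..<k i1}. Q i1 (a i1 j) b"
        proof (rule Mrow[OF i1(1) W1 _ _ m, of "{..<k i1}" "a i1" b])
          fix j assume j: "j \<in> {..<k i1}"
          show "a i1 j \<in> assignments S" using a by blast
          show "b j \<in> ?B \<and> Q i1 (a i1 j) (b j)" using b j by auto
          show "sat M ((mval (a i1 j))(?z := bp (a i0 0 (dec w)))) (\<chi>M i1)"
            using Mpath[OF i1(1) W1, of "a i1 j" "b j"] a b j bp[of j] by auto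
        qed
        moreover have "{..<k i1} \<subseteq> {..k i1}" by auto
        ultimately show False using rows by simp
      qed
      have "\<exists>\<alpha>\<in>dom1 M. fapprox (N \<alpha>) ?z \<chi>N k I0 n" if I0: "finite I0" "I0 \<subseteq> I" for I0 n
      proof -
        \<comment> \<open>For infinite \<open>M\<close> the approximation is enlarged to contain a
          second row, so that two rows control the projection.\<close>
        have "\<exists>I1. finite I1 \<and> I0 \<subseteq> I1 \<and> i0 \<in> I1 \<and> I1 \<subseteq> I \<and> (infinite (dom1 M) \<longrightarrow> (\<exists>i1\<in>I1. i1 \<noteq> i0))"
        proof (cases "infinite (dom1 M)")
          case True
          then obtain i1 where "i1 \<in> I" "i1 \<noteq> i0" using nsing i0(1) by blast
          then show ?thesis using I0 i0 by (intro exI[of _ "insert i0 (insert i1 I0)"]) auto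
        qed (use I0 i0 in \<open>auto intro!: exI[of _ "insert i0 I0"]\<close>)
        then obtain I1 where I1: "finite I1" "I0 \<subseteq> I1" "i0 \<in> I1" "I1 \<subseteq> I"
          "infinite (dom1 M) \<Longrightarrow> \<exists>i1\<in>I1. i1 \<noteq> i0" by blast
        from pure[OF I1(1,4), of n] obtain a where a: "\<forall>i j. a i j \<in> assignments S"
          and rows: "\<forall>i\<in>I1. \<forall>J\<subseteq>{..n}. card J = k i \<longrightarrow> \<not> (\<exists>b\<in>?B. \<forall>j\<in>J. Q i (a i j) b)"
          and paths: "\<forall>f. (\<forall>i\<in>I1. f i \<le> n) \<longrightarrow> (\<exists>b\<in>?B. \<forall>i\<in>I1. Q i (a i (f i)) b \<and> (finite (dom1 M) \<longrightarrow> bp b = \<alpha>0 i))"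
          by (elim exE conjE)
        have "\<exists>b. (\<forall>i\<in>I1. f i \<le> n) \<longrightarrow> b \<in> ?B \<and> (\<forall>i\<in>I1. Q i (a i (f i)) b \<and> (finite (dom1 M) \<longrightarrow> bp b = \<alpha>0 i))" for f
          using paths by blast
        then have "\<forall>f. \<exists>b. (\<forall>i\<in>I1. f i \<le> n) \<longrightarrow> b \<in> ?B \<and> (\<forall>i\<in>I1. Q i (a i (f i)) b \<and> (finite (dom1 M) \<longrightarrow> bp b = \<alpha>0 i))"
          by blast
        from choice[OF this] obtain bf where bf: "\<forall>f. (\<forall>i\<in>I1. f i \<le> n) \<longrightarrow> bf f \<in> ?B \<and>
           (\<forall>i\<in>I1. Q i (a i (f i)) (bf f) \<and> (finite (dom1 M) \<longrightarrow> bp (bf f) = \<alpha>0 i))" by (elim exE)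
        have bfB: "bf f \<in> ?B" and bfQ: "\<And>i. i \<in> I1 \<Longrightarrow> Q i (a i (f i)) (bf f)"
          and bf\<alpha>: "finite (dom1 M) \<Longrightarrow> bp (bf f) = \<alpha>0 i0" if "\<forall>i\<in>I1. f i \<le> n" for f
          using bf that I1(3) by blast+
        obtain w where w: "w \<in> W i0" using i0 by blast
        define \<alpha> where "\<alpha> = bp (bf (\<lambda>_. 0))"
        have \<alpha>M: "\<alpha> \<in> dom1 M" unfolding \<alpha>_def by (rule bp_in[OF bfB]) simp
        have bp\<alpha>: "bp (bf f) = \<alpha>" if f: "\<forall>i\<in>I1. f i \<le> n" for f
        proof (cases "finite (dom1 M)")
          case True
          then show ?thesis using bf\<alpha>[OF f] bf\<alpha>[of "\<lambda>_. 0"] by (simp add: \<alpha>_def)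
        next
          case False
          then obtain i1 where i1: "i1 \<in> I1" "i1 \<noteq> i0" using I1(5) by blast
          then have i1I: "i1 \<in> I" using I1(4) by blast
          obtain w1 where w1: "w1 \<in> W i1" using WI[OF i1I i1(2)] by blast
          have b0: "bp (bf f) = bp (a i0 (f i0) (dec w))" if "\<forall>i\<in>I1. f i \<le> n" for f
            using fibre[OF i0(1) w bfQ[OF that I1(3)]] by auto
          have b1: "bp (bf f) = bp (a i1 (f i1) (dec w1))" if "\<forall>i\<in>I1. f i \<le> n" for f
            using fibre[OF i1I w1 bfQ[OF that i1(1)]] by auto
          \<comment> \<open>\<open>?g\<close> agrees with \<open>f\<close> in row \<open>i0\<close>
            and with the zero path in row \<open>i1\<close>. As the projection is determined by
            either column alone, all three paths lead to the same fibre.\<close>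
          let ?g = "\<lambda>i. if i = i0 then f i0 else 0"
          have g: "\<forall>i\<in>I1. ?g i \<le> n" using f I1(3) by auto
          have "bp (bf f) = bp (bf ?g)" using b0[OF f] b0[OF g] by simp
          also have "\<dots> = bp (bf (\<lambda>_. 0))" using b1[OF g] b1[of "\<lambda>_. 0"] i1(2) by simp
          finally show ?thesis by (simp add: \<alpha>_def)
        qed
        have pt: "\<exists>d. bf f = Pt \<alpha> d \<and> d \<in> dom1 (N \<alpha>) \<and> fst x \<noteq> Base_Sort" if f: "\<forall>i\<in>I1. f i \<le> n" for f
        proof -
          obtain \<beta> d where "bf f = Pt \<beta> d" using fibre[OF i0(1) w bfQ[OF f I1(3)]] by blast
          moreover from this have "\<beta> = \<alpha>" using bp\<alpha>[OF f] by simp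
          ultimately show ?thesis using bfB[OF f] by (auto elim: univ_S_cases)
        qed
        have xB: "fst x \<noteq> Base_Sort" using pt[of "\<lambda>_. 0"] by auto
        obtain dn where dn: "dn \<in> dom1 (N \<alpha>)" using N_nonempty[OF \<alpha>M] by blast
        \<comment> \<open>Values that are not in \<open>N \<alpha>\<close> are replaced by
          \<open>dn\<close> to obtain assignments. Besides the variable of \<open>x\<close>, the
          formula \<open>\<chi>N i\<close> contains only variables of \<open>W i\<close>, whose
          values do lie in the fibre over \<open>\<alpha>\<close>.\<close>
        define a' where "a' = (\<lambda>i j z. if pval (a i j) z \<in> dom1 (N \<alpha>) then pval (a i j) z else dn)"
        have sat_a': "sat (N \<alpha>) ((a' i j)(?z := d)) (\<chi>N i) \<longleftrightarrow> sat (N \<alpha>) ((pval (a i j))(?z := d)) (\<chi>N i)"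
          if i: "i \<in> I1" and j: "j \<le> n" for i j d
        proof (rule sat_cong)
          fix z assume "z \<in> fv (\<chi>N i)"
          have iI: "i \<in> I" using i I1(4) by blast
          have fj: "\<forall>i\<in>I1. (\<lambda>_. j) i \<le> n" using j by simp
          have "z = ?z \<or> z \<in> W i"
            using \<open>z \<in> fv (\<chi>N i)\<close> fv_colour_fm_N[OF gd[OF iI] subI(2)[OF iI]] unfolding \<chi>N_def by blast
          moreover have "pval (a i j) z \<in> dom1 (N \<alpha>)" if zW: "z \<in> W i"
          proof -
            obtain \<beta> d1 d2 where bd: "bf (\<lambda>_. j) = Pt \<beta> d1" "a i j (dec z) = Pt \<beta> d2"
              using fibre[OF iI zW bfQ[OF fj i]] by blast
            have "a i j \<in> assignments S" using a by blast
            from assignmentsD[OF this, of "dec z"] have "d2 \<in> dom1 (N \<beta>)"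
              using bd(2) by (auto elim: univ_S_cases)
            moreover have "\<beta> = \<alpha>" using bp\<alpha>[OF fj] bd(1) by simp
            ultimately show ?thesis using bd(2) by (simp add: pval_def)
          qed
          ultimately show "((a' i j)(?z := d)) z = ((pval (a i j))(?z := d)) z" by (auto simp: a'_def)
        qed
        have "fapprox (N \<alpha>) ?z \<chi>N k I1 n"
          unfolding approx_def
        proof (intro exI[of _ a'] conjI allI ballI impI)
          show "a' i j \<in> assignments (N \<alpha>)" for i j using dn by (simp add: assignments_unit a'_def)
        next
          fix i J assume i: "i \<in> I1" and J: "J \<subseteq> {..n}" "card J = k i"
          have iI: "i \<in> I" using i I1(4) by blast
          show "\<not> (\<exists>b\<in>univ (N \<alpha>) (fst ?z). \<forall>j\<in>J. sat (N \<alpha>) ((a' i j)(?z := b)) (\<chi>N i))"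
          proof
            assume "\<exists>b\<in>univ (N \<alpha>) (fst ?z). \<forall>j\<in>J. sat (N \<alpha>) ((a' i j)(?z := b)) (\<chi>N i)"
            then obtain d where d: "d \<in> dom1 (N \<alpha>)" "\<forall>j\<in>J. sat (N \<alpha>) ((a' i j)(?z := d)) (\<chi>N i)" by auto
            have "Q i (a i j) (Pt \<alpha> d)" if j: "j \<in> J" for j
            proof -
              have jn: "j \<le> n" using j J(1) by auto
              then have fj: "\<forall>i\<in>I1. (\<lambda>_. j) i \<le> n" by simp
              obtain d0 where d0: "bf (\<lambda>_. j) = Pt \<alpha> d0" using pt[OF fj] by blast
              have "sat (N \<alpha>) ((pval (a i j))(?z := d)) (\<chi>N i)" using d(2) j sat_a'[OF i jn] by blast
              then show ?thesis
                using colour_fm_N_row[OF gd[OF iI] Qeq[OF iI bfQ[OF fj i], unfolded d0] \<alpha>M, of d] QI[OF iI]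
                unfolding \<chi>N_def by blast
            qed
            moreover have "Pt \<alpha> d \<in> ?B" using xB \<alpha>M d(1) by (simp add: univ_S_Pt)
            ultimately show False using rows i J by blast
          qed
        next
          fix f assume f: "\<forall>i\<in>I1. f i \<le> n"
          obtain d where d: "bf f = Pt \<alpha> d" "d \<in> dom1 (N \<alpha>)" using pt[OF f] by blast
          have "sat (N \<alpha>) ((a' i (f i))(?z := d)) (\<chi>N i)" if i: "i \<in> I1" for i
          proof -
            have iI: "i \<in> I" using i I1(4) by blast
            have "f i \<le> n" using f i by blast
            from sat_a'[OF i this] show ?thesis
              using colour_fm_N_path[OF gd[OF iI] Qeq[OF iI bfQ[OF f i], unfolded d(1)] \<alpha>M]
              unfolding \<chi>N_def by blast
          qed
          then show "\<exists>b\<in>univ (N \<alpha>) (fst ?z). \<forall>i\<in>I1. sat (N \<alpha>) ((a' i (f i))(?z := b)) (\<chi>N i)"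
            using d(2) by auto
        qed
        then have "fapprox (N \<alpha>) ?z \<chi>N k I0 n" by (rule approx_mono[OF _ I1(2) order_refl])
        then show ?thesis using \<alpha>M by blast
      qed
      moreover have "\<chi>N i \<in> fms LN" if "i \<in> I" for i
        unfolding \<chi>N_def by (rule colour_fm_N_fms[OF gd[OF that] subI(2)[OF that]])
      ultimately have "\<exists>\<rho>. fibre_type I \<rho>" by (intro limit_fibre_type)
      then show ?thesis by blast
    qed
  qed
qed

end

section \<open>The lower bounds\<close>

primrec base_trm :: "(unit, 'f) trm \<Rightarrow> (lex_sort, ('f, 'g) lex_fun) trm" where
  "base_trm (Var y) = Var (Base_Sort, snd y)"
| "base_trm (Fn f ts) = Fn (Base_Fun f) (map base_trm ts)"

primrec base_fm :: "(unit, 'f, 'p) fm \<Rightarrow> (lex_sort, ('f, 'g) lex_fun, ('p, 'q) lex_rel) fm" where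
  "base_fm (Eq t u) = Eq (base_trm t) (base_trm u)"
| "base_fm (Rel P ts) = Rel (Base_Rel P) (map base_trm ts)"
| "base_fm (Neg \<phi>) = Neg (base_fm \<phi>)"
| "base_fm (Conj \<phi> \<psi>) = Conj (base_fm \<phi>) (base_fm \<psi>)"
| "base_fm (Ex y \<phi>) = Ex (Base_Sort, snd y) (base_fm \<phi>)"

definition base_val :: "(lex_sort var \<Rightarrow> ('a, 'b) lex_elem) \<Rightarrow> unit var \<Rightarrow> 'a" where
  "base_val e y = the_base (e (Base_Sort, snd y))"

text \<open>Supplies, for each formula, a finite set of symbols that contains its constants, which
  can then be numbered.\<close>

primrec trm_syms :: "('s, 'f) trm \<Rightarrow> 'f set" where
  "trm_syms (Var y) = {}"
| "trm_syms (Fn f ts) = insert f (\<Union> (set (map trm_syms ts)))"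

primrec fm_syms :: "('s, 'f, 'p) fm \<Rightarrow> 'f set" where
  "fm_syms (Eq t u) = trm_syms t \<union> trm_syms u"
| "fm_syms (Rel P ts) = \<Union> (trm_syms ` set ts)"
| "fm_syms (Neg \<phi>) = fm_syms \<phi>"
| "fm_syms (Conj \<phi> \<psi>) = fm_syms \<phi> \<union> fm_syms \<psi>"
| "fm_syms (Ex x \<phi>) = fm_syms \<phi>"

lemma finite_trm_syms [simp]: "finite (trm_syms t)"
  by (induction t) auto

lemma finite_fm_syms [simp]: "finite (fm_syms \<phi>)"
  by (induction \<phi>) auto

text \<open>Odd indices, apart from the even ones that carry the variables of the translated
  formula.\<close>

definition temp :: "nat \<Rightarrow> lex_sort var" where
  "temp i = (Main_Sort, 2 * i + 1)"

text \<open>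
  The formula \<open>fibre_trm c t m z\<close> says that \<open>z\<close> is the value of \<open>t\<close> in the fibre of its variables.
  Terms have to be flattened because \<open>f\<^sub>\<bullet>\<close> takes values in the sort \<open>S \<union> {u}\<close>; the intermediate
  values are stored in the variables \<open>temp i\<close> with \<open>i \<ge> m\<close>.  The variables of \<open>t\<close> become variables
  of the main sort with an even index.  A constant symbol \<open>g\<close> is interpreted in the product by \<open>u\<close>,
  hence it is replaced by a variable with index \<open>c g\<close>, whose value will be a parameter.
\<close>

primrec fibre_trm :: "('g \<Rightarrow> nat) \<Rightarrow> (unit, 'g) trm \<Rightarrow> nat \<Rightarrow> lex_sort var
    \<Rightarrow> (lex_sort, ('f, 'g) lex_fun, ('p, 'q) lex_rel) fm" where
  "fibre_trm c (Var y) = (\<lambda>m z. Eq (Var (Main_Sort, 2 * snd y)) (Var z))"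
| "fibre_trm c (Fn g ts) = (\<lambda>m z. if ts = [] then Eq (Var (Main_Undet_Sort, c g)) (Fn Incl [Var z])
     else Exs ((\<lambda>i. temp (m + i)) ` {..<length ts})
       (Conj (Conjs ((\<lambda>i. (map (fibre_trm c) ts ! i) (m + length ts) (temp (m + i))) ` {..<length ts}))
         (Eq (Fn (Bullet_Fun g) (map (\<lambda>i. Var (temp (m + i))) [0..<length ts])) (Fn Incl [Var z]))))"

context lex_sum
begin

section \<open>Formulas of \<open>M\<close> in the base sort\<close>

lemma eval_base_trm:
  assumes "\<And>n. \<exists>a. e (Base_Sort, n) = Base a"
  shows "eval S e (base_trm t) = Base (eval M (base_val e) t)"
proof (induction t)
  case (Var y)
  obtain a where "e (Base_Sort, snd y) = Base a" using assms by blast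
  then show ?case by (simp add: base_val_def)
next
  case (Fn f ts)
  have "map (the_base \<circ> (eval S e \<circ> base_trm)) ts = map (eval M (base_val e)) ts"
    using Fn by (intro map_cong) auto
  then show ?case by (simp only: base_trm.simps eval.simps fun_int_S map_map)
qed

lemma sat_base_fm:
  "(\<And>n. \<exists>a. e (Base_Sort, n) = Base a) \<Longrightarrow> sat S e (base_fm \<phi>) \<longleftrightarrow> sat M (base_val e) \<phi>"
proof (induction \<phi> arbitrary: e)
  case (Eq t u)
  then show ?case using eval_base_trm[of e] by simp
next
  case (Rel P ts)
  have "map (the_base \<circ> (eval S e \<circ> base_trm)) ts = map (eval M (base_val e)) ts"
    using eval_base_trm[where e = e, OF Rel] by (intro map_cong) auto
  then show ?case by (simp only: base_fm.simps sat.simps rel_int_S map_map)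
next
  case (Neg \<phi>)
  then show ?case by simp
next
  case (Conj \<phi> \<psi>)
  then show ?case by simp
next
  case (Ex y \<phi>)
  have "sat S (e((Base_Sort, snd y) := Base a)) (base_fm \<phi>) \<longleftrightarrow> sat M ((base_val e)(y := a)) \<phi>" for a
  proof -
    have "base_val (e((Base_Sort, snd y) := Base a)) = (base_val e)(y := a)"
      by (auto simp: fun_eq_iff base_val_def prod_eq_iff)
    moreover have "\<exists>a'. (e((Base_Sort, snd y) := Base a)) (Base_Sort, n) = Base a'" for n
      using Ex.prems by auto
    then have "sat S (e((Base_Sort, snd y) := Base a)) (base_fm \<phi>) \<longleftrightarrow>
        sat M (base_val (e((Base_Sort, snd y) := Base a))) \<phi>" by (rule Ex.IH)
    ultimately show ?thesis by (simp only:)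
  qed
  then show ?case by (simp add: univ_S)
qed

lemma base_trm_sort: "has_sort LM t s \<Longrightarrow> has_sort LS (base_trm t) Base_Sort"
proof (induction rule: has_sort.induct)
  case (1 y)
  show ?case using has_sort.intros(1)[of LS "(Base_Sort, snd y)"] by simp
next
  case (2 f ts)
  have "Base_Fun f \<in> funs LS" using 2(1) by (simp add: lex_lang_def)
  moreover have "list_all2 (has_sort LS) (map base_trm ts) (fun_dom LS (Base_Fun f))"
    using 2(2) by (auto simp: lex_lang_def list_all2_map1 list_all2_map2 elim!: list_all2_mono)
  ultimately have "has_sort LS (Fn (Base_Fun f) (map base_trm ts)) (fun_cod LS (Base_Fun f))"
    by (rule has_sort.intros(2))
  then show ?case by (simp add: lex_lang_def)
qed

lemma base_fm_wf: "wf_fm LM \<phi> \<Longrightarrow> wf_fm LS (base_fm \<phi>)"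
proof (induction \<phi>)
  case (Rel P ts)
  then have "list_all2 (has_sort LS) (map base_trm ts) (rel_dom LS (Base_Rel P))"
    using base_trm_sort by (auto simp: lex_lang_def list_all2_map1 list_all2_map2 elim!: list_all2_mono)
  then show ?case using Rel by (simp add: lex_lang_def)
next
  case (Eq t u)
  then obtain s where "has_sort LM t s" "has_sort LM u s" by auto
  then show ?case using base_trm_sort by (auto intro: exI[of _ Base_Sort])
qed auto

lemma approximable_base:
  assumes "approximable LM M I"
  shows "approximable LS S I"
proof -
  from assms obtain x \<phi> k where \<phi>: "\<forall>i\<in>I. \<phi> i \<in> fms LM"
    and apx: "\<forall>I0 n. finite I0 \<longrightarrow> I0 \<subseteq> I \<longrightarrow> fapprox M x \<phi> k I0 n"
    unfolding approximable_def by (elim exE conjE)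
  let ?x = "(Base_Sort, snd x)"
  obtain e0 where e0: "e0 \<in> assignments S" using ex_assignment is_struct_nonempty[OF is_struct_S] by blast
  have "fapprox S ?x (\<lambda>i. base_fm (\<phi> i)) k I0 n" if I0: "finite I0" "I0 \<subseteq> I" for I0 n
  proof -
    have "fapprox M x \<phi> k I0 n" using apx I0 by blast
    then obtain a where a: "\<forall>i j. a i j \<in> assignments M"
      and rows: "\<forall>i\<in>I0. \<forall>J\<subseteq>{..n}. card J = k i \<longrightarrow> \<not> (\<exists>b\<in>univ M (fst x). \<forall>j\<in>J. sat M ((a i j)(x := b)) (\<phi> i))"
      and paths: "\<forall>f. (\<forall>i\<in>I0. f i \<le> n) \<longrightarrow> (\<exists>b\<in>univ M (fst x). \<forall>i\<in>I0. sat M ((a i (f i))(x := b)) (\<phi> i))"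
      unfolding approx_def by (elim exE conjE)
    define a' where "a' = (\<lambda>i j v. if fst v = Base_Sort then Base (a i j ((), snd v)) else e0 v)"
    have a': "a' i j \<in> assignments S" for i j
    proof -
      have "a' i j v \<in> univ S (fst v)" for v
        using a assignmentsD[OF e0, of v] by (auto simp: a'_def univ_S assignments_unit)
      then show ?thesis by (simp add: assignments_def)
    qed
    have s: "sat S ((a' i j)(?x := Base b)) (base_fm (\<phi> i)) \<longleftrightarrow> sat M ((a i j)(x := b)) (\<phi> i)" for i j b
    proof -
      have "base_val ((a' i j)(?x := Base b)) = (a i j)(x := b)"
        by (auto simp: fun_eq_iff base_val_def a'_def prod_eq_iff)
      moreover have "\<exists>c. ((a' i j)(?x := Base b)) (Base_Sort, n) = Base c" for n by (simp add: a'_def)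
      ultimately show ?thesis using sat_base_fm by metis
    qed
    have u: "univ S (fst ?x) = Base ` univ M (fst x)" by (simp add: univ_S)
    show ?thesis
      unfolding approx_def u
    proof (intro exI[of _ a'] conjI allI ballI impI)
      show "a' i j \<in> assignments S" for i j by (rule a')
    next
      fix i J assume "i \<in> I0" "J \<subseteq> {..n}" "card J = k i"
      then have "\<not> (\<exists>b\<in>univ M (fst x). \<forall>j\<in>J. sat M ((a i j)(x := b)) (\<phi> i))" using rows by blast
      then show "\<not> (\<exists>b\<in>Base ` univ M (fst x). \<forall>j\<in>J. sat S ((a' i j)(?x := b)) (base_fm (\<phi> i)))"
        unfolding bex_simps s .
    next
      fix f assume "\<forall>i\<in>I0. f i \<le> n"
      then have "\<exists>b\<in>univ M (fst x). \<forall>i\<in>I0. sat M ((a i (f i))(x := b)) (\<phi> i)" using paths by blast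
      then show "\<exists>b\<in>Base ` univ M (fst x). \<forall>i\<in>I0. sat S ((a' i (f i))(?x := b)) (base_fm (\<phi> i))"
        unfolding bex_simps s .
    qed
  qed
  moreover have "base_fm (\<phi> i) \<in> fms LS" if "i \<in> I" for i
    using \<phi> that base_fm_wf by (simp add: fms_def)
  ultimately show ?thesis
    unfolding approximable_def
    by (intro exI[of _ ?x] exI[of _ "\<lambda>i. base_fm (\<phi> i)"] exI[of _ k] conjI ballI allI impI)
qed

text \<open>The base variable with index \<open>0\<close> names the fibre and serves to relativise
  quantifiers. The constants in \<open>C\<close> are supplied as values of variables of the sort
  with \<open>u\<close>, because their copies in the product are \<open>u\<close>.\<close>

definition represents where
  "represents c C a e h \<longleftrightarrow> a \<in> dom1 M \<and> e \<in> assignments S \<and> h \<in> assignments (N a) \<and>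
     e (Base_Sort, 0) = Base a \<and> (\<forall>y. e (Main_Sort, 2 * snd y) = Pt a (h y)) \<and>
     (\<forall>g\<in>C. g \<in> funs LN \<longrightarrow> fun_dom LN g = [] \<longrightarrow> e (Main_Undet_Sort, c g) = Pt a (fun_int (N a) g []))"

lemma represents_temp:
  assumes "represents c C a e h" and "\<And>v. v \<notin> range temp \<Longrightarrow> e' v = e v" "e' \<in> assignments S"
  shows "represents c C a e' h"
proof -
  have "(Base_Sort, 0) \<notin> range temp" "(Main_Sort, 2 * n) \<notin> range temp" "(Main_Undet_Sort, n) \<notin> range temp" for n
    by (auto simp: temp_def) presburger
  then show ?thesis using assms unfolding represents_def by simp
qed

lemma temp_eq_iff [simp]: "temp i = temp j \<longleftrightarrow> i = j"
  by (auto simp: temp_def)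

text \<open>Each \<open>\<psi> i\<close> determines the value of its temporary variable, so the
  block of quantifiers has only one candidate, and the formula reduces to \<open>\<theta>\<close> at
  these values. This serves function and relation symbols alike.\<close>

lemma sat_Exs_temp:
  assumes r: "represents c C a e h" and v: "\<And>i. i < l \<Longrightarrow> v i \<in> dom1 (N a)"
    and \<psi>: "\<And>e' i. represents c C a e' h \<Longrightarrow> i < l \<Longrightarrow> sat S e' (\<psi> i) \<longleftrightarrow> e' (temp (m + i)) = Pt a (v i)"
    and \<theta>: "\<And>e'. represents c C a e' h \<Longrightarrow> (\<And>i. i < l \<Longrightarrow> e' (temp (m + i)) = Pt a (v i)) \<Longrightarrow>
      (\<And>y. y \<notin> (\<lambda>i. temp (m + i)) ` {..<l} \<Longrightarrow> e' y = e y) \<Longrightarrow> sat S e' \<theta> \<longleftrightarrow> R"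
  shows "sat S e (Exs ((\<lambda>i. temp (m + i)) ` {..<l}) (Conj (Conjs (\<psi> ` {..<l})) \<theta>)) \<longleftrightarrow> R"
proof -
  let ?W = "(\<lambda>i. temp (m + i)) ` {..<l}"
  have a: "a \<in> dom1 M" and e: "e \<in> assignments S" using r by (simp_all add: represents_def)
  have r': "represents c C a e' h" if "\<forall>y\<in>?W. e' y \<in> univ S (fst y)" "\<forall>y. y \<notin> ?W \<longrightarrow> e' y = e y" for e'
  proof (rule represents_temp[OF r])
    show "e' y = e y" if "y \<notin> range temp" for y
      using \<open>\<forall>y. y \<notin> ?W \<longrightarrow> e' y = e y\<close> that by blast
    have "e' y \<in> univ S (fst y)" for y using that assignmentsD[OF e, of y] by (cases "y \<in> ?W") auto
    then show "e' \<in> assignments S" by (simp add: assignments_def)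
  qed
  have conj: "sat S e' (Conj (Conjs (\<psi> ` {..<l})) \<theta>) \<longleftrightarrow>
     (\<forall>i<l. e' (temp (m + i)) = Pt a (v i)) \<and> R"
    if "\<forall>y\<in>?W. e' y \<in> univ S (fst y)" "\<forall>y. y \<notin> ?W \<longrightarrow> e' y = e y" for e'
  proof -
    have "sat S e' (Conjs (\<psi> ` {..<l})) \<longleftrightarrow> (\<forall>i<l. e' (temp (m + i)) = Pt a (v i))"
      using sat_Conjs[of "\<psi> ` {..<l}" S e'] is_struct_nonempty[OF is_struct_S] \<psi>[OF r'[OF that]] by auto
    moreover have "sat S e' \<theta> \<longleftrightarrow> R" if "\<forall>i<l. e' (temp (m + i)) = Pt a (v i)"
      by (rule \<theta>[OF r']) (use that \<open>\<forall>y\<in>?W. e' y \<in> univ S (fst y)\<close> \<open>\<forall>y. y \<notin> ?W \<longrightarrow> e' y = e y\<close> in auto)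
    ultimately show ?thesis unfolding sat.simps by blast
  qed
  have fin: "finite ?W" by simp
  show ?thesis unfolding sat_Exs[OF fin]
  proof
    assume "\<exists>e'. (\<forall>y\<in>?W. e' y \<in> univ S (fst y)) \<and> (\<forall>y. y \<notin> ?W \<longrightarrow> e' y = e y) \<and>
       sat S e' (Conj (Conjs (\<psi> ` {..<l})) \<theta>)"
    then obtain e' where "\<forall>y\<in>?W. e' y \<in> univ S (fst y)" "\<forall>y. y \<notin> ?W \<longrightarrow> e' y = e y"
       "sat S e' (Conj (Conjs (\<psi> ` {..<l})) \<theta>)" by (elim exE conjE)
    then show R using conj[of e'] by blast
  next
    assume R: R
    \<comment> \<open>\<open>(snd y - 1) div 2 - m\<close> recovers \<open>i\<close> from
      \<open>temp (m + i)\<close>.\<close>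
    define e' where "e' = (\<lambda>y. if y \<in> ?W then Pt a (v ((snd y - 1) div 2 - m)) else e y)"
    have tv: "e' (temp (m + i)) = Pt a (v i)" if "i < l" for i
      using that by (simp add: e'_def temp_def)
    have 1: "\<forall>y\<in>?W. e' y \<in> univ S (fst y)"
    proof
      fix y assume "y \<in> ?W"
      then obtain i where i: "y = temp (m + i)" "i < l" by blast
      show "e' y \<in> univ S (fst y)" unfolding i(1) tv[OF i(2)] using a v[OF i(2)] by (simp add: temp_def univ_S)
    qed
    have 2: "\<forall>y. y \<notin> ?W \<longrightarrow> e' y = e y" by (simp add: e'_def)
    have "sat S e' (Conj (Conjs (\<psi> ` {..<l})) \<theta>)" using conj[OF 1 2] tv R by blast
    then show "\<exists>e'. (\<forall>y\<in>?W. e' y \<in> univ S (fst y)) \<and> (\<forall>y. y \<notin> ?W \<longrightarrow> e' y = e y) \<and>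
       sat S e' (Conj (Conjs (\<psi> ` {..<l})) \<theta>)" using 1 2 by (intro exI[of _ e'] conjI)
  qed
qed

text \<open>The arguments are stored at the indices from \<open>m\<close> to
  \<open>m + length ts - 1\<close>, and their subterms use those from \<open>m + length ts\<close>
  on; the condition on \<open>z\<close> keeps the result variable from being overwritten.\<close>

lemma sat_fibre_trm:
  "has_sort LN t s \<Longrightarrow> represents c C a e h \<Longrightarrow> trm_syms t \<subseteq> C \<Longrightarrow> (\<And>i. z = temp i \<Longrightarrow> i < m) \<Longrightarrow>
    sat S e (fibre_trm c t m z) \<longleftrightarrow> e z = Pt a (eval (N a) h t)"
proof (induction t arbitrary: s e m z)
  case (Var y)
  then show ?case by (auto simp: represents_def)
next
  case (Fn g ts)
  have a: "a \<in> dom1 M" and h: "h \<in> assignments (N a)" using Fn.prems(2) by (simp_all add: represents_def)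
  from Fn.prems(1) have g: "g \<in> funs LN" and ts: "list_all2 (has_sort LN) ts (fun_dom LN g)"
    by (auto elim: has_sort.cases)
  show ?case
  proof (cases "ts = []")
    case True
    then have "fun_dom LN g = []" using ts by simp
    then have "e (Main_Undet_Sort, c g) = Pt a (fun_int (N a) g [])"
      using Fn.prems(2,3) g by (simp add: represents_def)
    then show ?thesis using True by auto
  next
    case False
    let ?l = "length ts"
    have hs: "has_sort LN (ts ! i) (fun_dom LN g ! i)" if "i < ?l" for i
      using ts that by (simp add: list_all2_conv_all_nth)
    have "sat S e (Exs ((\<lambda>i. temp (m + i)) ` {..<?l})
       (Conj (Conjs ((\<lambda>i. (map (fibre_trm c) ts ! i) (m + ?l) (temp (m + i))) ` {..<?l}))
         (Eq (Fn (Bullet_Fun g) (map (\<lambda>i. Var (temp (m + i))) [0..<?l])) (Fn Incl [Var z])))) \<longleftrightarrow>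
       e z = Pt a (fun_int (N a) g (map (\<lambda>i. eval (N a) h (ts ! i)) [0..<?l]))"
    proof (rule sat_Exs_temp[OF Fn.prems(2), where v = "\<lambda>i. eval (N a) h (ts ! i)"])
      show "eval (N a) h (ts ! i) \<in> dom1 (N a)" if "i < ?l" for i
        using eval_in_univ[OF N[OF a] h hs[OF that]] by simp
      show "sat S e' ((map (fibre_trm c) ts ! i) (m + ?l) (temp (m + i))) \<longleftrightarrow>
          e' (temp (m + i)) = Pt a (eval (N a) h (ts ! i))"
        if e': "represents c C a e' h" and i: "i < ?l" for e' i
      proof -
        have "trm_syms (ts ! i) \<subseteq> C" using Fn.prems(3) nth_mem[OF i] by auto
        then have "sat S e' (fibre_trm c (ts ! i) (m + ?l) (temp (m + i))) \<longleftrightarrow>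
            e' (temp (m + i)) = Pt a (eval (N a) h (ts ! i))"
          by (intro Fn.IH[OF nth_mem[OF i] hs[OF i] e']) (use i in auto)
        then show ?thesis using i by simp
      qed
      fix e' assume e't: "\<And>i. i < ?l \<Longrightarrow> e' (temp (m + i)) = Pt a (eval (N a) h (ts ! i))"
        and e'e: "\<And>y. y \<notin> (\<lambda>i. temp (m + i)) ` {..<?l} \<Longrightarrow> e' y = e y"
      have "z \<notin> (\<lambda>i. temp (m + i)) ` {..<?l}" using Fn.prems(4) by fastforce
      then have z: "e' z = e z" by (rule e'e)
      have m: "map (\<lambda>i. e' (temp (m + i))) [0..<?l] = map (Pt a) (map (\<lambda>i. eval (N a) h (ts ! i)) [0..<?l])"
        using e't by simp
      have ne: "[0..<?l] \<noteq> []" using False by simp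
      have b: "bullet_fun N g (map (Pt a) bs) = Pt a (fun_int (N a) g bs)" if "bs \<noteq> []" for bs
        using that by (simp add: bullet_fun_def hd_map o_def)
      have "eval S e' (Fn (Bullet_Fun g) (map (\<lambda>i. Var (temp (m + i))) [0..<?l])) =
          Pt a (fun_int (N a) g (map (\<lambda>i. eval (N a) h (ts ! i)) [0..<?l]))"
        unfolding eval.simps fun_int_S map_map o_def using m ne b by (simp only: map_is_Nil_conv not_False_eq_True)
      then show "sat S e' (Eq (Fn (Bullet_Fun g) (map (\<lambda>i. Var (temp (m + i))) [0..<?l])) (Fn Incl [Var z])) \<longleftrightarrow>
          e z = Pt a (fun_int (N a) g (map (\<lambda>i. eval (N a) h (ts ! i)) [0..<?l]))"
        using z by (simp only: sat.simps eval.simps fun_int_S list.map list.sel eq_commute)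
    qed
    moreover have "map (\<lambda>i. eval (N a) h (ts ! i)) [0..<?l] = map (eval (N a) h) ts"
      by (rule nth_equalityI) simp_all
    ultimately show ?thesis using False by (simp only: fibre_trm.simps eval.simps if_False)
  qed
qed

text \<open>A nullary relation of the product does not see the fibre, so its truth value in
  \<open>N a\<close> is expressed in \<open>M\<close> by the definability hypothesis. In an equation
  the common value is stored in \<open>temp 0\<close>, hence the other temporaries start at
  \<open>1\<close>. The form \<open>0 + i\<close> matches \<open>sat_Exs_temp\<close> with
  \<open>m = 0\<close>.\<close>

primrec fibre_tr :: "('g \<Rightarrow> nat) \<Rightarrow> (unit, 'g, 'q) fm \<Rightarrow> (lex_sort, ('f, 'g) lex_fun, ('p, 'q) lex_rel) fm" where
  "fibre_tr c (Eq t u) = Ex (temp 0) (Conj (fibre_trm c t 1 (temp 0)) (fibre_trm c u 1 (temp 0)))"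
| "fibre_tr c (Rel P ts) = (if ts = [] then base_fm (fibre_fm ((), 0) (Rel P []))
     else Exs ((\<lambda>i. temp (0 + i)) ` {..<length ts})
       (Conj (Conjs ((\<lambda>i. fibre_trm c (ts ! i) (length ts) (temp (0 + i))) ` {..<length ts}))
         (Rel (Bullet_Rel P) (map (\<lambda>i. Var (temp (0 + i))) [0..<length ts]))))"
| "fibre_tr c (Neg \<phi>) = Neg (fibre_tr c \<phi>)"
| "fibre_tr c (Conj \<phi> \<psi>) = Conj (fibre_tr c \<phi>) (fibre_tr c \<psi>)"
| "fibre_tr c (Ex y \<phi>) = Ex (Main_Sort, 2 * snd y)
     (Conj (Eq (Fn Proj [Var (Main_Sort, 2 * snd y)]) (Var (Base_Sort, 0))) (fibre_tr c \<phi>))"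

lemma represents_upd:
  assumes "represents c C a e h" "b \<in> dom1 (N a)"
  shows "represents c C a (e((Main_Sort, 2 * snd y) := Pt a b)) (h(y := b))"
proof -
  have "e((Main_Sort, 2 * snd y) := Pt a b) \<in> assignments S"
    using assms by (intro assignments_upd) (auto simp: represents_def univ_S)
  moreover have "h(y := b) \<in> assignments (N a)"
    using assms by (auto simp: represents_def assignments_unit)
  ultimately show ?thesis using assms(1) by (auto simp: represents_def prod_eq_iff)
qed

lemma sat_fibre_tr:
  "wf_fm LN \<phi> \<Longrightarrow> represents c C a e h \<Longrightarrow> fm_syms \<phi> \<subseteq> C \<Longrightarrow> sat S e (fibre_tr c \<phi>) \<longleftrightarrow> sat (N a) h \<phi>"
proof (induction \<phi> arbitrary: e h)
  case (Eq t u)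
  obtain s where s: "has_sort LN t s" "has_sort LN u s" using Eq.prems(1) by auto
  have a: "a \<in> dom1 M" and h: "h \<in> assignments (N a)" using Eq.prems(2) by (simp_all add: represents_def)
  have "sat S (e(temp 0 := b)) (Conj (fibre_trm c t 1 (temp 0)) (fibre_trm c u 1 (temp 0))) \<longleftrightarrow>
      b = Pt a (eval (N a) h t) \<and> b = Pt a (eval (N a) h u)" if b: "b \<in> univ S Main_Sort" for b
  proof -
    have "e(temp 0 := b) \<in> assignments S"
      using Eq.prems(2) b by (intro assignments_upd) (auto simp: represents_def temp_def)
    then have r: "represents c C a (e(temp 0 := b)) h"
      by (intro represents_temp[OF Eq.prems(2)]) auto
    show ?thesis
      using sat_fibre_trm[OF s(1) r, of "temp 0" 1] sat_fibre_trm[OF s(2) r, of "temp 0" 1] Eq.prems(3) by simp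
  qed
  moreover have "Pt a (eval (N a) h t) \<in> univ S Main_Sort"
    using eval_in_univ[OF N[OF a] h s(1)] a by (simp add: univ_S)
  ultimately show ?case by (auto simp: temp_def)
next
  case (Rel P ts)
  have a: "a \<in> dom1 M" and h: "h \<in> assignments (N a)" and e: "e \<in> assignments S"
    using Rel.prems(2) by (simp_all add: represents_def)
  have ts: "list_all2 (has_sort LN) ts (rel_dom LN P)" and P: "P \<in> rels LN" using Rel.prems(1) by auto
  show ?case
  proof (cases "ts = []")
    case True
    then have "Rel P [] \<in> sentences LN" using ts P by (simp add: sentences_def fms_def)
    note f = fibre_fm(3)[OF this, of "base_val e" "((), 0)"]
    have "\<exists>a. e (Base_Sort, n) = Base a" for n using assignmentsD[OF e, of "(Base_Sort, n)"] by (auto simp: univ_S)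
    then have "sat S e (base_fm (fibre_fm ((), 0) (Rel P []))) \<longleftrightarrow> sat M (base_val e) (fibre_fm ((), 0) (Rel P []))"
      by (rule sat_base_fm)
    moreover have "base_val e ((), 0) = a" using Rel.prems(2) by (simp add: represents_def base_val_def)
    moreover have "N a \<Turnstile> Rel P [] \<longleftrightarrow> sat (N a) h (Rel P [])"
      by (rule models_iff_sat) (use N_nonempty[OF a] in auto)
    ultimately show ?thesis using True f a by simp
  next
    case False
    let ?l = "length ts"
    have hs: "has_sort LN (ts ! i) (rel_dom LN P ! i)" if "i < ?l" for i
      using ts that by (simp add: list_all2_conv_all_nth)
    have "sat S e (Exs ((\<lambda>i. temp (0 + i)) ` {..<?l})
       (Conj (Conjs ((\<lambda>i. fibre_trm c (ts ! i) ?l (temp (0 + i))) ` {..<?l}))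
         (Rel (Bullet_Rel P) (map (\<lambda>i. Var (temp (0 + i))) [0..<?l])))) \<longleftrightarrow>
       rel_int (N a) P (map (\<lambda>i. eval (N a) h (ts ! i)) [0..<?l])"
    proof (rule sat_Exs_temp[OF Rel.prems(2), where v = "\<lambda>i. eval (N a) h (ts ! i)"])
      show "eval (N a) h (ts ! i) \<in> dom1 (N a)" if "i < ?l" for i
        using eval_in_univ[OF N[OF a] h hs[OF that]] by simp
      show "sat S e' (fibre_trm c (ts ! i) ?l (temp (0 + i))) \<longleftrightarrow>
          e' (temp (0 + i)) = Pt a (eval (N a) h (ts ! i))"
        if e': "represents c C a e' h" and i: "i < ?l" for e' i
      proof -
        have "trm_syms (ts ! i) \<subseteq> C" using Rel.prems(3) nth_mem[OF i] by auto
        then show ?thesis by (rule sat_fibre_trm[OF hs[OF i] e']) (use i in simp)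
      qed
      fix e' assume e't: "\<And>i. i < ?l \<Longrightarrow> e' (temp (0 + i)) = Pt a (eval (N a) h (ts ! i))"
      let ?bs = "map (\<lambda>i. eval (N a) h (ts ! i)) [0..<?l]"
      have m: "map (\<lambda>i. e' (temp (0 + i))) [0..<?l] = map (Pt a) ?bs"
        using e't by simp
      have ne: "?bs \<noteq> []" using False by simp
      have b: "bullet_rel (dom1 M) N P (map (Pt a) bs) \<longleftrightarrow> rel_int (N a) P bs" if bs: "bs \<noteq> []" for bs
      proof
        assume "bullet_rel (dom1 M) N P (map (Pt a) bs)"
        then obtain a' bs' where *: "map (Pt a) bs = map (Pt a') bs'" "rel_int (N a') P bs'"
          unfolding bullet_rel_def by blast
        have "bs' \<noteq> []" using *(1) bs by auto
        \<comment> \<open>The list is nonempty, so the fibre can be read off from its head.\<close>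
        then have "a = a'" using arg_cong[OF *(1), of hd] bs by (simp add: hd_map)
        moreover have "bs = bs'" using arg_cong[OF *(1), of "map snd_pt"] by (simp add: o_def)
        ultimately show "rel_int (N a) P bs" using *(2) by simp
      next
        assume "rel_int (N a) P bs"
        then show "bullet_rel (dom1 M) N P (map (Pt a) bs)" using a unfolding bullet_rel_def by blast
      qed
      have "map (eval S e') (map (\<lambda>i. Var (temp (0 + i))) [0..<?l]) = map (Pt a) ?bs"
        unfolding m[symmetric] by simp
      then show "sat S e' (Rel (Bullet_Rel P) (map (\<lambda>i. Var (temp (0 + i))) [0..<?l])) \<longleftrightarrow>
          rel_int (N a) P ?bs"
        using b[OF ne] by (simp only: sat.simps rel_int_S)
    qed
    moreover have "map (\<lambda>i. eval (N a) h (ts ! i)) [0..<?l] = map (eval (N a) h) ts"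
      by (rule nth_equalityI) simp_all
    ultimately show ?thesis using False by (simp only: fibre_tr.simps sat.simps if_False)
  qed
next
  case (Neg \<phi>)
  then show ?case by simp
next
  case (Conj \<phi> \<psi>)
  then show ?case by simp
next
  case (Ex y \<phi>)
  have a: "a \<in> dom1 M" and eb: "e (Base_Sort, 0) = Base a" using Ex.prems(2) by (simp_all add: represents_def)
  let ?x = "(Main_Sort, 2 * snd y)"
  have IH: "sat S (e(?x := Pt a b)) (fibre_tr c \<phi>) \<longleftrightarrow> sat (N a) (h(y := b)) \<phi>" if "b \<in> dom1 (N a)" for b
    by (rule Ex.IH[OF _ represents_upd[OF Ex.prems(2) that]]) (use Ex.prems in simp_all)
  have "sat S e (fibre_tr c (Ex y \<phi>)) \<longleftrightarrow>
     (\<exists>p\<in>univ S Main_Sort. fst_pt p = a \<and> sat S (e(?x := p)) (fibre_tr c \<phi>))"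
    using eb by simp
  also have "\<dots> \<longleftrightarrow> (\<exists>b\<in>dom1 (N a). sat S (e(?x := Pt a b)) (fibre_tr c \<phi>))"
  proof
    assume "\<exists>p\<in>univ S Main_Sort. fst_pt p = a \<and> sat S (e(?x := p)) (fibre_tr c \<phi>)"
    then obtain p where p: "p \<in> univ S Main_Sort" "fst_pt p = a" "sat S (e(?x := p)) (fibre_tr c \<phi>)" by blast
    then obtain b where "p = Pt a b" "b \<in> dom1 (N a)" by (auto simp: univ_S)
    with p(3) show "\<exists>b\<in>dom1 (N a). sat S (e(?x := Pt a b)) (fibre_tr c \<phi>)" by blast
  next
    assume "\<exists>b\<in>dom1 (N a). sat S (e(?x := Pt a b)) (fibre_tr c \<phi>)"
    then obtain b where "b \<in> dom1 (N a)" "sat S (e(?x := Pt a b)) (fibre_tr c \<phi>)" by blast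
    then show "\<exists>p\<in>univ S Main_Sort. fst_pt p = a \<and> sat S (e(?x := p)) (fibre_tr c \<phi>)"
      using a by (intro bexI[of _ "Pt a b"]) (simp_all add: univ_S)
  qed
  also have "\<dots> \<longleftrightarrow> sat (N a) h (Ex y \<phi>)" using IH by simp
  finally show ?case .
qed

end

section \<open>Sorts of the translated formulas, and patterns of the fibres in the product\<close>

context lex_sum
begin

lemma incl_sort: "fst z = Main_Sort \<Longrightarrow> has_sort LS (Fn Incl [Var z]) Main_Undet_Sort"
  using has_sort.intros(2)[of Incl LS "[Var z]"] has_sort.intros(1)[of LS z] by (simp add: lex_lang_def)

lemma proj_sort: "fst z = Main_Sort \<Longrightarrow> has_sort LS (Fn Proj [Var z]) Base_Sort"
  using has_sort.intros(2)[of Proj LS "[Var z]"] has_sort.intros(1)[of LS z] by (simp add: lex_lang_def)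

lemma var_sort: "has_sort LS (Var (s, n)) s"
  using has_sort.intros(1)[of LS "(s, n)"] by simp

lemma temp_vars_sort:
  "l = length ds \<Longrightarrow> list_all2 (has_sort LS) (map (\<lambda>i. Var (temp (m + i))) [0..<l]) (map (\<lambda>_. Main_Sort) ds)"
  by (simp add: list_all2_conv_all_nth temp_def var_sort)

lemma fibre_trm_wf:
  "has_sort LN t s \<Longrightarrow> fst z = Main_Sort \<Longrightarrow> wf_fm LS (fibre_trm c t m z)"
proof (induction t arbitrary: s m z)
  case (Var y)
  have "has_sort LS (Var z) Main_Sort" using has_sort.intros(1)[of LS z] Var(2) by simp
  then show ?case using var_sort[of Main_Sort] by (auto intro!: exI[of _ Main_Sort])
next
  case (Fn g ts)
  from Fn.prems(1) have g: "g \<in> funs LN" and ts: "list_all2 (has_sort LN) ts (fun_dom LN g)"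
    by (auto elim: has_sort.cases)
  show ?case
  proof (cases "ts = []")
    case True
    then show ?thesis using var_sort[of Main_Undet_Sort "c g"] incl_sort[OF Fn.prems(2)] by auto
  next
    case False
    let ?l = "length ts"
    have "wf_fm LS ((map (fibre_trm c) ts ! i) (m + ?l) (temp (m + i)))" if i: "i < ?l" for i
    proof -
      have "has_sort LN (ts ! i) (fun_dom LN g ! i)" using ts i by (simp add: list_all2_conv_all_nth)
      then have "wf_fm LS (fibre_trm c (ts ! i) (m + ?l) (temp (m + i)))"
        by (rule Fn.IH[OF nth_mem[OF i]]) (simp add: temp_def)
      then show ?thesis using i by simp
    qed
    then have 1: "wf_fm LS (Conjs ((\<lambda>i. (map (fibre_trm c) ts ! i) (m + ?l) (temp (m + i))) ` {..<?l}))"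
      by (intro wf_Conjs) auto
    have "Bullet_Fun g \<in> funs LS" using g by (simp add: lex_lang_def)
    moreover have "list_all2 (has_sort LS) (map (\<lambda>i. Var (temp (m + i))) [0..<?l]) (fun_dom LS (Bullet_Fun g))"
      using temp_vars_sort[OF list_all2_lengthD[OF ts]] by (simp add: lex_lang_def)
    ultimately have "has_sort LS (Fn (Bullet_Fun g) (map (\<lambda>i. Var (temp (m + i))) [0..<?l])) (fun_cod LS (Bullet_Fun g))"
      by (rule has_sort.intros(2))
    then have 2: "has_sort LS (Fn (Bullet_Fun g) (map (\<lambda>i. Var (temp (m + i))) [0..<?l])) Main_Undet_Sort"
      by (simp add: lex_lang_def)
    show ?thesis
      unfolding fibre_trm.simps if_not_P[OF False] wf_Exs wf_fm.simps
      using 1 2 incl_sort[OF Fn.prems(2)] by (intro conjI exI[of _ Main_Undet_Sort])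
  qed
qed

lemma fibre_tr_wf: "wf_fm LN \<phi> \<Longrightarrow> wf_fm LS (fibre_tr c \<phi>)"
proof (induction \<phi>)
  case (Eq t u)
  then obtain s where "has_sort LN t s" "has_sort LN u s" by auto
  then show ?case using fibre_trm_wf[of t s "temp 0" c 1] fibre_trm_wf[of u s "temp 0" c 1] by (simp add: temp_def)
next
  case (Rel P ts)
  have ts: "list_all2 (has_sort LN) ts (rel_dom LN P)" and P: "P \<in> rels LN" using Rel by auto
  show ?case
  proof (cases "ts = []")
    case True
    then have "Rel P [] \<in> sentences LN" using ts P by (simp add: sentences_def fms_def)
    from fibre_fm(1)[OF this] have "wf_fm LM (fibre_fm ((), 0) (Rel P []))" by (simp add: fms_def)
    then show ?thesis using base_fm_wf True by simp
  next
    case False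
    let ?l = "length ts"
    have "wf_fm LS (fibre_trm c (ts ! i) ?l (temp (0 + i)))" if i: "i < ?l" for i
      using ts i by (intro fibre_trm_wf[of _ "rel_dom LN P ! i"]) (simp_all add: list_all2_conv_all_nth temp_def)
    then have 1: "wf_fm LS (Conjs ((\<lambda>i. fibre_trm c (ts ! i) ?l (temp (0 + i))) ` {..<?l}))"
      by (intro wf_Conjs) auto
    have 2: "list_all2 (has_sort LS) (map (\<lambda>i. Var (temp (0 + i))) [0..<?l]) (rel_dom LS (Bullet_Rel P))"
      using temp_vars_sort[OF list_all2_lengthD[OF ts], of 0] by (simp add: lex_lang_def)
    have 3: "Bullet_Rel P \<in> rels LS" using P by (simp add: lex_lang_def)
    show ?thesis
      unfolding fibre_tr.simps if_not_P[OF False] wf_Exs wf_fm.simps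
      using 1 2 3 by (intro conjI)
  qed
next
  case (Ex y \<phi>)
  then show ?case using proj_sort[of "(Main_Sort, 2 * snd y)"] var_sort[of Base_Sort 0] by auto
qed auto

text \<open>The fibre enters only through parameters, namely the base variable \<open>0\<close> and
  the variables for constants, so it may change with the approximation. The first conjunct of
  \<open>\<psi> i\<close> confines solutions to the fibre.\<close>

lemma approximable_fibre:
  assumes \<phi>: "\<And>i. i \<in> I \<Longrightarrow> \<phi> i \<in> fms LN"
    and apx: "\<And>I0 n. finite I0 \<Longrightarrow> I0 \<subseteq> I \<Longrightarrow> \<exists>a\<in>dom1 M. fapprox (N a) x \<phi> k I0 n"
  shows "approximable LS S I"
proof -
  let ?x = "(Main_Sort, 2 * snd x)"
  define c where "c = (\<lambda>i. to_nat_on (fm_syms (\<phi> i)))"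
  define \<psi> where "\<psi> = (\<lambda>i. Conj (Eq (Fn Proj [Var ?x]) (Var (Base_Sort, 0))) (fibre_tr (c i) (\<phi> i)))"
  have "fapprox S ?x \<psi> k I0 n" if I0: "finite I0" "I0 \<subseteq> I" for I0 n
  proof -
    obtain m where m: "m \<in> dom1 M" and "fapprox (N m) x \<phi> k I0 n" using apx[OF I0] by blast
    then obtain a where a: "\<forall>i j. a i j \<in> assignments (N m)"
      and rows: "\<forall>i\<in>I0. \<forall>J\<subseteq>{..n}. card J = k i \<longrightarrow> \<not> (\<exists>b\<in>univ (N m) (fst x). \<forall>j\<in>J. sat (N m) ((a i j)(x := b)) (\<phi> i))"
      and paths: "\<forall>f. (\<forall>i\<in>I0. f i \<le> n) \<longrightarrow> (\<exists>b\<in>univ (N m) (fst x). \<forall>i\<in>I0. sat (N m) ((a i (f i))(x := b)) (\<phi> i))"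
      unfolding approx_def by (elim exE conjE)
    \<comment> \<open>The value of the constant with number \<open>r\<close>;
      \<open>Undetermined\<close> is the default where the decoded symbol is no constant of
      \<open>LN\<close>.\<close>
    define cv where "cv = (\<lambda>i r. let g = from_nat_into (fm_syms (\<phi> i)) r in
       if g \<in> funs LN \<and> fun_dom LN g = [] then Pt m (fun_int (N m) g []) else Undetermined)"
    define A where "A = (\<lambda>i j (v :: lex_sort var). case fst v of Main_Sort \<Rightarrow> Pt m (a i j ((), snd v div 2))
       | Base_Sort \<Rightarrow> Base m | Main_Undet_Sort \<Rightarrow> cv i (snd v))"
    have cvu: "cv i r \<in> univ S Main_Undet_Sort" for i r
    proof -
      have "fun_int (N m) g [] \<in> dom1 (N m)" if "g \<in> funs LN" "fun_dom LN g = []" for g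
        using N[OF m] that by (simp add: is_struct_def)
      then show ?thesis using m by (simp add: cv_def Let_def univ_S)
    qed
    have A: "A i j \<in> assignments S" for i j
    proof -
      have "A i j v \<in> univ S (fst v)" for v
        using a m cvu by (cases "fst v") (simp_all add: A_def univ_S assignments_unit)
      then show ?thesis by (simp add: assignments_def)
    qed
    have rep: "represents (c i) (fm_syms (\<phi> i)) m (A i j) (a i j)" for i j
    proof -
      have "A i j (Main_Undet_Sort, c i g) = Pt m (fun_int (N m) g [])"
        if "g \<in> fm_syms (\<phi> i)" "g \<in> funs LN" "fun_dom LN g = []" for g
        using that by (simp add: A_def cv_def c_def countable_finite)
      moreover have "A i j (Main_Sort, 2 * snd y) = Pt m (a i j y)" for y
      proof -
        have "((), snd y) = y" by (simp add: prod_eq_iff)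
        then show ?thesis by (simp add: A_def)
      qed
      moreover have "A i j (Base_Sort, 0) = Base m" by (simp add: A_def)
      moreover have "a i j \<in> assignments (N m)" using a by blast
      ultimately show ?thesis using m A unfolding represents_def by simp
    qed
    have s: "sat S ((A i j)(?x := p)) (\<psi> i) \<longleftrightarrow> (\<exists>b\<in>dom1 (N m). p = Pt m b \<and> sat (N m) ((a i j)(x := b)) (\<phi> i))"
      if i: "i \<in> I0" and p: "p \<in> univ S Main_Sort" for i j p
    proof -
      have "sat S ((A i j)(?x := p)) (Eq (Fn Proj [Var ?x]) (Var (Base_Sort, 0))) \<longleftrightarrow> fst_pt p = m"
        by (simp add: A_def)
      also have "\<dots> \<longleftrightarrow> (\<exists>b\<in>dom1 (N m). p = Pt m b)" using p by (auto simp: univ_S)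
      finally have 1: "sat S ((A i j)(?x := p)) (\<psi> i) \<longleftrightarrow>
          (\<exists>b\<in>dom1 (N m). p = Pt m b) \<and> sat S ((A i j)(?x := p)) (fibre_tr (c i) (\<phi> i))"
        unfolding \<psi>_def sat.simps(4) by (rule arg_cong2[OF _ refl])
      have 2: "sat S ((A i j)(?x := Pt m b)) (fibre_tr (c i) (\<phi> i)) \<longleftrightarrow> sat (N m) ((a i j)(x := b)) (\<phi> i)"
        if "b \<in> dom1 (N m)" for b
        by (rule sat_fibre_tr[OF _ represents_upd[OF rep that]]) (use \<phi> i I0(2) in \<open>auto simp: fms_def\<close>)
      show ?thesis
      proof (cases "\<exists>b\<in>dom1 (N m). p = Pt m b")
        case True
        then obtain b where b: "b \<in> dom1 (N m)" "p = Pt m b" by blast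
        then show ?thesis using 1 2[OF b(1)] True by simp
      qed (use 1 in blast)
    qed
    show ?thesis
      unfolding approx_def
    proof (intro exI[of _ A] conjI allI ballI impI)
      show "A i j \<in> assignments S" for i j by (rule A)
    next
      fix i J assume i: "i \<in> I0" and J: "J \<subseteq> {..n}" "card J = k i"
      have r: "\<not> (\<exists>b\<in>dom1 (N m). \<forall>j\<in>J. sat (N m) ((a i j)(x := b)) (\<phi> i))"
        using rows i J by simp
      show "\<not> (\<exists>b\<in>univ S (fst ?x). \<forall>j\<in>J. sat S ((A i j)(?x := b)) (\<psi> i))"
      proof
        assume "\<exists>b\<in>univ S (fst ?x). \<forall>j\<in>J. sat S ((A i j)(?x := b)) (\<psi> i)"
        then obtain p where p: "p \<in> univ S Main_Sort" "\<forall>j\<in>J. sat S ((A i j)(?x := p)) (\<psi> i)" by auto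
        have pj: "\<exists>b\<in>dom1 (N m). p = Pt m b \<and> sat (N m) ((a i j)(x := b)) (\<phi> i)" if "j \<in> J" for j
          using p(2) that s[OF i p(1)] by blast
        \<comment> \<open>For empty \<open>J\<close> every element of the fibre would be a common
          solution, contrary to \<open>r\<close>. Any column in \<open>J\<close> then shows that
          \<open>p\<close> lies in the fibre.\<close>
        have "J \<noteq> {}" using r N_nonempty[OF m] by blast
        then obtain b where b: "b \<in> dom1 (N m)" "p = Pt m b" using pj by blast
        have "sat (N m) ((a i j)(x := b)) (\<phi> i)" if "j \<in> J" for j using pj[OF that] b(2) by auto
        then show False using r b(1) by blast
      qed
    next
      fix f assume "\<forall>i\<in>I0. f i \<le> n"
      then obtain b where b: "b \<in> dom1 (N m)" "\<forall>i\<in>I0. sat (N m) ((a i (f i))(x := b)) (\<phi> i)"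
        using paths by auto
      have p: "Pt m b \<in> univ S Main_Sort" using m b(1) by (simp add: univ_S)
      have "sat S ((A i (f i))(?x := Pt m b)) (\<psi> i)" if "i \<in> I0" for i
        unfolding s[OF that p] using b that by blast
      then show "\<exists>b\<in>univ S (fst ?x). \<forall>i\<in>I0. sat S ((A i (f i))(?x := b)) (\<psi> i)"
        using p by (intro bexI[of _ "Pt m b"]) simp_all
    qed
  qed
  moreover have "\<psi> i \<in> fms LS" if "i \<in> I" for i
  proof -
    have "wf_fm LS (fibre_tr (c i) (\<phi> i))" using fibre_tr_wf \<phi>[OF that] by (simp add: fms_def)
    then show ?thesis
      using proj_sort[of ?x] var_sort[of Base_Sort 0] by (auto simp: \<psi>_def fms_def)
  qed
  ultimately show ?thesis
    unfolding approximable_def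
    by (intro exI[of _ ?x] exI[of _ \<psi>] exI[of _ k] conjI ballI allI impI)
qed

section \<open>The burden of a lexicographic product\<close>

context
  fixes U :: "(unit, 'f, 'p) fm set \<Rightarrow> 'a filter"
  assumes U: "\<And>\<rho>. \<rho> \<in> S1 LM M \<Longrightarrow> ultrafilter_on (dom1 M) (U \<rho>)"
    and U\<rho>: "\<And>\<rho> \<phi>. \<rho> \<in> S1 LM M \<Longrightarrow> \<phi> \<in> \<rho> \<Longrightarrow> eventually (\<lambda>a. a \<in> solutions M \<phi>) (U \<rho>)"
begin

abbreviation "N_type \<rho> \<equiv> ultraproduct (dom1 M) (U \<rho>) N"

lemma is_struct_N_type: "\<rho> \<in> S1 LM M \<Longrightarrow> is_struct LN (N_type \<rho>)"
  unfolding ultraproduct_eq_uprod[of _ _ _ LN] by (rule is_struct_uprod[OF U N])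

lemma models_N_type:
  "\<rho> \<in> S1 LM M \<Longrightarrow> \<sigma> \<in> sentences LN \<Longrightarrow> N_type \<rho> \<Turnstile> \<sigma> \<longleftrightarrow> eventually (\<lambda>a. N a \<Turnstile> \<sigma>) (U \<rho>)"
  unfolding ultraproduct_eq_uprod[of _ _ _ LN] by (rule models_uprod[OF U N])

lemma fibre_type_approximable:
  assumes "fibre_type I \<rho>"
  shows "\<rho> \<in> S1 LM M" "approximable LN (N_type \<rho>) I"
proof -
  from assms obtain z \<psi> k where \<rho>: "\<rho> \<in> S1 LM M" and \<psi>: "\<forall>i\<in>I. \<psi> i \<in> fms LN"
    and *: "\<forall>I0 n. finite I0 \<longrightarrow> I0 \<subseteq> I \<longrightarrow> (\<exists>\<delta>\<in>\<rho>. solutions M \<delta> = {a \<in> dom1 M. N a \<Turnstile> approx_sentence z \<psi> k I0 n})"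
    unfolding fibre_type_def by (elim exE conjE)
  show "\<rho> \<in> S1 LM M" by (rule \<rho>)
  have "fapprox (N_type \<rho>) z \<psi> k I0 n" if I0: "finite I0" "I0 \<subseteq> I" for I0 n
  proof -
    obtain \<delta> where \<delta>: "\<delta> \<in> \<rho>" "solutions M \<delta> = {a \<in> dom1 M. N a \<Turnstile> approx_sentence z \<psi> k I0 n}" using * I0 by blast
    have "eventually (\<lambda>a. N a \<Turnstile> approx_sentence z \<psi> k I0 n) (U \<rho>)"
      using U\<rho>[OF \<rho> \<delta>(1)] unfolding \<delta>(2) by (rule eventually_mono) blast
    moreover have "approx_sentence z \<psi> k I0 n \<in> sentences LN"
      by (rule approx_sentence_sentences[OF I0(1)]) (use \<psi> I0(2) in blast)
    ultimately have "N_type \<rho> \<Turnstile> approx_sentence z \<psi> k I0 n" using models_N_type[OF \<rho>] by blast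
    then show ?thesis
      unfolding models_approx_sentence[OF I0(1) is_struct_nonempty[OF is_struct_N_type[OF \<rho>]]] .
  qed
  then show "approximable LN (N_type \<rho>) I"
    using \<psi> unfolding approximable_def
    by (intro exI[of _ z] exI[of _ \<psi>] exI[of _ k] conjI allI impI)
qed

lemma approximable_N_type:
  assumes \<rho>: "\<rho> \<in> S1 LM M" and "approximable LN (N_type \<rho>) I"
  shows "approximable LS S I"
proof -
  from assms(2) obtain x \<phi> k where \<phi>: "\<forall>i\<in>I. \<phi> i \<in> fms LN"
    and apx: "\<forall>I0 n. finite I0 \<longrightarrow> I0 \<subseteq> I \<longrightarrow> fapprox (N_type \<rho>) x \<phi> k I0 n"
    unfolding approximable_def by (elim exE conjE)
  show ?thesis
  proof (rule approximable_fibre)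
    show "\<phi> i \<in> fms LN" if "i \<in> I" for i using \<phi> that by blast
    fix I0 n assume I0: "finite I0" "I0 \<subseteq> I"
    have "N_type \<rho> \<Turnstile> approx_sentence x \<phi> k I0 n"
      unfolding models_approx_sentence[OF I0(1) is_struct_nonempty[OF is_struct_N_type[OF \<rho>]]] using apx I0 by blast
    moreover have "approx_sentence x \<phi> k I0 n \<in> sentences LN"
      by (rule approx_sentence_sentences[OF I0(1)]) (use \<phi> I0(2) in blast)
    ultimately have "eventually (\<lambda>a. N a \<Turnstile> approx_sentence x \<phi> k I0 n) (U \<rho>)" using models_N_type[OF \<rho>] by blast
    moreover have "eventually (\<lambda>a. a \<in> dom1 M) (U \<rho>)" using U[OF \<rho>] by (simp add: ultrafilter_on_def)
    ultimately have ev: "eventually (\<lambda>a. N a \<Turnstile> approx_sentence x \<phi> k I0 n \<and> a \<in> dom1 M) (U \<rho>)"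
      by (rule eventually_conj)
    have "U \<rho> \<noteq> bot" using U[OF \<rho>] by (simp add: ultrafilter_on_def)
    from eventually_happens'[OF this ev] obtain a where a: "a \<in> dom1 M" "N a \<Turnstile> approx_sentence x \<phi> k I0 n" by blast
    then show "\<exists>a\<in>dom1 M. fapprox (N a) x \<phi> k I0 n"
      unfolding models_approx_sentence[OF I0(1) N_nonempty[OF a(1)]] by blast
  qed
qed

theorem bdn_lex_product:
  "(bdn LS S :: 'u cardinal) = sup (bdn LM M) (SUP \<rho>\<in>S1 LM M. bdn LN (N_type \<rho>))"
proof (rule antisym)
  show "(bdn LS S :: 'u cardinal) \<le> sup (bdn LM M) (SUP \<rho>\<in>S1 LM M. bdn LN (N_type \<rho>))"
    unfolding bdn_eq_Sup_approximable[OF is_struct_S]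
  proof (rule Sup_least)
    fix \<kappa> :: "'u cardinal"
    assume "\<kappa> \<in> {cardinality I | I. approximable LS S I}"
    then obtain I :: "'u set" where \<kappa>: "\<kappa> = cardinality I" and I: "approximable LS S I" by blast
    from approximable_lex_product[OF I] show "\<kappa> \<le> sup (bdn LM M) (SUP \<rho>\<in>S1 LM M. bdn LN (N_type \<rho>))"
    proof
      assume "approximable LM M I"
      then show ?thesis unfolding \<kappa> using cardinality_le_bdn[OF M] by (intro le_supI1)
    next
      assume "\<exists>\<rho>. fibre_type I \<rho>"
      then obtain \<rho> where \<rho>: "fibre_type I \<rho>" by blast
      note f = fibre_type_approximable[OF \<rho>]
      have "\<kappa> \<le> bdn LN (N_type \<rho>)"
        unfolding \<kappa> by (rule cardinality_le_bdn[OF is_struct_N_type[OF f(1)] f(2)])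
      also have "\<dots> \<le> (SUP \<rho>\<in>S1 LM M. bdn LN (N_type \<rho>))" by (rule SUP_upper[OF f(1)])
      finally show ?thesis by (intro le_supI2)
    qed
  qed
next
  \<comment> \<open>Depths are measured by the same subsets of \<open>'u\<close> on both sides, so
    an implication for each \<open>I\<close> gives an inequality of suprema, whatever the types of
    elements.\<close>
  have mono: "(bdn L K :: 'u cardinal) \<le> bdn LS S"
    if "is_struct L K" "\<And>I :: 'u set. approximable L K I \<Longrightarrow> approximable LS S I"
    for L :: "(unit, 'x, 'y) lang" and K :: "(unit, 'x, 'y, 'z) struct"
    unfolding bdn_eq_Sup_approximable[OF that(1)] bdn_eq_Sup_approximable[OF is_struct_S]
    by (rule Sup_subset_mono) (use that(2) in blast)
  show "sup (bdn LM M) (SUP \<rho>\<in>S1 LM M. bdn LN (N_type \<rho>)) \<le> (bdn LS S :: 'u cardinal)"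
    using mono[OF M approximable_base] mono[OF is_struct_N_type approximable_N_type]
    by (intro le_supI SUP_least) blast+
qed

text \<open>A formula defining the set of points whose fibre satisfies \<open>\<sigma>\<close> is
  decided by the complete type \<open>\<rho>\<close>, and in the same way as by its realisation
  \<open>a\<close>; so its solution set is in the ultrafilter. Negations give the other
  inclusion.\<close>

lemma Th_realised:
  assumes \<rho>: "\<rho> \<in> S1 LM M" and a: "a \<in> dom1 M" "\<And>\<theta>. \<theta> \<in> \<rho> \<Longrightarrow> a \<in> solutions M \<theta>"
  shows "Th LN (N_type \<rho>) = Th LN (N a)"
proof -
  have imp: "N_type \<rho> \<Turnstile> \<sigma>" if \<sigma>: "\<sigma> \<in> sentences LN" "N a \<Turnstile> \<sigma>" for \<sigma>
  proof -
    obtain \<delta> where \<delta>: "\<delta> \<in> fms1 LM" "{a \<in> dom1 M. N a \<Turnstile> \<sigma>} = solutions M \<delta>"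
      using definable[OF \<sigma>(1)] unfolding definable0_def by blast
    have "a \<in> solutions M \<delta>" unfolding \<delta>(2)[symmetric] using a(1) \<sigma>(2) by blast
    then have "Neg \<delta> \<notin> \<rho>" using a(2)[of "Neg \<delta>"] by (auto simp: solutions_def)
    then have "\<delta> \<in> \<rho>" using \<rho> \<delta>(1) unfolding S1_def by blast
    from U\<rho>[OF \<rho> this] have "eventually (\<lambda>a. N a \<Turnstile> \<sigma>) (U \<rho>)"
      unfolding \<delta>(2)[symmetric] by (rule eventually_mono) blast
    then show ?thesis using models_N_type[OF \<rho> \<sigma>(1)] by blast
  qed
  have "N_type \<rho> \<Turnstile> \<sigma> \<longleftrightarrow> N a \<Turnstile> \<sigma>" if \<sigma>: "\<sigma> \<in> sentences LN" for \<sigma>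
    using imp[OF \<sigma>] imp[OF Neg_sentences[OF \<sigma>]] models_Neg[OF \<sigma> N_nonempty[OF a(1)]]
      models_Neg[OF \<sigma> is_struct_nonempty[OF is_struct_N_type[OF \<rho>]]] by blast
  then show ?thesis unfolding Th_def by blast
qed

text \<open>\<open>bdn\<close> refers to the structure only through its theory, so the two types of
  elements may differ.\<close>

lemma bdn_Th:
  fixes K :: "('s, 'h, 'r, 'x) struct" and K' :: "('s, 'h, 'r, 'y) struct"
  assumes "Th L K = Th L K'"
  shows "(bdn L K :: 'u cardinal) = bdn L K'"
  unfolding bdn_def assms ..

lemma type_of_point:
  assumes a: "a \<in> dom1 M"
  shows "{\<theta> \<in> fms1 LM. a \<in> solutions M \<theta>} \<in> S1 LM M"
  unfolding S1_def
proof (intro CollectI conjI allI impI ballI)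
  show "\<exists>a\<in>dom1 M. \<forall>\<phi>\<in>q. a \<in> solutions M \<phi>" if "q \<subseteq> {\<theta> \<in> fms1 LM. a \<in> solutions M \<theta>}" for q
    using a that by blast
  show "\<phi> \<in> {\<theta> \<in> fms1 LM. a \<in> solutions M \<theta>} \<or> Neg \<phi> \<in> {\<theta> \<in> fms1 LM. a \<in> solutions M \<theta>}"
    if "\<phi> \<in> fms1 LM" for \<phi>
    using that a by (auto simp: solutions_def fms1_def fms_def)
qed blast

text \<open>\<open>\<rho>\<close> is a partial type over the empty set, and saturation bounds the
  number of parameters, not of formulas. The dummy assignment is harmless, since the formulas of
  \<open>\<rho>\<close> have at most one free variable.\<close>

lemma saturated_realises:
  assumes sat: "saturated (cardSuc |fms LN| ) LM M" and \<rho>: "\<rho> \<in> S1 LM M"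
  shows "\<exists>a\<in>dom1 M. \<forall>\<theta>\<in>\<rho>. a \<in> solutions M \<theta>"
proof -
  let ?x = "((), 0 :: nat)" and ?e = "\<lambda>_ :: unit var. undefined :: 'a"
  have \<rho>1: "\<rho> \<subseteq> fms1 LM" and fin: "\<And>q. q \<subseteq> \<rho> \<Longrightarrow> finite q \<Longrightarrow> \<exists>a\<in>dom1 M. \<forall>\<phi>\<in>q. a \<in> solutions M \<phi>"
    using \<rho> unfolding S1_def by blast+
  have s: "sat M (?e(?x := b)) \<phi> \<longleftrightarrow> b \<in> solutions M \<phi>" if "\<phi> \<in> \<rho>" "b \<in> dom1 M" for \<phi> b
  proof -
    have "fv \<phi> \<subseteq> {?x}" using that(1) \<rho>1 by (auto simp: fms1_def)
    then have "sat M (?e(?x := b)) \<phi> \<longleftrightarrow> sat M (\<lambda>_. b) \<phi>" by (intro sat_cong) auto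
    then show ?thesis using that(2) by (simp add: solutions_def)
  qed
  let ?p = "(\<lambda>\<phi>. (\<phi>, ?e)) ` \<rho>"
  have "|{} :: 'a set| \<le>o |fms LN|" by (rule card_of_empty)
  moreover have "|fms LN| <o cardSuc |fms LN|" by (rule cardSuc_greater) (rule card_of_Card_order)
  ultimately have "|{} :: 'a set| <o cardSuc |fms LN|" by (rule ordLeq_ordLess_trans)
  moreover have "partial_type LM M ?x {} ?p"
    unfolding partial_type_def
  proof (intro conjI allI impI ballI)
    fix pe assume "pe \<in> ?p"
    then obtain \<phi> where \<phi>: "pe = (\<phi>, ?e)" "\<phi> \<in> \<rho>" by blast
    have "\<phi> \<in> fms LM" "fv \<phi> - {?x} = {}" using \<phi>(2) \<rho>1 by (auto simp: fms1_def)
    then show "case pe of (\<phi>, e) \<Rightarrow> \<phi> \<in> fms LM \<and> (\<forall>y\<in>fv \<phi> - {?x}. e y \<in> univ M (fst y) \<inter> {})"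
      unfolding \<phi>(1) prod.case by blast
  next
    fix q assume q: "q \<subseteq> ?p" "finite q"
    have sub: "fst ` q \<subseteq> \<rho>" using q(1) by auto
    obtain a where a: "a \<in> dom1 M" "\<forall>\<phi>\<in>fst ` q. a \<in> solutions M \<phi>"
      using fin[OF sub] q(2) by blast
    have "sat M (e(?x := a)) \<phi>" if "(\<phi>, e) \<in> q" for \<phi> e
    proof -
      have "e = ?e" "\<phi> \<in> \<rho>" using that q(1) by auto
      moreover have "a \<in> solutions M \<phi>" using a(2) that by force
      ultimately show ?thesis using s a(1) by blast
    qed
    then show "\<exists>b\<in>univ M (fst ?x). \<forall>(\<phi>, e)\<in>q. sat M (e(?x := b)) \<phi>" using a(1) by auto
  qed
  ultimately have "\<exists>b\<in>univ M (fst ?x). \<forall>(\<phi>, e)\<in>?p. sat M (e(?x := b)) \<phi>"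
    using sat unfolding saturated_def by blast
  then obtain b where b: "b \<in> dom1 M" "\<forall>(\<phi>, e)\<in>?p. sat M (e(?x := b)) \<phi>" by auto
  have "b \<in> solutions M \<theta>" if "\<theta> \<in> \<rho>" for \<theta>
    using b(2) that s[OF that b(1)] by auto
  then show ?thesis using b(1) by blast
qed

text \<open>Every type is realised by a point, and every point realises its own type; in both cases
  the theories, and hence the burdens, agree.\<close>

lemma SUP_bdn_saturated:
  assumes "saturated (cardSuc |fms LN| ) LM M"
  shows "(SUP \<rho>\<in>S1 LM M. bdn LN (N_type \<rho>) :: 'u cardinal) = (SUP a\<in>dom1 M. bdn LN (N a))"
proof (rule antisym)
  show "(SUP \<rho>\<in>S1 LM M. bdn LN (N_type \<rho>) :: 'u cardinal) \<le> (SUP a\<in>dom1 M. bdn LN (N a))"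
  proof (rule SUP_least)
    fix \<rho> assume \<rho>: "\<rho> \<in> S1 LM M"
    obtain a where a: "a \<in> dom1 M" "\<forall>\<theta>\<in>\<rho>. a \<in> solutions M \<theta>" using saturated_realises[OF assms \<rho>] by blast
    have "Th LN (N_type \<rho>) = Th LN (N a)" by (rule Th_realised[OF \<rho> a(1)]) (use a(2) in blast)
    then have "(bdn LN (N_type \<rho>) :: 'u cardinal) = bdn LN (N a)" by (rule bdn_Th)
    then show "(bdn LN (N_type \<rho>) :: 'u cardinal) \<le> (SUP a\<in>dom1 M. bdn LN (N a))"
      using SUP_upper[OF a(1), of "\<lambda>a. bdn LN (N a) :: 'u cardinal"] by simp
  qed
  show "(SUP a\<in>dom1 M. bdn LN (N a)) \<le> (SUP \<rho>\<in>S1 LM M. bdn LN (N_type \<rho>) :: 'u cardinal)"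
  proof (rule SUP_least)
    fix a assume a: "a \<in> dom1 M"
    let ?\<rho> = "{\<theta> \<in> fms1 LM. a \<in> solutions M \<theta>}"
    have "Th LN (N_type ?\<rho>) = Th LN (N a)" by (rule Th_realised[OF type_of_point[OF a] a]) blast
    then have "(bdn LN (N_type ?\<rho>) :: 'u cardinal) = bdn LN (N a)" by (rule bdn_Th)
    then show "(bdn LN (N a) :: 'u cardinal) \<le> (SUP \<rho>\<in>S1 LM M. bdn LN (N_type \<rho>))"
      using SUP_upper[OF type_of_point[OF a], of "\<lambda>\<rho>. bdn LN (N_type \<rho>) :: 'u cardinal"] by simp
  qed
qed

end

end

theorem theorem2p16:
  fixes LM :: "(unit, 'f, 'p) lang" and LN :: "(unit, 'g, 'q) lang"
    and M :: "(unit, 'f, 'p, 'a) struct"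
    and N :: "'a \<Rightarrow> (unit, 'g, 'q, 'b) struct"
    and U :: "(unit, 'f, 'p) fm set \<Rightarrow> 'a filter"
  assumes "is_struct LM M"
    and "\<And>a. a \<in> dom1 M \<Longrightarrow> is_struct LN (N a)"
    and "\<And>\<phi>. \<phi> \<in> sentences LN \<Longrightarrow> definable0 LM M {a \<in> dom1 M. N a \<Turnstile> \<phi>}"
    and "\<And>\<rho>. \<rho> \<in> S1 LM M \<Longrightarrow> ultrafilter_on (dom1 M) (U \<rho>)"
    and "\<And>\<rho> \<phi>. \<rho> \<in> S1 LM M \<Longrightarrow> \<phi> \<in> \<rho> \<Longrightarrow> eventually (\<lambda>a. a \<in> solutions M \<phi>) (U \<rho>)"
  shows "(bdn (lex_lang LM LN) (lex_product M N) :: 'u cardinal) =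
           sup (bdn LM M) (SUP \<rho>\<in>S1 LM M. bdn LN (ultraproduct (dom1 M) (U \<rho>) N))
       \<and> (saturated (cardSuc |fms LN| ) LM M \<longrightarrow>
           (bdn (lex_lang LM LN) (lex_product M N) :: 'u cardinal) =
           sup (bdn LM M) (SUP a\<in>dom1 M. bdn LN (N a)))"
proof -
  interpret lex_sum LM LN M N
    by (rule lex_sum.intro[OF assms(1-3)])
  have bdn: "(bdn LS S :: 'u cardinal) =
      sup (bdn LM M) (SUP \<rho>\<in>S1 LM M. bdn LN (ultraproduct (dom1 M) (U \<rho>) N))"
    by (rule bdn_lex_product[OF assms(4,5)])
  moreover have "(SUP \<rho>\<in>S1 LM M. bdn LN (ultraproduct (dom1 M) (U \<rho>) N) :: 'u cardinal) =
      (SUP a\<in>dom1 M. bdn LN (N a))" if "saturated (cardSuc |fms LN| ) LM M"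
    by (rule SUP_bdn_saturated[OF assms(4,5) that])
  ultimately show ?thesis by metis
qed

end
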